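(* For $d+2$ points drawn independently from the standard normal distribution in $\mathbb{R}^d$, the probability $\Pr(X_d \neq 1)$ that the points are in convex position satisfies, as $d \to \infty$, $$1 - \Pr(X_d \neq 1) \sim 2\left(\frac{e^{d}}{2\,(d+2)^{d-2}\,(2\pi)^{d+1}}\right)^{1/2}.$$
   Context: Here $a_d \sim b_d$ means $\lim_{d\to\infty} a_d/b_d = 1$. Points are in convex position if none of them lies in the convex hull of the others. Radon's theorem: any $d+2$ points in $\mathbb{R}^d$ can be partitioned into two sets whose convex hulls intersect; such a partition is called a Radon partition, and if the points are in general position it is unique up to swapping the two sets. $X_d$ is the random variable equal to the number of points in the smaller side of the (almost surely unique) Radon partition of $d+2$ independent standard Gaussian points in $\mathbb{R}^d$; thus, almost surely, the points are in convex position if and only if $X_d \neq 1$. *)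

theory Defs
  imports
    "HOL-Probability.Probability"
    "HOL-Library.Landau_Symbols"
    "HOL-Library.Function_Algebras"
begin

text \<open>
  The dimension \<open>d\<close> is a variable of the statement, so it cannot be a type index. Points of
  \<open>\<real>\<^sup>d\<close> are functions \<open>nat \<Rightarrow> real\<close> from the carrier \<open>{..<d} \<rightarrow>\<^sub>E UNIV\<close> of the product measure.
  The pointwise vector space structure on functions makes the library's \<open>convex hull\<close> available.
  All points of the carrier have the same (undefined) values outside \<open>{..<d}\<close>, and a convex
  combination of them has these values too, so hulls are those taken in \<open>\<real>\<^sup>d\<close>.
\<close>

instantiation "fun" :: (type, real_vector) real_vector
begin

definition scaleR_fun :: "real \<Rightarrow> ('a \<Rightarrow> 'b) \<Rightarrow> 'a \<Rightarrow> 'b" where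
  "scaleR_fun c f = (\<lambda>x. c *\<^sub>R f x)"

instance
  by standard (simp_all add: scaleR_fun_def fun_eq_iff algebra_simps)

end

definition std_gaussian :: "nat \<Rightarrow> (nat \<Rightarrow> real) measure" where
  "std_gaussian d = (\<Pi>\<^sub>M j\<in>{..<d}. density lborel (\<lambda>x. ennreal (std_normal_density x)))"

definition gaussian_points :: "nat \<Rightarrow> (nat \<Rightarrow> nat \<Rightarrow> real) measure" where
  "gaussian_points d = (\<Pi>\<^sub>M i\<in>{..<d + 2}. std_gaussian d)"

text \<open>
  Configurations are families \<open>p\<close> of points indexed by \<open>N\<close>, so coinciding points count separately.
\<close>

definition convex_position :: "'i set \<Rightarrow> ('i \<Rightarrow> 'a::real_vector) \<Rightarrow> bool" where
  "convex_position N p \<longleftrightarrow> (\<forall>i\<in>N. p i \<notin> convex hull (p ` (N - {i})))"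

definition radon_partition :: "'i set \<Rightarrow> ('i \<Rightarrow> 'a::real_vector) \<Rightarrow> 'i set \<Rightarrow> 'i set \<Rightarrow> bool" where
  "radon_partition N p I J \<longleftrightarrow>
     I \<union> J = N \<and> I \<inter> J = {} \<and> convex hull (p ` I) \<inter> convex hull (p ` J) \<noteq> {}"

text \<open>
  The description is well-defined whenever the Radon partition is unique up to swapping the sides,
  hence almost surely; its value on the remaining null set is irrelevant.
\<close>

definition radon_size :: "nat \<Rightarrow> (nat \<Rightarrow> nat \<Rightarrow> real) \<Rightarrow> nat" where
  "radon_size d p = (THE k. \<exists>I J. radon_partition {..<d + 2} p I J \<and> k = min (card I) (card J))"

end

theory Submission
  imports Defs "HOL-Real_Asymp.Real_Asymp"
begin

text \<open>
  Almost surely the \<open>d + 2\<close> points have exactly one affine dependency up to scaling, and its signs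
  give the Radon partition. A rotation of the index space that turns the all-ones vector into a
  coordinate axis reduces affine dependencies of \<open>d + 2\<close> points to linear dependencies of
  \<open>d + 1\<close> Gaussian points in \<open>\<real>\<^sup>d\<close>. By induction on \<open>d\<close> (rotate one point onto an axis and
  eliminate it) their direction is distributed like that of a standard Gaussian vector. Hence the
  coefficients of the affine dependency behave like those of the centred vector
  \<open>z\<^sub>i - (z\<^sub>0 + \<dots> + z\<^sub>n\<^sub>-\<^sub>1) / n\<close>, where \<open>n = d + 2\<close> and \<open>z\<close> is standard Gaussian.

  The points fail to be in convex position iff one coefficient differs in sign from all others,
  so that probability is \<open>2 n\<close> times the probability that \<open>n - 1\<close> given coordinates of \<open>z\<close> lie below
  the mean. The latter is a Gaussian integral over the orthant \<open>y \<ge> 0\<close> in \<open>\<real>\<^sup>n\<^sup>-\<^sup>1\<close> with exponent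
  \<open>- (s\<^sup>2 + q) / 2\<close>, where \<open>s\<close> is the sum of the coordinates of \<open>y\<close> and \<open>q\<close> that of their squares.
  By moments of the Dirichlet distribution \<open>q / 2\<close> concentrates at 1, which gives the factor
  \<open>exp (- 1)\<close>, and the integral over \<open>s\<close> is evaluated by Laplace's method.
\<close>

text \<open>The obstacle in the induction is the coefficient of the eliminated point
  \<open>c\<close>. It is a linear form in the remaining coefficients \<open>z\<close>, divided by
  the norm of \<open>c\<close>, so given \<open>z\<close> it is a standard normal variable times |z|
  / |c| instead of a standard normal one. Three facts remove this factor: the events are blind to a
  common scaling of all coefficients, |z| and |c| have the same law, and |z| is independent of the
  direction of \<open>z\<close>. The last one is the purpose of the polar decomposition.

  Events have the form "some nontrivial dependency lies in \<open>A\<close>" for a closed set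
  \<open>A\<close> invariant under nonzero scalars. Nothing is selected, and measurability follows
  from closedness. Uniqueness of the Radon partition is then deduced from the probabilities alone:
  they agree with those of the Gaussian model for two sign patterns and for their union, and in the
  model two different patterns overlap in a null set, so by additivity they do so for the points
  too.\<close>

abbreviation std_normal :: "real measure" where
  "std_normal \<equiv> density lborel (\<lambda>x. ennreal (std_normal_density x))"

definition iid_normal :: "'k set \<Rightarrow> ('k \<Rightarrow> real) measure" where
  "iid_normal K = (\<Pi>\<^sub>M k\<in>K. std_normal)"

lemma prob_space_std_normal: "prob_space std_normal"
  by (rule prob_space_normal_density) simp

interpretation std_normal: prob_space std_normal
  by (rule prob_space_std_normal)

lemma product_sigma_finite_std_normal: "product_sigma_finite (\<lambda>_. std_normal)"
  by (simp add: product_sigma_finite_def prob_space_std_normal prob_space_imp_sigma_finite)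

lemma product_sigma_finite_lborel: "product_sigma_finite (\<lambda>_. lborel)"
  by (simp add: product_sigma_finite_def lborel.sigma_finite_measure_axioms)

lemma prob_space_iid_normal: "prob_space (iid_normal K)"
  unfolding iid_normal_def by (intro prob_space_PiM prob_space_std_normal)

abbreviation borel_Pi :: "'k set \<Rightarrow> ('k \<Rightarrow> real) measure" where
  "borel_Pi K \<equiv> Pi\<^sub>M K (\<lambda>_. borel)"

lemma sets_iid_normal [measurable_cong]: "sets (iid_normal K) = sets (borel_Pi K)"
  unfolding iid_normal_def by (intro sets_PiM_cong) auto

lemma space_iid_normal: "space (iid_normal K) = PiE K (\<lambda>_. UNIV)"
  by (simp add: iid_normal_def space_PiM)

section \<open>One and two independent standard normal variables\<close>

lemma nn_integral_std_normal:
  assumes "f \<in> borel_measurable borel"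
  shows "(\<integral>\<^sup>+x. f x \<partial>std_normal) = (\<integral>\<^sup>+x. ennreal (std_normal_density x) * f x \<partial>lborel)"
  using assms by (intro nn_integral_density) auto

lemma std_normal_density_rotate:
  assumes "c\<^sup>2 + s\<^sup>2 = 1"
  shows "std_normal_density (c * x - s * y) * std_normal_density (s * x + c * y) =
         std_normal_density x * std_normal_density y"
proof -
  have "(c * x - s * y)\<^sup>2 + (s * x + c * y)\<^sup>2 = (c\<^sup>2 + s\<^sup>2) * (x\<^sup>2 + y\<^sup>2)"
    by (simp add: power2_eq_square algebra_simps)
  then have *: "(c * x - s * y)\<^sup>2 + (s * x + c * y)\<^sup>2 = x\<^sup>2 + y\<^sup>2"
    using assms by simp
  have "exp (- (c * x - s * y)\<^sup>2 / 2) * exp (- (s * x + c * y)\<^sup>2 / 2) = exp (- x\<^sup>2 / 2) * exp (- y\<^sup>2 / 2)"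
    unfolding exp_add[symmetric] using * by (simp add: field_simps)
  then show ?thesis
    unfolding std_normal_density_def by simp
qed

text \<open>Stated for an arbitrary sign \<open>s\<close>, so that it covers the degenerate rotation
  with \<open>c = 0\<close> as well as the undetermined sign that remains after a vector has been
  rotated onto an axis.\<close>

lemma nn_integral_std_normal_reflect:
  assumes [measurable]: "f \<in> borel_measurable borel" and s: "s\<^sup>2 = 1"
  shows "(\<integral>\<^sup>+x. f (s * x) \<partial>std_normal) = (\<integral>\<^sup>+x. f x \<partial>std_normal)"
proof -
  have s': "\<bar>s\<bar> = 1" "s \<noteq> 0" using s by (auto simp: power2_eq_1_iff)
  have "(\<integral>\<^sup>+x. f x \<partial>std_normal) = (\<integral>\<^sup>+x. ennreal (std_normal_density x) * f x \<partial>lborel)"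
    by (simp add: nn_integral_std_normal)
  also have "\<dots> = (\<integral>\<^sup>+x. ennreal (std_normal_density (0 + s * x)) * f (0 + s * x) \<partial>lborel)"
    using s' by (subst nn_integral_real_affine[where t = 0 and c = s]) auto
  also have "\<dots> = (\<integral>\<^sup>+x. ennreal (std_normal_density x) * f (s * x) \<partial>lborel)"
    using s by (simp add: std_normal_density_def power_mult_distrib)
  also have "\<dots> = (\<integral>\<^sup>+x. f (s * x) \<partial>std_normal)"
    by (simp add: nn_integral_std_normal)
  finally show ?thesis ..
qed

text \<open>The rotation is carried out by one-dimensional substitutions: with \<open>y\<close>
  fixed, u = c x - s y replaces \<open>x\<close>; after exchanging the integrals, with
  \<open>u\<close> fixed, v = (s u + y) / c replaces \<open>y\<close>. The factor |1/c| produced by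
  the first is exactly what the second absorbs. This requires c to be nonzero; for
  \<open>c = 0\<close> the map is a swap of the variables with a sign change.\<close>

lemma nn_integral_std_normal_rotate:
  assumes f [measurable]: "(\<lambda>(x, y). f x y) \<in> borel_measurable (borel \<Otimes>\<^sub>M borel)"
    and cs: "c\<^sup>2 + s\<^sup>2 = 1"
  shows "(\<integral>\<^sup>+x. \<integral>\<^sup>+y. f (c * x - s * y) (s * x + c * y) \<partial>std_normal \<partial>std_normal) =
         (\<integral>\<^sup>+x. \<integral>\<^sup>+y. f x y \<partial>std_normal \<partial>std_normal)"
proof -
  interpret NN: pair_prob_space std_normal std_normal ..
  have [measurable]: "f x \<in> borel_measurable borel" for x
    using f by measurable
  show ?thesis
  proof (cases "c = 0")
    case True
    then have s: "s\<^sup>2 = 1" using cs by simp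
    then have s': "(- s)\<^sup>2 = 1" by simp
    have "(\<integral>\<^sup>+x. \<integral>\<^sup>+y. f (c * x - s * y) (s * x + c * y) \<partial>std_normal \<partial>std_normal) =
          (\<integral>\<^sup>+x. \<integral>\<^sup>+y. f ((- s) * y) (s * x) \<partial>std_normal \<partial>std_normal)"
      using True by simp
    also have "\<dots> = (\<integral>\<^sup>+x. \<integral>\<^sup>+y. f y (s * x) \<partial>std_normal \<partial>std_normal)"
      by (intro nn_integral_cong nn_integral_std_normal_reflect s') measurable
    also have "\<dots> = (\<integral>\<^sup>+y. \<integral>\<^sup>+x. f y (s * x) \<partial>std_normal \<partial>std_normal)"
      by (rule NN.Fubini') measurable
    also have "\<dots> = (\<integral>\<^sup>+y. \<integral>\<^sup>+x. f y x \<partial>std_normal \<partial>std_normal)"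
      by (intro nn_integral_cong nn_integral_std_normal_reflect s) measurable
    finally show ?thesis .
  next
    case False
    let ?\<phi> = "\<lambda>x. ennreal (std_normal_density x)"
    define H where "H = (\<lambda>u v. ?\<phi> u * ?\<phi> v * f u v)"
    have H [measurable]: "(\<lambda>(u, v). H u v) \<in> borel_measurable (borel \<Otimes>\<^sub>M borel)"
      unfolding H_def by measurable
    have LH: "(\<integral>\<^sup>+x. \<integral>\<^sup>+y. g x y \<partial>std_normal \<partial>std_normal) =
        (\<integral>\<^sup>+x. \<integral>\<^sup>+y. ?\<phi> x * ?\<phi> y * g x y \<partial>lborel \<partial>lborel)"
      if [measurable]: "(\<lambda>(x, y). g x y) \<in> borel_measurable (borel \<Otimes>\<^sub>M borel)" for g
    proof -
      have gx [measurable]: "\<And>x. g x \<in> borel_measurable borel"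
        using measurable_compose[of "\<lambda>y. (x, y)" borel "borel \<Otimes>\<^sub>M borel", OF _ that] by simp
      have "(\<integral>\<^sup>+x. \<integral>\<^sup>+y. g x y \<partial>std_normal \<partial>std_normal) =
          (\<integral>\<^sup>+x. ?\<phi> x * (\<integral>\<^sup>+y. ?\<phi> y * g x y \<partial>lborel) \<partial>lborel)"
        by (subst nn_integral_std_normal, measurable) (simp only: nn_integral_std_normal[OF gx])
      also have "\<dots> = (\<integral>\<^sup>+x. \<integral>\<^sup>+y. ?\<phi> x * (?\<phi> y * g x y) \<partial>lborel \<partial>lborel)"
        by (intro nn_integral_cong nn_integral_cmult[symmetric]) measurable
      finally show ?thesis by (simp only: mult.assoc)
    qed
    have "(\<integral>\<^sup>+x. \<integral>\<^sup>+y. f (c * x - s * y) (s * x + c * y) \<partial>std_normal \<partial>std_normal) =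
          (\<integral>\<^sup>+x. \<integral>\<^sup>+y. H (c * x - s * y) (s * x + c * y) \<partial>lborel \<partial>lborel)"
    proof (subst LH)
      have "?\<phi> x * ?\<phi> y = ?\<phi> (c * x - s * y) * ?\<phi> (s * x + c * y)" for x y
        using std_normal_density_rotate[OF cs, of x y] by (simp only: ennreal_mult[symmetric] normal_density_nonneg)
      then show "(\<integral>\<^sup>+x. \<integral>\<^sup>+y. ?\<phi> x * ?\<phi> y * f (c * x - s * y) (s * x + c * y) \<partial>lborel \<partial>lborel) =
          (\<integral>\<^sup>+x. \<integral>\<^sup>+y. H (c * x - s * y) (s * x + c * y) \<partial>lborel \<partial>lborel)"
        by (simp only: H_def)
    qed measurable
    also have "\<dots> = (\<integral>\<^sup>+y. \<integral>\<^sup>+x. H (c * x - s * y) (s * x + c * y) \<partial>lborel \<partial>lborel)"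
      by (rule lborel_pair.Fubini') measurable
    also have "\<dots> = (\<integral>\<^sup>+y. ennreal \<bar>1/c\<bar> * (\<integral>\<^sup>+u. H u (s / c * u + y / c) \<partial>lborel) \<partial>lborel)"
    proof (rule nn_integral_cong)
      fix y
      have *: "c * (s * y / c + 1 / c * u) - s * y = u"
        "s * (s * y / c + 1 / c * u) + c * y = s / c * u + y / c" for u
      proof -
        show "c * (s * y / c + 1 / c * u) - s * y = u" using False by (simp add: field_simps)
        have "s * (s * y / c + 1 / c * u) + c * y = s / c * u + (s\<^sup>2 + c\<^sup>2) * y / c"
          using False by (simp add: field_simps power2_eq_square)
        then show "s * (s * y / c + 1 / c * u) + c * y = s / c * u + y / c"
          using cs by (simp add: add.commute)
      qed
      have "(\<integral>\<^sup>+x. H (c * x - s * y) (s * x + c * y) \<partial>lborel) =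
          ennreal \<bar>1/c\<bar> * (\<integral>\<^sup>+u. H (c * (s * y / c + 1 / c * u) - s * y) (s * (s * y / c + 1 / c * u) + c * y) \<partial>lborel)"
        by (intro nn_integral_real_affine) (measurable, simp add: False)
      then show "(\<integral>\<^sup>+x. H (c * x - s * y) (s * x + c * y) \<partial>lborel) =
            ennreal \<bar>1/c\<bar> * (\<integral>\<^sup>+u. H u (s / c * u + y / c) \<partial>lborel)"
        by (simp only: *)
    qed
    also have "\<dots> = ennreal \<bar>1/c\<bar> * (\<integral>\<^sup>+y. (\<integral>\<^sup>+u. H u (s / c * u + y / c) \<partial>lborel) \<partial>lborel)"
      by (rule nn_integral_cmult) measurable
    also have "\<dots> = ennreal \<bar>1/c\<bar> * (\<integral>\<^sup>+u. (\<integral>\<^sup>+y. H u (s / c * u + y / c) \<partial>lborel) \<partial>lborel)"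
      by (intro arg_cong2[where f = "(*)"] refl lborel_pair.Fubini') measurable
    also have "\<dots> = (\<integral>\<^sup>+u. ennreal \<bar>1/c\<bar> * (\<integral>\<^sup>+y. H u (s / c * u + (1/c) * y) \<partial>lborel) \<partial>lborel)"
      unfolding times_divide_eq_left mult_1
      by (rule nn_integral_cmult[symmetric]) measurable
    also have "\<dots> = (\<integral>\<^sup>+u. \<integral>\<^sup>+v. H u v \<partial>lborel \<partial>lborel)"
      by (intro nn_integral_cong nn_integral_real_affine[symmetric]) (measurable, simp add: False)
    also have "\<dots> = (\<integral>\<^sup>+x. \<integral>\<^sup>+y. f x y \<partial>std_normal \<partial>std_normal)"
      by (subst LH) (simp_all only: H_def f)
    finally show ?thesis .
  qed
qed

lemma nn_integral_iid_normal_insert: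
  assumes "finite K" "a \<notin> K" "f \<in> borel_measurable (borel_Pi (insert a K))"
  shows "(\<integral>\<^sup>+w. f w \<partial>iid_normal (insert a K)) = (\<integral>\<^sup>+w. \<integral>\<^sup>+x. f (w(a := x)) \<partial>std_normal \<partial>iid_normal K)"
proof -
  have "sets (borel_Pi (insert a K)) = sets (Pi\<^sub>M (insert a K) (\<lambda>_. std_normal))"
    by (intro sets_PiM_cong) auto
  then have "f \<in> borel_measurable (Pi\<^sub>M (insert a K) (\<lambda>_. std_normal))"
    using assms(3) by (metis measurable_cong_sets)
  then show ?thesis
    unfolding iid_normal_def
    by (intro product_sigma_finite.product_nn_integral_insert product_sigma_finite_std_normal assms)
qed

lemma nn_integral_iid_normal_Un:
  assumes "I \<inter> J = {}" "finite I" "finite J" "f \<in> borel_measurable (borel_Pi (I \<union> J))"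
  shows "(\<integral>\<^sup>+w. f w \<partial>iid_normal (I \<union> J)) =
    (\<integral>\<^sup>+x. \<integral>\<^sup>+y. f (merge I J (x, y)) \<partial>iid_normal J \<partial>iid_normal I)"
proof -
  have "sets (borel_Pi (I \<union> J)) = sets (Pi\<^sub>M (I \<union> J) (\<lambda>_. std_normal))"
    by (intro sets_PiM_cong) auto
  then have "f \<in> borel_measurable (Pi\<^sub>M (I \<union> J) (\<lambda>_. std_normal))"
    using assms(4) by (metis measurable_cong_sets)
  then show ?thesis
    unfolding iid_normal_def
    by (intro product_sigma_finite.product_nn_integral_fold product_sigma_finite_std_normal assms)
qed

section \<open>Orthogonal invariance\<close>

text \<open>\<open>T'\<close> is the inverse of \<open>T\<close>, and on \<open>I\<close> also its
  transpose. Invariance of the Gaussian law is part of the definition, so it has to be verified only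
  for rotations of a coordinate plane and is inherited by compositions and inverses. Continuity is
  recorded because preimages of closed cones must again be closed.\<close>

definition rotation :: "'i set \<Rightarrow> (('i \<Rightarrow> real) \<Rightarrow> 'i \<Rightarrow> real) \<Rightarrow> (('i \<Rightarrow> real) \<Rightarrow> 'i \<Rightarrow> real) \<Rightarrow> bool" where
  "rotation I T T' \<longleftrightarrow>
     (\<forall>u. T' (T u) = u) \<and> (\<forall>u. T (T' u) = u) \<and>
     (\<forall>u v. T (\<lambda>i. u i + v i) = (\<lambda>i. T u i + T v i)) \<and>
     (\<forall>c u. T (\<lambda>i. c * u i) = (\<lambda>i. c * T u i)) \<and>
     (\<forall>u v. (\<Sum>i\<in>I. T u i * T v i) = (\<Sum>i\<in>I. u i * v i)) \<and>
     (\<forall>i. continuous_on UNIV (\<lambda>u. T u i)) \<and> (\<forall>i. continuous_on UNIV (\<lambda>u. T' u i)) \<and>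
     T \<in> measurable (iid_normal I) (iid_normal I) \<and> T' \<in> measurable (iid_normal I) (iid_normal I) \<and>
     distr (iid_normal I) (iid_normal I) T = iid_normal I"

lemma rotation_id: "rotation I (\<lambda>u. u) (\<lambda>u. u)"
  by (auto simp: rotation_def intro!: distr_id2)

lemma rotation_comp:
  assumes "rotation I T T'" "rotation I U U'"
  shows "rotation I (\<lambda>u. U (T u)) (\<lambda>u. T' (U' u))"
proof -
  note T = assms(1)[unfolded rotation_def] and U = assms(2)[unfolded rotation_def]
  have cont: "continuous_on UNIV (\<lambda>u. g (f u) i)"
    if "\<And>i. continuous_on UNIV (\<lambda>u. f u i)" "\<And>i. continuous_on UNIV (\<lambda>u. g u i)"
    for f g :: "('a \<Rightarrow> real) \<Rightarrow> 'a \<Rightarrow> real" and i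
    using continuous_on_compose2[of UNIV "\<lambda>u. g u i" UNIV f] that
    by (simp add: continuous_on_coordinatewise_then_product)
  have "distr (iid_normal I) (iid_normal I) (\<lambda>u. U (T u)) = distr (distr (iid_normal I) (iid_normal I) T) (iid_normal I) U"
    using T U by (subst distr_distr) (auto simp: comp_def)
  also have "\<dots> = iid_normal I" using T U by simp
  finally have D: "distr (iid_normal I) (iid_normal I) (\<lambda>u. U (T u)) = iid_normal I" .
  have M: "(\<lambda>u. U (T u)) \<in> iid_normal I \<rightarrow>\<^sub>M iid_normal I" "(\<lambda>u. T' (U' u)) \<in> iid_normal I \<rightarrow>\<^sub>M iid_normal I"
    using T U by (auto intro: measurable_compose)
  have C: "continuous_on UNIV (\<lambda>u. U (T u) i)" "continuous_on UNIV (\<lambda>u. T' (U' u) i)" for i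
    by (rule cont; use T U in simp)+
  show ?thesis
    unfolding rotation_def using T U D M C by simp
qed

lemma rotation_inverse:
  assumes "rotation I T T'"
  shows "rotation I T' T"
proof -
  note T = assms[unfolded rotation_def]
  have "distr (iid_normal I) (iid_normal I) T' = distr (distr (iid_normal I) (iid_normal I) T) (iid_normal I) T'"
    using T by simp
  also have "\<dots> = distr (iid_normal I) (iid_normal I) (\<lambda>u. T' (T u))"
    using T by (subst distr_distr) (auto simp: comp_def)
  also have "\<dots> = iid_normal I"
    using T by (simp add: distr_id2)
  finally have D: "distr (iid_normal I) (iid_normal I) T' = iid_normal I" .
  have A: "T' (\<lambda>i. u i + v i) = (\<lambda>i. T' u i + T' v i)" for u v
  proof -
    have "T (\<lambda>i. T' u i + T' v i) = (\<lambda>i. u i + v i)" using T by simp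
    then show ?thesis using T by metis
  qed
  have S: "T' (\<lambda>i. c * u i) = (\<lambda>i. c * T' u i)" for c u
  proof -
    have "T (\<lambda>i. c * T' u i) = (\<lambda>i. c * u i)" using T by simp
    then show ?thesis using T by metis
  qed
  have P: "(\<Sum>i\<in>I. T' u i * T' v i) = (\<Sum>i\<in>I. u i * v i)" for u v
    using T by metis
  show ?thesis
    unfolding rotation_def using T D A S P by (intro conjI allI) simp_all
qed

lemma measure_eqI_nn_integral:
  assumes "sets M = sets N"
    and "\<And>f. f \<in> borel_measurable N \<Longrightarrow> (\<integral>\<^sup>+x. f x \<partial>M) = (\<integral>\<^sup>+x. f x \<partial>N)"
  shows "M = N"
proof (rule measure_eqI)
  fix A assume A: "A \<in> sets M"
  have "emeasure M A = (\<integral>\<^sup>+x. indicator A x \<partial>M)" using A by simp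
  also have "\<dots> = (\<integral>\<^sup>+x. indicator A x \<partial>N)" using A assms by (intro assms(2)) simp
  also have "\<dots> = emeasure N A" using A assms by simp
  finally show "emeasure M A = emeasure N A" .
qed fact

text \<open>Everything but the invariance of the law is algebra with c^2 + s^2 = 1. For the law, all
  coordinates outside the plane are held fixed, which leaves the identity for two variables.\<close>

lemma rotation_plane:
  fixes c s :: real
  assumes fin: "finite I" and ab: "a \<in> I" "b \<in> I" "a \<noteq> b" and cs: "c\<^sup>2 + s\<^sup>2 = 1"
  shows "rotation I (\<lambda>u. u(a := c * u a + s * u b, b := c * u b - s * u a))
    (\<lambda>u. u(a := c * u a - s * u b, b := c * u b + s * u a))"
proof -
  define T :: "real \<Rightarrow> ('a \<Rightarrow> real) \<Rightarrow> 'a \<Rightarrow> real"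
    where "T s u = u(a := c * u a + s * u b, b := c * u b - s * u a)" for s u
  define K where "K = I - {a, b}"
  have I: "I = insert a (insert b K)" and K: "finite K" "a \<notin> insert b K" "b \<notin> K"
    using fin ab by (auto simp: K_def)
  have inv: "T (- t) (T t u) = u" if "c\<^sup>2 + t\<^sup>2 = 1" for t u
  proof -
    have "c * (c * u a + t * u b) - t * (c * u b - t * u a) = (c\<^sup>2 + t\<^sup>2) * u a"
      "c * (c * u b - t * u a) + t * (c * u a + t * u b) = (c\<^sup>2 + t\<^sup>2) * u b"
      by (simp_all add: algebra_simps power2_eq_square)
    then show ?thesis using ab that by (simp add: T_def fun_eq_iff)
  qed
  have coord: "T t u i = (if i = b then c * u b - t * u a else if i = a then c * u a + t * u b else u i)" for t u i
    by (simp add: T_def)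
  have cont: "continuous_on UNIV (\<lambda>u. T t u i)" for t i
    unfolding coord
    by (cases "i = b"; cases "i = a")
      (auto intro!: continuous_on_add continuous_on_diff continuous_on_mult continuous_on_const)
  have meas [measurable]: "T t \<in> borel_Pi I \<rightarrow>\<^sub>M borel_Pi I" for t
  proof (rule measurable_PiM_single')
    show "(\<lambda>u. T t u i) \<in> borel_Pi I \<rightarrow>\<^sub>M borel" if "i \<in> I" for i
      unfolding coord using ab that by measurable
    show "T t \<in> space (borel_Pi I) \<rightarrow> I \<rightarrow>\<^sub>E space borel"
      using ab by (auto simp: coord space_PiM PiE_iff extensional_def)
  qed
  then have meas' [measurable]: "T t \<in> iid_normal I \<rightarrow>\<^sub>M iid_normal I" for t
    by measurable
  have sum: "(\<Sum>i\<in>I. T s u i * T s v i) = (\<Sum>i\<in>I. u i * v i)" for u v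
  proof -
    have "(\<Sum>i\<in>K. T s u i * T s v i) = (\<Sum>i\<in>K. u i * v i)"
      using K by (intro sum.cong) (auto simp: coord)
    moreover have "T s u a * T s v a + T s u b * T s v b = (c\<^sup>2 + s\<^sup>2) * (u a * v a + u b * v b)"
      using ab by (simp add: coord power2_eq_square algebra_simps)
    ultimately show ?thesis
      using K cs ab unfolding I by simp
  qed
  have "distr (iid_normal I) (iid_normal I) (T s) = iid_normal I"
  proof (rule measure_eqI_nn_integral)
    fix f :: "('a \<Rightarrow> real) \<Rightarrow> ennreal" assume "f \<in> borel_measurable (iid_normal I)"
    then have f [measurable]: "f \<in> borel_measurable (borel_Pi I)" by measurable
    have split: "(\<integral>\<^sup>+u. g u \<partial>iid_normal I) =
        (\<integral>\<^sup>+w. \<integral>\<^sup>+y. \<integral>\<^sup>+x. g (w(b := y, a := x)) \<partial>std_normal \<partial>std_normal \<partial>iid_normal K)"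
      if [measurable]: "g \<in> borel_measurable (borel_Pi I)" for g
    proof -
      have [measurable]: "g \<in> borel_measurable (borel_Pi (insert a (insert b K)))"
        using that I by simp
      have "(\<integral>\<^sup>+u. g u \<partial>iid_normal I) = (\<integral>\<^sup>+w. \<integral>\<^sup>+x. g (w(a := x)) \<partial>std_normal \<partial>iid_normal (insert b K))"
        unfolding I using K by (intro nn_integral_iid_normal_insert) auto
      also have "\<dots> = (\<integral>\<^sup>+w. \<integral>\<^sup>+y. \<integral>\<^sup>+x. g (w(b := y, a := x)) \<partial>std_normal \<partial>std_normal \<partial>iid_normal K)"
        using K by (intro nn_integral_iid_normal_insert) measurable
      finally show ?thesis .
    qed
    have "(\<integral>\<^sup>+u. f u \<partial>distr (iid_normal I) (iid_normal I) (T s)) = (\<integral>\<^sup>+u. f (T s u) \<partial>iid_normal I)"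
      by (intro nn_integral_distr) measurable
    also have "\<dots> = (\<integral>\<^sup>+w. \<integral>\<^sup>+y. \<integral>\<^sup>+x. f (T s (w(b := y, a := x))) \<partial>std_normal \<partial>std_normal \<partial>iid_normal K)"
      by (rule split[of "\<lambda>u. f (T s u)"]) measurable
    also have "\<dots> = (\<integral>\<^sup>+w. \<integral>\<^sup>+y. \<integral>\<^sup>+x. f (w(b := c * y - s * x, a := s * y + c * x)) \<partial>std_normal \<partial>std_normal \<partial>iid_normal K)"
    proof -
      have "T s (w(b := y, a := x)) = w(b := c * y - s * x, a := s * y + c * x)" for w x y
        using ab by (auto simp: coord fun_eq_iff)
      then show ?thesis by simp
    qed
    also have "\<dots> = (\<integral>\<^sup>+w. \<integral>\<^sup>+y. \<integral>\<^sup>+x. f (w(b := y, a := x)) \<partial>std_normal \<partial>std_normal \<partial>iid_normal K)"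
    proof (rule nn_integral_cong)
      fix w :: "'a \<Rightarrow> real" assume w: "w \<in> space (iid_normal K)"
      have m: "(\<lambda>p. w(b := fst p, a := snd p)) \<in> borel \<Otimes>\<^sub>M borel \<rightarrow>\<^sub>M borel_Pi I"
      proof (rule measurable_PiM_single')
        show "(\<lambda>p. (w(b := fst p, a := snd p)) i) \<in> borel \<Otimes>\<^sub>M borel \<rightarrow>\<^sub>M borel" for i
          by (cases "i = a"; cases "i = b") auto
      qed (use w in \<open>auto simp: I space_iid_normal PiE_iff extensional_def\<close>)
      from measurable_compose[OF m f]
      have "(\<lambda>(y, x). f (w(b := y, a := x))) \<in> borel_measurable (borel \<Otimes>\<^sub>M borel)"
        by (simp add: split_beta')
      from nn_integral_std_normal_rotate[OF this cs]
      show "(\<integral>\<^sup>+y. \<integral>\<^sup>+x. f (w(b := c * y - s * x, a := s * y + c * x)) \<partial>std_normal \<partial>std_normal) =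
        (\<integral>\<^sup>+y. \<integral>\<^sup>+x. f (w(b := y, a := x)) \<partial>std_normal \<partial>std_normal)" .
    qed
    also have "\<dots> = (\<integral>\<^sup>+u. f u \<partial>iid_normal I)"
      by (rule split[OF f, symmetric])
    finally show "(\<integral>\<^sup>+u. f u \<partial>distr (iid_normal I) (iid_normal I) (T s)) = (\<integral>\<^sup>+u. f u \<partial>iid_normal I)" .
  qed simp
  moreover have "T s (\<lambda>i. u i + v i) = (\<lambda>i. T s u i + T s v i)" for u v
    by (auto simp: fun_eq_iff coord algebra_simps)
  moreover have "T s (\<lambda>i. k * u i) = (\<lambda>i. k * T s u i)" for k u
    by (auto simp: fun_eq_iff coord algebra_simps)
  moreover have "T s (T (- s) u) = u" for u
    using inv[of "- s" u] cs by simp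
  ultimately have "rotation I (T s) (T (- s))"
    unfolding rotation_def by (intro conjI allI inv[OF cs] cont meas' sum) simp_all
  then show ?thesis
    by (simp add: T_def[abs_def])
qed

text \<open>One plane rotation for each index other than \<open>b\<close> moves that coordinate into
  coordinate \<open>b\<close> and leaves zeros already produced untouched. The value
  \<open>r\<close> may have either sign (for instance if no rotation was necessary), hence only its
  square is stated.\<close>

lemma ex_rotation_to_axis:
  assumes fin: "finite I" and b: "b \<in> I"
  shows "\<exists>T T' r. rotation I T T' \<and> (\<forall>i\<in>I. T w i = (if i = b then r else 0)) \<and> r\<^sup>2 = (\<Sum>i\<in>I. (w i)\<^sup>2)"
proof -
  have "\<exists>T T'. rotation I T T' \<and> (\<forall>i\<in>S. T w i = 0)" if "finite S" "S \<subseteq> I - {b}" for S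
    using that
  proof (induction S rule: finite_induct)
    case empty
    then show ?case using rotation_id by blast
  next
    case (insert a S)
    then obtain T T' where T: "rotation I T T'" and T0: "\<forall>i\<in>S. T w i = 0" by auto
    have a: "a \<in> I" "a \<noteq> b" "a \<notin> S" "b \<notin> S" using insert by auto
    define \<rho> where "\<rho> = sqrt ((T w b)\<^sup>2 + (T w a)\<^sup>2)"
    show ?case
    proof (cases "T w a = 0")
      case True
      then show ?thesis using T T0 by auto
    next
      case False
      then have \<rho>: "\<rho> > 0" and \<rho>2: "\<rho>\<^sup>2 = (T w b)\<^sup>2 + (T w a)\<^sup>2"
        unfolding \<rho>_def by (auto simp: sum_power2_gt_zero_iff)
      define c s where "c = T w b / \<rho>" and "s = T w a / \<rho>"
      have "c\<^sup>2 + s\<^sup>2 = ((T w b)\<^sup>2 + (T w a)\<^sup>2) / \<rho>\<^sup>2"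
        by (simp add: c_def s_def power_divide add_divide_distrib)
      then have cs: "c\<^sup>2 + s\<^sup>2 = 1" using \<rho> unfolding \<rho>2[symmetric] by simp
      define G where "G = (\<lambda>u::'a \<Rightarrow> real. u(b := c * u b + s * u a, a := c * u a - s * u b))"
      from rotation_plane[OF fin b a(1) a(2)[symmetric] cs]
      obtain G' where "rotation I G G'" unfolding G_def by blast
      from rotation_comp[OF T this] have "rotation I (\<lambda>u. G (T u)) (\<lambda>u. T' (G' u))" .
      moreover have "\<forall>i\<in>insert a S. G (T w) i = 0"
        using T0 a \<rho> by (auto simp: G_def c_def s_def)
      ultimately show ?thesis by blast
    qed
  qed
  from this[of "I - {b}"] fin obtain T T' where T: "rotation I T T'" and T0: "\<forall>i\<in>I - {b}. T w i = 0"
    by auto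
  have "(\<Sum>i\<in>I. (w i)\<^sup>2) = (\<Sum>i\<in>I. T w i * T w i)"
    using T unfolding rotation_def power2_eq_square by simp
  also have "\<dots> = (T w b)\<^sup>2"
    using fin b T0 by (subst sum.remove[of I b]) (auto simp: power2_eq_square intro!: sum.neutral)
  finally have "(T w b)\<^sup>2 = (\<Sum>i\<in>I. (w i)\<^sup>2)" ..
  then show ?thesis
    using T T0 by (intro exI[of _ T] exI[of _ T'] exI[of _ "T w b"]) auto
qed

section \<open>Gaussian matrices as families of independent Gaussian rows or columns\<close>

lemma measurable_iid_normal1: "measurable (iid_normal K) N = measurable (borel_Pi K) N"
  by (rule measurable_cong_sets[OF sets_iid_normal refl])

lemma measurable_iid_normal2: "measurable M (iid_normal K) = measurable M (borel_Pi K)"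
  by (rule measurable_cong_sets[OF refl sets_iid_normal])

text \<open>The maps \<open>\<alpha>\<close> and \<open>\<beta>\<close> read an entry
  \<open>k\<close> of a matrix as a block number and a position within the block. Choosing them as
  the two projections in either order makes the blocks the rows or the columns. The two laws are
  compared on boxes, where both are the product of the same one-dimensional probabilities.\<close>

lemma iid_normal_nested:
  assumes fin: "finite I" "finite J" and bij: "bij_betw (\<lambda>k. (\<alpha> k, \<beta> k)) K (I \<times> J)"
  shows "(\<lambda>p. \<lambda>k\<in>K. p (\<alpha> k) (\<beta> k)) \<in> Pi\<^sub>M I (\<lambda>_. iid_normal J) \<rightarrow>\<^sub>M iid_normal K" (is "?F \<in> _")
    and "distr (Pi\<^sub>M I (\<lambda>_. iid_normal J)) (iid_normal K) (\<lambda>p. \<lambda>k\<in>K. p (\<alpha> k) (\<beta> k)) = iid_normal K"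
proof -
  let ?P = "Pi\<^sub>M I (\<lambda>_. iid_normal J)"
  have ab: "\<alpha> k \<in> I" "\<beta> k \<in> J" if "k \<in> K" for k
    using bij_betwE[OF bij] that by auto
  have finK: "finite K" using bij_betw_finite[OF bij] fin by simp
  interpret N: product_sigma_finite "\<lambda>_. std_normal" by (rule product_sigma_finite_std_normal)
  interpret Q: product_sigma_finite "\<lambda>_. iid_normal J"
    by (simp add: product_sigma_finite_def prob_space_iid_normal prob_space_imp_sigma_finite)
  have comp: "(\<lambda>p. p i j) \<in> ?P \<rightarrow>\<^sub>M borel" if "i \<in> I" "j \<in> J" for i j
  proof -
    have 1: "(\<lambda>p. p i) \<in> ?P \<rightarrow>\<^sub>M borel_Pi J"
      using measurable_component_singleton[OF that(1), of "\<lambda>_. iid_normal J"]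
      by (simp only: measurable_iid_normal1 measurable_iid_normal2)
    show ?thesis
      using measurable_compose[OF 1 measurable_component_singleton[OF that(2)]] .
  qed
  show meas: "?F \<in> ?P \<rightarrow>\<^sub>M iid_normal K"
  proof -
    have "?F \<in> ?P \<rightarrow>\<^sub>M borel_Pi K"
      by (intro measurable_restrict comp ab)
    then show ?thesis by (simp only: measurable_iid_normal1 measurable_iid_normal2)
  qed
  have "distr ?P (iid_normal K) ?F = Pi\<^sub>M K (\<lambda>_. std_normal)"
  proof (rule N.PiM_eqI[OF finK])
    show "sets (distr ?P (iid_normal K) ?F) = sets (Pi\<^sub>M K (\<lambda>_. std_normal))"
      by (simp add: iid_normal_def)
    fix A assume A: "\<And>k. k \<in> K \<Longrightarrow> A k \<in> sets std_normal"
    define g where "g = the_inv_into K (\<lambda>k. (\<alpha> k, \<beta> k))"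
    have g: "g (i, j) \<in> K" "\<alpha> (g (i, j)) = i" "\<beta> (g (i, j)) = j" if "i \<in> I" "j \<in> J" for i j
    proof -
      have "g (i, j) \<in> K" using bij_betw_the_inv_into[OF bij] that unfolding g_def
        by (auto dest: bij_betwE)
      moreover have "(\<alpha> (g (i, j)), \<beta> (g (i, j))) = (i, j)"
        using f_the_inv_into_f_bij_betw[OF bij, of "(i, j)"] that by (simp add: g_def)
      ultimately show "g (i, j) \<in> K" "\<alpha> (g (i, j)) = i" "\<beta> (g (i, j)) = j" by auto
    qed
    have g': "g (\<alpha> k, \<beta> k) = k" if "k \<in> K" for k
      unfolding g_def using the_inv_into_f_f[OF bij_betw_imp_inj_on[OF bij] that] .
    have sub: "?F -` Pi\<^sub>E K A \<inter> space ?P = Pi\<^sub>E I (\<lambda>i. Pi\<^sub>E J (\<lambda>j. A (g (i, j))))"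
    proof (intro set_eqI iffI)
      fix p assume "p \<in> ?F -` Pi\<^sub>E K A \<inter> space ?P"
      then have p: "p \<in> space ?P" and 1: "\<And>k. k \<in> K \<Longrightarrow> p (\<alpha> k) (\<beta> k) \<in> A k"
        by (auto simp: PiE_iff)
      have "p i j \<in> A (g (i, j))" if "i \<in> I" "j \<in> J" for i j
        using 1[OF g(1)[OF that]] g[OF that] by simp
      then show "p \<in> Pi\<^sub>E I (\<lambda>i. Pi\<^sub>E J (\<lambda>j. A (g (i, j))))"
        using p by (auto simp: space_PiM space_iid_normal PiE_iff)
    next
      fix p assume p: "p \<in> Pi\<^sub>E I (\<lambda>i. Pi\<^sub>E J (\<lambda>j. A (g (i, j))))"
      then have "p (\<alpha> k) (\<beta> k) \<in> A k" if "k \<in> K" for k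
        using ab[OF that] g'[OF that] that by (fastforce simp: PiE_iff)
      then show "p \<in> ?F -` Pi\<^sub>E K A \<inter> space ?P"
        using p by (auto simp: space_PiM space_iid_normal PiE_iff)
    qed
    have AJ: "A (g (i, j)) \<in> sets std_normal" if "i \<in> I" "j \<in> J" for i j
      using A g that by blast
    have PA: "Pi\<^sub>E K A \<in> sets (iid_normal K)"
      unfolding iid_normal_def using A finK by (intro sets_PiM_I_finite) auto
    have PJ: "Pi\<^sub>E J (\<lambda>j. A (g (i, j))) \<in> sets (iid_normal J)" if "i \<in> I" for i
      unfolding iid_normal_def using AJ that fin by (intro sets_PiM_I_finite) auto
    have "emeasure (distr ?P (iid_normal K) ?F) (Pi\<^sub>E K A) = emeasure ?P (Pi\<^sub>E I (\<lambda>i. Pi\<^sub>E J (\<lambda>j. A (g (i, j)))))"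
      by (subst emeasure_distr[OF meas PA]) (simp only: sub)
    also have "\<dots> = (\<Prod>i\<in>I. emeasure (iid_normal J) (Pi\<^sub>E J (\<lambda>j. A (g (i, j)))))"
      using fin PJ by (intro Q.emeasure_PiM) auto
    also have "\<dots> = (\<Prod>i\<in>I. \<Prod>j\<in>J. emeasure std_normal (A (g (i, j))))"
      unfolding iid_normal_def using fin AJ by (intro prod.cong refl N.emeasure_PiM) auto
    also have "\<dots> = (\<Prod>p\<in>I \<times> J. emeasure std_normal (A (g p)))"
      by (simp add: prod.cartesian_product)
    also have "\<dots> = (\<Prod>k\<in>K. emeasure std_normal (A k))"
      by (subst prod.reindex_bij_betw[OF bij, symmetric]) (simp add: g')
    finally show "emeasure (distr ?P (iid_normal K) ?F) (Pi\<^sub>E K A) = (\<Prod>k\<in>K. emeasure std_normal (A k))" .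
  qed
  then show "distr ?P (iid_normal K) ?F = iid_normal K"
    by (simp add: iid_normal_def)
qed

text \<open>The blocks are independent Gaussian vectors, so the same rotation may act on each of
  them simultaneously.\<close>

lemma rotation_iid_normal_nested:
  assumes fin: "finite I" "finite J" and bij: "bij_betw (\<lambda>k. (\<alpha> k, \<beta> k)) K (I \<times> J)"
    and g: "\<And>i j. i \<in> I \<Longrightarrow> j \<in> J \<Longrightarrow> g i j \<in> K \<and> \<alpha> (g i j) = i \<and> \<beta> (g i j) = j"
    and T: "rotation J T T'"
    and f: "f \<in> borel_measurable (borel_Pi K)"
  shows "(\<integral>\<^sup>+w. f w \<partial>iid_normal K) =
    (\<integral>\<^sup>+w. f (\<lambda>k\<in>K. T (\<lambda>j\<in>J. w (g (\<alpha> k) j)) (\<beta> k)) \<partial>iid_normal K)"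
proof -
  let ?P = "Pi\<^sub>M I (\<lambda>_. iid_normal J)"
  let ?F = "\<lambda>p. \<lambda>k\<in>K. p (\<alpha> k) (\<beta> k)"
  let ?R = "\<lambda>w. \<lambda>k\<in>K. T (\<lambda>j\<in>J. w (g (\<alpha> k) j)) (\<beta> k)"
  note nest = iid_normal_nested[OF fin bij]
  have ab: "\<alpha> k \<in> I" "\<beta> k \<in> J" if "k \<in> K" for k
    using bij_betwE[OF bij] that by auto
  have Tm: "T \<in> iid_normal J \<rightarrow>\<^sub>M iid_normal J" and Td: "distr (iid_normal J) (iid_normal J) T = iid_normal J"
    using T by (auto simp: rotation_def)
  have f': "f \<in> borel_measurable (iid_normal K)"
    using f by (simp only: measurable_iid_normal1 measurable_iid_normal2)
  have Tm': "(\<lambda>u. T u j) \<in> borel_Pi J \<rightarrow>\<^sub>M borel" if "j \<in> J" for j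
  proof -
    have "T \<in> borel_Pi J \<rightarrow>\<^sub>M borel_Pi J"
      using Tm by (simp only: measurable_iid_normal1 measurable_iid_normal2)
    from measurable_compose[OF this measurable_component_singleton[OF that]] show ?thesis .
  qed
  have R: "?R \<in> borel_Pi K \<rightarrow>\<^sub>M borel_Pi K"
  proof (intro measurable_restrict)
    fix k assume k: "k \<in> K"
    have "(\<lambda>w. \<lambda>j\<in>J. w (g (\<alpha> k) j)) \<in> borel_Pi K \<rightarrow>\<^sub>M borel_Pi J"
      using g ab[OF k] by (intro measurable_restrict measurable_component_singleton) blast
    from measurable_compose[OF this Tm'[OF ab(2)[OF k]]]
    show "(\<lambda>w. T (\<lambda>j\<in>J. w (g (\<alpha> k) j)) (\<beta> k)) \<in> borel_Pi K \<rightarrow>\<^sub>M borel" .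
  qed
  have R': "?R \<in> iid_normal K \<rightarrow>\<^sub>M iid_normal K"
    using R by (simp only: measurable_iid_normal1 measurable_iid_normal2)
  have C: "compose I T \<in> ?P \<rightarrow>\<^sub>M ?P"
    unfolding compose_def using Tm by (intro measurable_restrict) (auto intro: measurable_compose[OF measurable_component_singleton])
  have D: "distr ?P ?P (compose I T) = ?P"
    using distr_PiM_finite_prob_space'[OF fin(1), of "\<lambda>_. iid_normal J" "\<lambda>_. iid_normal J" T]
    by (simp add: prob_space_iid_normal Tm Td)
  have "(\<integral>\<^sup>+w. f w \<partial>iid_normal K) = (\<integral>\<^sup>+p. f (?F p) \<partial>?P)"
    using nest(1) f' by (subst nest(2)[symmetric]) (rule nn_integral_distr; simp)
  also have "\<dots> = (\<integral>\<^sup>+p. f (?F (compose I T p)) \<partial>?P)"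
    using measurable_compose[OF nest(1) f']
    by (subst (1) D[symmetric]) (subst nn_integral_distr[OF C]; simp)
  also have "\<dots> = (\<integral>\<^sup>+p. f (?R (?F p)) \<partial>?P)"
  proof (intro nn_integral_cong arg_cong[where f = f] restrict_ext)
    fix p k assume p: "p \<in> space ?P" and k: "k \<in> K"
    have "(\<lambda>j\<in>J. ?F p (g (\<alpha> k) j)) = p (\<alpha> k)"
      using p g ab[OF k] by (auto simp: fun_eq_iff space_PiM space_iid_normal PiE_iff extensional_def)
    then show "compose I T p (\<alpha> k) (\<beta> k) = T (\<lambda>j\<in>J. ?F p (g (\<alpha> k) j)) (\<beta> k)"
      using ab[OF k] by (simp add: compose_def)
  qed
  also have "\<dots> = (\<integral>\<^sup>+w. f (?R w) \<partial>iid_normal K)"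
    using measurable_compose[OF R' f']
    by (subst nest(2)[symmetric]) (subst nn_integral_distr[OF nest(1)]; simp)
  finally show ?thesis .
qed

text \<open>The rotation of the surrounding space: it acts on each point separately.\<close>

lemma rotation_iid_normal_snd:
  assumes fin: "finite I" "finite J" and T: "rotation J T T'"
    and f: "f \<in> borel_measurable (borel_Pi (I \<times> J))"
  shows "(\<integral>\<^sup>+w. f w \<partial>iid_normal (I \<times> J)) =
    (\<integral>\<^sup>+w. f (\<lambda>k\<in>I \<times> J. T (\<lambda>j\<in>J. w (fst k, j)) (snd k)) \<partial>iid_normal (I \<times> J))"
proof (rule rotation_iid_normal_nested[OF fin _ _ T f, where g = "\<lambda>i j. (i, j)"])
  show "bij_betw (\<lambda>k. (fst k, snd k)) (I \<times> J) (I \<times> J)" by (simp add: bij_betw_def)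
qed auto

text \<open>The rotation of the index space: it mixes the points, in each coordinate by the same
  coefficients.\<close>

lemma rotation_iid_normal_fst:
  assumes fin: "finite I" "finite J" and T: "rotation I T T'"
    and f: "f \<in> borel_measurable (borel_Pi (I \<times> J))"
  shows "(\<integral>\<^sup>+w. f w \<partial>iid_normal (I \<times> J)) =
    (\<integral>\<^sup>+w. f (\<lambda>k\<in>I \<times> J. T (\<lambda>i\<in>I. w (i, snd k)) (fst k)) \<partial>iid_normal (I \<times> J))"
proof (rule rotation_iid_normal_nested[OF fin(2,1) _ _ T f, where g = "\<lambda>j i. (i, j)"])
  show "bij_betw (\<lambda>k. (snd k, fst k)) (I \<times> J) (J \<times> I)"
    by (rule bij_betwI[where g = "\<lambda>(j, i). (i, j)"]) auto
qed auto

interpretation iid_normal: prob_space "iid_normal K" for K :: "'k set"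
  by (rule prob_space_iid_normal)

section \<open>Lebesgue integrals over finite products\<close>

abbreviation lborel_Pi :: "'k set \<Rightarrow> ('k \<Rightarrow> real) measure" where
  "lborel_Pi K \<equiv> (\<Pi>\<^sub>M k\<in>K. lborel)"

lemma sets_lborel_Pi: "sets (lborel_Pi K) = sets (borel_Pi K)"
  by (intro sets_PiM_cong) auto

lemma measurable_lborel_Pi: "measurable (lborel_Pi K) N = measurable (borel_Pi K) N"
  by (rule measurable_cong_sets[OF sets_lborel_Pi refl])

lemma nn_integral_lborel_Pi_insert:
  assumes "finite K" "a \<notin> K" "f \<in> borel_measurable (borel_Pi (insert a K))"
  shows "(\<integral>\<^sup>+w. f w \<partial>lborel_Pi (insert a K)) = (\<integral>\<^sup>+w. \<integral>\<^sup>+x. f (w(a := x)) \<partial>lborel \<partial>lborel_Pi K)"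
proof -
  have "f \<in> borel_measurable (lborel_Pi (insert a K))"
    using assms(3) by (simp only: measurable_lborel_Pi)
  then show ?thesis
    by (intro product_sigma_finite.product_nn_integral_insert product_sigma_finite_lborel assms)
qed

lemma sigma_finite_lborel_Pi:
  assumes "finite K"
  shows "sigma_finite_measure (lborel_Pi K)"
proof -
  interpret product_sigma_finite "\<lambda>_::'a. lborel" by (rule product_sigma_finite_lborel)
  show ?thesis by (rule sigma_finite[OF assms])
qed

lemma nn_integral_iid_normal_eq_lborel_Pi:
  assumes "finite K" "f \<in> borel_measurable (borel_Pi K)"
  shows "(\<integral>\<^sup>+w. f w \<partial>iid_normal K) =
    (\<integral>\<^sup>+w. ennreal (\<Prod>k\<in>K. std_normal_density (w k)) * f w \<partial>lborel_Pi K)"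
  using assms
proof (induction K arbitrary: f rule: finite_induct)
  case empty
  then show ?case by (simp add: iid_normal_def PiM_empty nn_integral_count_space_finite)
next
  case (insert a K f)
  note [measurable] = insert.prems
  have "(\<integral>\<^sup>+w. f w \<partial>iid_normal (insert a K)) = (\<integral>\<^sup>+w. \<integral>\<^sup>+x. f (w(a := x)) \<partial>std_normal \<partial>iid_normal K)"
    using insert by (intro nn_integral_iid_normal_insert)
  also have "\<dots> = (\<integral>\<^sup>+w. ennreal (\<Prod>k\<in>K. std_normal_density (w k)) * (\<integral>\<^sup>+x. f (w(a := x)) \<partial>std_normal) \<partial>lborel_Pi K)"
    by (rule insert.IH) measurable
  also have "\<dots> = (\<integral>\<^sup>+w. \<integral>\<^sup>+x. ennreal (\<Prod>k\<in>insert a K. std_normal_density ((w(a := x)) k)) * f (w(a := x)) \<partial>lborel \<partial>lborel_Pi K)"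
  proof (rule nn_integral_cong)
    fix w assume w: "w \<in> space (lborel_Pi K)"
    have [measurable]: "(\<lambda>x. f (w(a := x))) \<in> borel_measurable borel"
      using measurable_compose[OF measurable_component_update[of w K "\<lambda>_. borel" a] insert.prems] w insert.hyps
      by (simp add: space_PiM)
    have "ennreal (\<Prod>k\<in>K. std_normal_density (w k)) * (\<integral>\<^sup>+x. f (w(a := x)) \<partial>std_normal) =
      ennreal (\<Prod>k\<in>K. std_normal_density (w k)) * (\<integral>\<^sup>+x. ennreal (std_normal_density x) * f (w(a := x)) \<partial>lborel)"
      by (subst nn_integral_std_normal) auto
    also have "\<dots> = (\<integral>\<^sup>+x. ennreal (\<Prod>k\<in>K. std_normal_density (w k)) * (ennreal (std_normal_density x) * f (w(a := x))) \<partial>lborel)"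
      by (rule nn_integral_cmult[symmetric]) measurable
    also have "\<dots> = (\<integral>\<^sup>+x. ennreal (\<Prod>k\<in>insert a K. std_normal_density ((w(a := x)) k)) * f (w(a := x)) \<partial>lborel)"
    proof (rule nn_integral_cong)
      fix x
      have "(\<Prod>k\<in>insert a K. std_normal_density ((w(a := x)) k)) =
        std_normal_density x * (\<Prod>k\<in>K. std_normal_density (w k))"
        using insert.hyps by (auto intro!: prod.cong)
      then show "ennreal (\<Prod>k\<in>K. std_normal_density (w k)) * (ennreal (std_normal_density x) * f (w(a := x))) =
        ennreal (\<Prod>k\<in>insert a K. std_normal_density ((w(a := x)) k)) * f (w(a := x))"
        by (simp add: ennreal_mult prod_nonneg mult_ac)
    qed
    finally show "ennreal (\<Prod>k\<in>K. std_normal_density (w k)) * (\<integral>\<^sup>+x. f (w(a := x)) \<partial>std_normal) =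
      (\<integral>\<^sup>+x. ennreal (\<Prod>k\<in>insert a K. std_normal_density ((w(a := x)) k)) * f (w(a := x)) \<partial>lborel)" .
  qed
  also have "\<dots> = (\<integral>\<^sup>+w. ennreal (\<Prod>k\<in>insert a K. std_normal_density (w k)) * f w \<partial>lborel_Pi (insert a K))"
    using insert.hyps by (intro nn_integral_lborel_Pi_insert[symmetric]) measurable
  finally show ?case .
qed

lemma nn_integral_lborel_Pi_affine:
  fixes s t :: real
  assumes "finite K" "s \<noteq> 0" "f \<in> borel_measurable (borel_Pi K)"
  shows "(\<integral>\<^sup>+w. f w \<partial>lborel_Pi K) =
    ennreal (\<bar>s\<bar> ^ card K) * (\<integral>\<^sup>+w. f (\<lambda>k\<in>K. t + s * w k) \<partial>lborel_Pi K)"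
  using assms(1,3)
proof (induction K arbitrary: f rule: finite_induct)
  case empty
  then show ?case by (simp add: PiM_empty nn_integral_count_space_finite)
next
  case (insert a K f)
  note [measurable] = insert.prems
  have "(\<integral>\<^sup>+w. f w \<partial>lborel_Pi (insert a K)) = (\<integral>\<^sup>+w. \<integral>\<^sup>+x. f (w(a := x)) \<partial>lborel \<partial>lborel_Pi K)"
    using insert by (intro nn_integral_lborel_Pi_insert)
  also have "\<dots> = (\<integral>\<^sup>+w. ennreal \<bar>s\<bar> * (\<integral>\<^sup>+x. f (w(a := t + s * x)) \<partial>lborel) \<partial>lborel_Pi K)"
  proof (rule nn_integral_cong)
    fix w assume w: "w \<in> space (lborel_Pi K)"
    have "(\<lambda>x. f (w(a := x))) \<in> borel_measurable borel"
      using measurable_compose[OF measurable_component_update[of w K "\<lambda>_. borel" a] insert.prems] w insert.hyps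
      by (simp add: space_PiM)
    then show "(\<integral>\<^sup>+x. f (w(a := x)) \<partial>lborel) = ennreal \<bar>s\<bar> * (\<integral>\<^sup>+x. f (w(a := t + s * x)) \<partial>lborel)"
      by (rule nn_integral_real_affine[OF _ assms(2)])
  qed
  also have "\<dots> = ennreal \<bar>s\<bar> * (\<integral>\<^sup>+w. (\<integral>\<^sup>+x. f (w(a := t + s * x)) \<partial>lborel) \<partial>lborel_Pi K)"
    by (rule nn_integral_cmult) measurable
  also have "(\<integral>\<^sup>+w. (\<integral>\<^sup>+x. f (w(a := t + s * x)) \<partial>lborel) \<partial>lborel_Pi K) =
    ennreal (\<bar>s\<bar> ^ card K) * (\<integral>\<^sup>+w. (\<integral>\<^sup>+x. f ((\<lambda>k\<in>K. t + s * w k)(a := t + s * x)) \<partial>lborel) \<partial>lborel_Pi K)"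
    by (rule insert.IH) measurable
  also have "(\<integral>\<^sup>+w. (\<integral>\<^sup>+x. f ((\<lambda>k\<in>K. t + s * w k)(a := t + s * x)) \<partial>lborel) \<partial>lborel_Pi K) =
    (\<integral>\<^sup>+w. (\<integral>\<^sup>+x. f (\<lambda>k\<in>insert a K. t + s * (w(a := x)) k) \<partial>lborel) \<partial>lborel_Pi K)"
    using insert.hyps
    by (intro nn_integral_cong arg_cong[where f = f]) (auto simp: fun_eq_iff)
  also have "\<dots> = (\<integral>\<^sup>+w. f (\<lambda>k\<in>insert a K. t + s * w k) \<partial>lborel_Pi (insert a K))"
    using insert.hyps by (intro nn_integral_lborel_Pi_insert[symmetric]) measurable
  also have "ennreal \<bar>s\<bar> * (ennreal (\<bar>s\<bar> ^ card K) * (\<integral>\<^sup>+w. f (\<lambda>k\<in>insert a K. t + s * w k) \<partial>lborel_Pi (insert a K))) =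
    ennreal (\<bar>s\<bar> ^ card (insert a K)) * (\<integral>\<^sup>+w. f (\<lambda>k\<in>insert a K. t + s * w k) \<partial>lborel_Pi (insert a K))"
    unfolding mult.assoc[symmetric] using insert.hyps by (subst ennreal_mult[symmetric]) simp_all
  finally show ?case .
qed

section \<open>Polar decomposition\<close>

definition norm_on :: "'k set \<Rightarrow> ('k \<Rightarrow> real) \<Rightarrow> real" where
  "norm_on K w = sqrt (\<Sum>k\<in>K. (w k)\<^sup>2)"

lemma norm_on_nonneg: "norm_on K w \<ge> 0"
  by (simp add: norm_on_def sum_nonneg)

lemma norm_on_scale: "s \<ge> 0 \<Longrightarrow> norm_on K (\<lambda>k\<in>K. s * w k) = s * norm_on K w"
  by (simp add: norm_on_def power_mult_distrib sum_distrib_left[symmetric] real_sqrt_mult)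

lemma norm_on_eq_0_iff: "finite K \<Longrightarrow> norm_on K w = 0 \<longleftrightarrow> (\<forall>k\<in>K. w k = 0)"
  by (simp add: norm_on_def sum_nonneg_eq_0_iff)

lemma measurable_norm_on [measurable]: "norm_on K \<in> borel_measurable (borel_Pi K)"
  unfolding norm_on_def[abs_def] by measurable

lemma AE_lborel_Pi_norm_on:
  assumes "finite K" "K \<noteq> {}"
  shows "AE w in lborel_Pi K. norm_on K w > 0"
proof -
  obtain a where a: "a \<in> K" using assms by auto
  define L where "L = K - {a}"
  have K: "K = insert a L" "a \<notin> L" "finite L" using a assms by (auto simp: L_def)
  have [measurable]: "(\<lambda>w. indicator {0} (w a :: real) :: ennreal) \<in> borel_measurable (borel_Pi K)"
    by (rule measurable_compose[OF measurable_component_singleton[OF a] borel_measurable_indicator]) simp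
  have "(\<integral>\<^sup>+w. indicator {0} (w a) \<partial>lborel_Pi K) = (\<integral>\<^sup>+w. \<integral>\<^sup>+x. indicator {0} ((w(a := x)) a) \<partial>lborel \<partial>lborel_Pi L)"
    unfolding K(1) using K by (intro nn_integral_lborel_Pi_insert) (auto simp: K(1)[symmetric])
  also have "\<dots> = 0" by simp
  finally have "AE w in lborel_Pi K. (indicator {0} (w a) :: ennreal) = 0"
    by (subst (asm) nn_integral_0_iff_AE) (auto simp: measurable_lborel_Pi)
  then show ?thesis
  proof eventually_elim
    case (elim w)
    then have "w a \<noteq> 0" by (auto simp: indicator_def split: if_splits)
    then show ?case using a assms norm_on_nonneg[of K w] norm_on_eq_0_iff[of K w] by force
  qed
qed

text \<open>This takes the role of polar coordinates. Write the left side as a double integral over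
  \<open>w\<close> and \<open>c\<close>. Scaling \<open>w\<close> by |c| turns the argument of
  \<open>g\<close> into |c| |w|; scaling \<open>c\<close> by 1 / |w| then makes \<open>g\<close>
  depend on \<open>c\<close> only and \<open>h\<close> on |c| / |w|; scaling \<open>w\<close> by |c|
  once more makes \<open>h\<close> depend on \<open>w\<close> only. As \<open>f\<close> ignores all
  scalings, the variables are separated, and the last factor on the right does not involve
  \<open>g\<close>.\<close>

lemma nn_integral_homogeneous_radial:
  fixes g h :: "real \<Rightarrow> ennreal"
  assumes K: "finite K" "K \<noteq> {}"
    and f [measurable]: "f \<in> borel_measurable (borel_Pi K)"
    and g [measurable]: "g \<in> borel_measurable borel" and h [measurable]: "h \<in> borel_measurable borel"
    and hom: "\<And>s w. s > 0 \<Longrightarrow> w \<in> space (borel_Pi K) \<Longrightarrow> f (\<lambda>k\<in>K. s * w k) = f w"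
  shows "(\<integral>\<^sup>+w. f w * g (norm_on K w) \<partial>lborel_Pi K) * (\<integral>\<^sup>+w. h (norm_on K w) \<partial>lborel_Pi K) =
    (\<integral>\<^sup>+w. g (norm_on K w) \<partial>lborel_Pi K) *
    (\<integral>\<^sup>+w. ennreal (1 / norm_on K w ^ card K) * ennreal (1 / norm_on K w ^ card K) * h (1 / norm_on K w) * f w \<partial>lborel_Pi K)"
proof -
  let ?L = "lborel_Pi K" and ?N = "norm_on K" and ?k = "card K"
  interpret L: sigma_finite_measure ?L by (rule sigma_finite_lborel_Pi[OF K(1)])
  interpret LL: pair_sigma_finite ?L ?L ..
  note AE = AE_lborel_Pi_norm_on[OF K]
  have scale: "(\<integral>\<^sup>+w. F w \<partial>?L) = ennreal (s ^ ?k) * (\<integral>\<^sup>+w. F (\<lambda>k\<in>K. s * w k) \<partial>?L)"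
    if "s > 0" "F \<in> borel_measurable (borel_Pi K)" for s F
    using nn_integral_lborel_Pi_affine[of K s F 0] that K by simp
  define G where "G = (\<lambda>w c. ennreal (1 / ?N w ^ ?k) * h (?N c / ?N w) * ennreal ((?N c / ?N w) ^ ?k) * f w * g (?N c))"
  have Gm [measurable]: "(\<lambda>(w, c). G w c) \<in> borel_measurable (borel_Pi K \<Otimes>\<^sub>M borel_Pi K)"
    unfolding G_def by measurable
  have "(\<integral>\<^sup>+w. f w * g (?N w) \<partial>?L) * (\<integral>\<^sup>+w. h (?N w) \<partial>?L) =
    (\<integral>\<^sup>+c. (\<integral>\<^sup>+w. f w * g (?N w) \<partial>?L) * h (?N c) \<partial>?L)"
    by (rule nn_integral_cmult[symmetric]) measurable
  also have "\<dots> = (\<integral>\<^sup>+c. \<integral>\<^sup>+w. h (?N c) * ennreal (?N c ^ ?k) * (f w * g (?N c * ?N w)) \<partial>?L \<partial>?L)"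
  proof (rule nn_integral_cong_AE, use AE AE_space in eventually_elim)
    case (elim c)
    have "(\<integral>\<^sup>+w. f w * g (?N w) \<partial>?L) = ennreal (?N c ^ ?k) *
        (\<integral>\<^sup>+w. f (\<lambda>k\<in>K. ?N c * w k) * g (?N (\<lambda>k\<in>K. ?N c * w k)) \<partial>?L)"
      using elim by (intro scale) measurable
    also have "(\<integral>\<^sup>+w. f (\<lambda>k\<in>K. ?N c * w k) * g (?N (\<lambda>k\<in>K. ?N c * w k)) \<partial>?L) =
        (\<integral>\<^sup>+w. f w * g (?N c * ?N w) \<partial>?L)"
      using elim by (intro nn_integral_cong) (simp add: hom norm_on_scale space_PiM)
    finally have "(\<integral>\<^sup>+w. f w * g (?N w) \<partial>?L) * h (?N c) =
      h (?N c) * ennreal (?N c ^ ?k) * (\<integral>\<^sup>+w. f w * g (?N c * ?N w) \<partial>?L)"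
      by (simp add: mult_ac)
    also have "\<dots> = (\<integral>\<^sup>+w. h (?N c) * ennreal (?N c ^ ?k) * (f w * g (?N c * ?N w)) \<partial>?L)"
      by (rule nn_integral_cmult[symmetric]) measurable
    finally show ?case .
  qed
  also have "\<dots> = (\<integral>\<^sup>+w. \<integral>\<^sup>+c. h (?N c) * ennreal (?N c ^ ?k) * (f w * g (?N c * ?N w)) \<partial>?L \<partial>?L)"
    by (rule LL.Fubini') measurable
  also have "\<dots> = (\<integral>\<^sup>+w. \<integral>\<^sup>+c. G w c \<partial>?L \<partial>?L)"
  proof (rule nn_integral_cong_AE, use AE AE_space in eventually_elim)
    case (elim w)
    let ?s = "1 / ?N w"
    have s: "?s > 0" using elim by simp
    have "(\<integral>\<^sup>+c. h (?N c) * ennreal (?N c ^ ?k) * (f w * g (?N c * ?N w)) \<partial>?L) =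
      ennreal (?s ^ ?k) * (\<integral>\<^sup>+c. h (?N (\<lambda>k\<in>K. ?s * c k)) * ennreal (?N (\<lambda>k\<in>K. ?s * c k) ^ ?k) *
        (f w * g (?N (\<lambda>k\<in>K. ?s * c k) * ?N w)) \<partial>?L)"
      using s by (intro scale) measurable
    also have "\<dots> = ennreal (?s ^ ?k) * (\<integral>\<^sup>+c. h (?N c / ?N w) * ennreal ((?N c / ?N w) ^ ?k) * (f w * g (?N c)) \<partial>?L)"
    proof -
      have "?N (\<lambda>k\<in>K. ?s * c k) = ?N c / ?N w" for c
        using norm_on_scale[of ?s K c] s by simp
      moreover have "?N c / ?N w * ?N w = ?N c" for c
        using elim by simp
      ultimately show ?thesis by (simp only:)
    qed
    also have "\<dots> = (\<integral>\<^sup>+c. ennreal (?s ^ ?k) * (h (?N c / ?N w) * ennreal ((?N c / ?N w) ^ ?k) * (f w * g (?N c))) \<partial>?L)"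
      by (rule nn_integral_cmult[symmetric]) measurable
    also have "\<dots> = (\<integral>\<^sup>+c. G w c \<partial>?L)"
      by (simp add: G_def mult_ac power_one_over)
    finally show ?case .
  qed
  also have "\<dots> = (\<integral>\<^sup>+c. \<integral>\<^sup>+w. G w c \<partial>?L \<partial>?L)"
    by (rule LL.Fubini') measurable
  also have "\<dots> = (\<integral>\<^sup>+c. g (?N c) * (\<integral>\<^sup>+w. ennreal (1 / ?N w ^ ?k) * ennreal (1 / ?N w ^ ?k) * h (1 / ?N w) * f w \<partial>?L) \<partial>?L)"
  proof (rule nn_integral_cong_AE, use AE AE_space in eventually_elim)
    case (elim c)
    then have [measurable]: "c \<in> space (borel_Pi K)" by (simp add: space_PiM)
    have "(\<integral>\<^sup>+w. G w c \<partial>?L) = ennreal (?N c ^ ?k) * (\<integral>\<^sup>+w. G (\<lambda>k\<in>K. ?N c * w k) c \<partial>?L)"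
      by (rule scale[OF elim(1)]) measurable
    also have "\<dots> = (\<integral>\<^sup>+w. ennreal (?N c ^ ?k) * G (\<lambda>k\<in>K. ?N c * w k) c \<partial>?L)"
      using elim by (intro nn_integral_cmult[symmetric]) measurable
    also have "\<dots> = (\<integral>\<^sup>+w. g (?N c) * (ennreal (1 / ?N w ^ ?k) * ennreal (1 / ?N w ^ ?k) * h (1 / ?N w) * f w) \<partial>?L)"
    proof (rule nn_integral_cong)
      fix w assume w: "w \<in> space ?L"
      have 1: "ennreal (?N c ^ ?k) * ennreal (1 / (?N c * ?N w) ^ ?k) = ennreal (1 / ?N w ^ ?k)"
        using elim norm_on_nonneg[of K w]
        by (simp add: ennreal_mult[symmetric] power_mult_distrib)
      have 2: "?N c / (?N c * ?N w) = 1 / ?N w" using elim by simp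
      have 3: "?N (\<lambda>k\<in>K. ?N c * w k) = ?N c * ?N w" "f (\<lambda>k\<in>K. ?N c * w k) = f w"
        using elim w by (simp_all add: norm_on_scale hom space_PiM)
      have "ennreal (?N c ^ ?k) * G (\<lambda>k\<in>K. ?N c * w k) c =
        (ennreal (?N c ^ ?k) * ennreal (1 / (?N c * ?N w) ^ ?k)) * h (1 / ?N w) * ennreal (1 / ?N w ^ ?k) * f w * g (?N c)"
        unfolding G_def 3 2 power_one_over by (simp only: mult_ac)
      then show "ennreal (?N c ^ ?k) * G (\<lambda>k\<in>K. ?N c * w k) c =
        g (?N c) * (ennreal (1 / ?N w ^ ?k) * ennreal (1 / ?N w ^ ?k) * h (1 / ?N w) * f w)"
        unfolding 1 by (simp add: mult_ac)
    qed
    also have "\<dots> = g (?N c) * (\<integral>\<^sup>+w. ennreal (1 / ?N w ^ ?k) * ennreal (1 / ?N w ^ ?k) * h (1 / ?N w) * f w \<partial>?L)"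
      by (rule nn_integral_cmult) measurable
    finally show ?case .
  qed
  also have "\<dots> = (\<integral>\<^sup>+c. g (?N c) \<partial>?L) * (\<integral>\<^sup>+w. ennreal (1 / ?N w ^ ?k) * ennreal (1 / ?N w ^ ?k) * h (1 / ?N w) * f w \<partial>?L)"
    by (rule nn_integral_multc) measurable
  finally show ?thesis .
qed

text \<open>Independence of direction and radius. The previous identity is used for the pairs
  \<open>h\<close>, \<open>g\<close> and \<open>g\<close>, \<open>g\<close>; both contain the same
  unevaluated last factor, which is eliminated with the normalisation of \<open>g\<close>.\<close>

lemma nn_integral_homogeneous_radial_prob:
  fixes g h :: "real \<Rightarrow> ennreal"
  assumes K: "finite K" "K \<noteq> {}"
    and f: "f \<in> borel_measurable (borel_Pi K)"
    and g: "g \<in> borel_measurable borel" and h: "h \<in> borel_measurable borel"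
    and hom: "\<And>s w. s > 0 \<Longrightarrow> w \<in> space (borel_Pi K) \<Longrightarrow> f (\<lambda>k\<in>K. s * w k) = f w"
    and one: "(\<integral>\<^sup>+w. g (norm_on K w) \<partial>lborel_Pi K) = 1"
  shows "(\<integral>\<^sup>+w. f w * h (norm_on K w) \<partial>lborel_Pi K) =
    (\<integral>\<^sup>+w. h (norm_on K w) \<partial>lborel_Pi K) * (\<integral>\<^sup>+w. f w * g (norm_on K w) \<partial>lborel_Pi K)"
  using nn_integral_homogeneous_radial[OF K f h g hom] nn_integral_homogeneous_radial[OF K f g g hom]
  by (simp add: one)

definition radial_normal_density :: "nat \<Rightarrow> real \<Rightarrow> real" where
  "radial_normal_density n r = (1 / sqrt (2 * pi)) ^ n * exp (- r\<^sup>2 / 2)"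

lemma measurable_radial_normal_density [measurable]: "radial_normal_density n \<in> borel_measurable borel"
  unfolding radial_normal_density_def[abs_def] by measurable

lemma prod_std_normal_density:
  "finite K \<Longrightarrow> (\<Prod>k\<in>K. std_normal_density (w k)) = radial_normal_density (card K) (norm_on K w)"
proof -
  assume K: "finite K"
  have "(\<Prod>k\<in>K. std_normal_density (w k)) = (1 / sqrt (2 * pi)) ^ card K * (\<Prod>k\<in>K. exp (- (w k)\<^sup>2 / 2))"
    by (simp only: std_normal_density_def prod.distrib prod_constant)
  also have "(\<Prod>k\<in>K. exp (- (w k)\<^sup>2 / 2)) = exp (- (norm_on K w)\<^sup>2 / 2)"
    using K by (simp add: exp_sum[symmetric] norm_on_def sum_nonneg sum_negf sum_divide_distrib)
  finally show ?thesis by (simp add: radial_normal_density_def)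
qed

lemma nn_integral_iid_normal_radial:
  assumes "finite K" "f \<in> borel_measurable (borel_Pi K)"
  shows "(\<integral>\<^sup>+w. f w \<partial>iid_normal K) =
    (\<integral>\<^sup>+w. f w * ennreal (radial_normal_density (card K) (norm_on K w)) \<partial>lborel_Pi K)"
  using nn_integral_iid_normal_eq_lborel_Pi[OF assms] assms(1)
  by (simp add: prod_std_normal_density mult.commute)

lemma AE_iid_normal_norm_on:
  assumes "finite K" "K \<noteq> {}"
  shows "AE w in iid_normal K. norm_on K w > 0"
proof -
  let ?f = "\<lambda>w. indicator {0} (norm_on K w) :: ennreal"
  have f: "?f \<in> borel_measurable (borel_Pi K)"
    by (rule measurable_compose[OF measurable_norm_on borel_measurable_indicator]) simp
  have "(\<integral>\<^sup>+w. ?f w \<partial>iid_normal K) = (\<integral>\<^sup>+w. ?f w * ennreal (radial_normal_density (card K) (norm_on K w)) \<partial>lborel_Pi K)"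
    by (rule nn_integral_iid_normal_radial[OF assms(1) f])
  also have "\<dots> = (\<integral>\<^sup>+w. 0 \<partial>lborel_Pi K)"
    using AE_lborel_Pi_norm_on[OF assms] by (intro nn_integral_cong_AE) (auto elim!: eventually_mono)
  finally have "(\<integral>\<^sup>+w. ?f w \<partial>iid_normal K) = 0" by simp
  then have "AE w in iid_normal K. ?f w = 0"
    using f by (subst (asm) nn_integral_0_iff_AE) (auto simp: measurable_iid_normal1)
  then show ?thesis
    using norm_on_nonneg[of K]
    by (auto elim!: eventually_mono simp: indicator_def less_le split: if_splits)
qed

text \<open>Substituting t = |c| u turns the argument of \<open>F\<close> into (z, |z| u), which
  depends only on the direction of \<open>z\<close>; the norm of \<open>c\<close> survives only in
  the density of \<open>u\<close>. There it may be replaced by |z|, which has the same law and is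
  independent of the direction, and substituting back with t = |z| u gives the right side.\<close>

lemma nn_integral_iid_normal_exchange_norm:
  fixes F :: "('k \<Rightarrow> real) \<Rightarrow> real \<Rightarrow> ennreal"
  assumes K: "finite K" "K \<noteq> {}"
    and F [measurable]: "(\<lambda>(w, t). F w t) \<in> borel_measurable (borel_Pi K \<Otimes>\<^sub>M borel)"
    and hom: "\<And>s w t. s > 0 \<Longrightarrow> w \<in> space (borel_Pi K) \<Longrightarrow> F (\<lambda>k\<in>K. s * w k) (s * t) = F w t"
  shows "(\<integral>\<^sup>+c. \<integral>\<^sup>+z. \<integral>\<^sup>+t. F z (norm_on K z * t / norm_on K c) \<partial>std_normal \<partial>iid_normal K \<partial>iid_normal K) =
    (\<integral>\<^sup>+z. \<integral>\<^sup>+t. F z t \<partial>std_normal \<partial>iid_normal K)"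
proof -
  let ?N = "norm_on K" and ?L = "lborel_Pi K" and ?\<phi> = "\<lambda>x. ennreal (std_normal_density x)"
  let ?g = "\<lambda>r. ennreal (radial_normal_density (card K) r)"
  interpret NL: pair_sigma_finite "iid_normal K" lborel ..
  interpret LN: pair_sigma_finite lborel "iid_normal K" ..
  interpret NN: pair_sigma_finite "iid_normal K" "iid_normal K" ..
  have affine: "(\<integral>\<^sup>+t. F z t \<partial>std_normal) = (\<integral>\<^sup>+u. ennreal s * ?\<phi> (s * u) * F z (s * u) \<partial>lborel)"
    if "z \<in> space (borel_Pi K)" "s > 0" for z s
  proof -
    note [measurable] = that(1)
    have "(\<integral>\<^sup>+t. F z t \<partial>std_normal) = (\<integral>\<^sup>+t. ?\<phi> t * F z t \<partial>lborel)"
      by (rule nn_integral_std_normal) measurable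
    also have "\<dots> = ennreal \<bar>s\<bar> * (\<integral>\<^sup>+u. ?\<phi> (0 + s * u) * F z (0 + s * u) \<partial>lborel)"
      using that by (intro nn_integral_real_affine) simp_all
    also have "\<dots> = (\<integral>\<^sup>+u. ennreal s * (?\<phi> (s * u) * F z (s * u)) \<partial>lborel)"
      using that(2) by (simp add: nn_integral_cmult)
    finally show ?thesis by (simp add: mult_ac)
  qed
  have affine2: "(\<integral>\<^sup>+t. F z (?N z * t / ?N c) \<partial>std_normal) =
      (\<integral>\<^sup>+u. ennreal (?N c) * ?\<phi> (?N c * u) * F z (?N z * u) \<partial>lborel)"
    if "z \<in> space (borel_Pi K)" "?N c > 0" for z c
  proof -
    note [measurable] = that(1)
    have "(\<integral>\<^sup>+t. F z (?N z * t / ?N c) \<partial>std_normal) = (\<integral>\<^sup>+t. ?\<phi> t * F z (?N z * t / ?N c) \<partial>lborel)"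
      by (rule nn_integral_std_normal) measurable
    also have "\<dots> = ennreal \<bar>?N c\<bar> * (\<integral>\<^sup>+u. ?\<phi> (0 + ?N c * u) * F z (?N z * (0 + ?N c * u) / ?N c) \<partial>lborel)"
      using that by (intro nn_integral_real_affine) simp_all
    also have "\<dots> = ennreal (?N c) * (\<integral>\<^sup>+u. ?\<phi> (?N c * u) * F z (?N z * u) \<partial>lborel)"
      using that(2) by simp
    also have "\<dots> = (\<integral>\<^sup>+u. ennreal (?N c) * (?\<phi> (?N c * u) * F z (?N z * u)) \<partial>lborel)"
      by (rule nn_integral_cmult[symmetric]) measurable
    finally show ?thesis by (simp add: mult_ac)
  qed
  have one: "(\<integral>\<^sup>+w. ?g (?N w) \<partial>?L) = 1"
    using nn_integral_iid_normal_radial[OF K(1), of "\<lambda>_. 1"] iid_normal.emeasure_space_1[of K] by simp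
  \<comment> \<open>For fixed \<open>u\<close>, \<open>?f\<close> is invariant under scaling of
    \<open>z\<close>. Hence averaging \<open>?h\<close> over the norm of an independent
    \<open>c\<close> has the same effect as inserting the norm of \<open>z\<close> itself.\<close>
  have radial: "(\<integral>\<^sup>+z. \<integral>\<^sup>+c. ennreal (?N c) * ?\<phi> (?N c * u) * F z (?N z * u) \<partial>iid_normal K \<partial>iid_normal K) =
      (\<integral>\<^sup>+z. ennreal (?N z) * ?\<phi> (?N z * u) * F z (?N z * u) \<partial>iid_normal K)" for u
  proof -
    let ?f = "\<lambda>z. F z (?N z * u)" and ?h = "\<lambda>r. ennreal r * ?\<phi> (r * u)"
    have "(\<integral>\<^sup>+z. \<integral>\<^sup>+c. ?h (?N c) * ?f z \<partial>iid_normal K \<partial>iid_normal K) =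
        (\<integral>\<^sup>+z. (\<integral>\<^sup>+c. ?h (?N c) \<partial>iid_normal K) * ?f z \<partial>iid_normal K)"
      by (intro nn_integral_cong nn_integral_multc) measurable
    also have "\<dots> = (\<integral>\<^sup>+c. ?h (?N c) \<partial>iid_normal K) * (\<integral>\<^sup>+z. ?f z \<partial>iid_normal K)"
      by (rule nn_integral_cmult) measurable
    also have "\<dots> = (\<integral>\<^sup>+c. ?h (?N c) * ?g (?N c) \<partial>?L) * (\<integral>\<^sup>+z. ?f z * ?g (?N z) \<partial>?L)"
      by (intro arg_cong2[where f = "(*)"] nn_integral_iid_normal_radial K) measurable
    also have "\<dots> = (\<integral>\<^sup>+z. ?f z * (?h (?N z) * ?g (?N z)) \<partial>?L)"
    proof (rule nn_integral_homogeneous_radial_prob[OF K _ _ _ _ one, symmetric])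
      fix s :: real and w :: "'k \<Rightarrow> real" assume s: "s > 0" and w: "w \<in> space (borel_Pi K)"
      show "?f (\<lambda>k\<in>K. s * w k) = ?f w"
        using hom[OF s w, of "?N w * u"] s by (simp add: norm_on_scale mult.assoc)
    qed measurable
    also have "\<dots> = (\<integral>\<^sup>+z. (?h (?N z) * ?f z) * ?g (?N z) \<partial>?L)"
      by (simp add: mult_ac)
    also have "\<dots> = (\<integral>\<^sup>+z. ?h (?N z) * ?f z \<partial>iid_normal K)"
      by (intro nn_integral_iid_normal_radial[symmetric] K) measurable
    finally show ?thesis .
  qed
  have "(\<integral>\<^sup>+c. \<integral>\<^sup>+z. \<integral>\<^sup>+t. F z (?N z * t / ?N c) \<partial>std_normal \<partial>iid_normal K \<partial>iid_normal K) =
    (\<integral>\<^sup>+c. \<integral>\<^sup>+z. \<integral>\<^sup>+u. ennreal (?N c) * ?\<phi> (?N c * u) * F z (?N z * u) \<partial>lborel \<partial>iid_normal K \<partial>iid_normal K)"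
    using AE_iid_normal_norm_on[OF K]
    by (intro nn_integral_cong_AE) (auto elim!: eventually_mono intro!: nn_integral_cong affine2 simp: space_iid_normal space_PiM)
  also have "\<dots> = (\<integral>\<^sup>+c. \<integral>\<^sup>+u. \<integral>\<^sup>+z. ennreal (?N c) * ?\<phi> (?N c * u) * F z (?N z * u) \<partial>iid_normal K \<partial>lborel \<partial>iid_normal K)"
  proof (rule nn_integral_cong)
    fix c assume "c \<in> space (iid_normal K)"
    then have [measurable]: "c \<in> space (borel_Pi K)" by (simp add: space_iid_normal space_PiM)
    show "(\<integral>\<^sup>+z. \<integral>\<^sup>+u. ennreal (?N c) * ?\<phi> (?N c * u) * F z (?N z * u) \<partial>lborel \<partial>iid_normal K) =
      (\<integral>\<^sup>+u. \<integral>\<^sup>+z. ennreal (?N c) * ?\<phi> (?N c * u) * F z (?N z * u) \<partial>iid_normal K \<partial>lborel)"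
      by (rule LN.Fubini') measurable
  qed
  also have "\<dots> = (\<integral>\<^sup>+u. \<integral>\<^sup>+c. \<integral>\<^sup>+z. ennreal (?N c) * ?\<phi> (?N c * u) * F z (?N z * u) \<partial>iid_normal K \<partial>iid_normal K \<partial>lborel)"
    by (rule LN.Fubini') measurable
  also have "\<dots> = (\<integral>\<^sup>+u. \<integral>\<^sup>+z. \<integral>\<^sup>+c. ennreal (?N c) * ?\<phi> (?N c * u) * F z (?N z * u) \<partial>iid_normal K \<partial>iid_normal K \<partial>lborel)"
    by (intro nn_integral_cong NN.Fubini') measurable
  also have "\<dots> = (\<integral>\<^sup>+u. \<integral>\<^sup>+z. ennreal (?N z) * ?\<phi> (?N z * u) * F z (?N z * u) \<partial>iid_normal K \<partial>lborel)"
    by (simp only: radial)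
  also have "\<dots> = (\<integral>\<^sup>+z. \<integral>\<^sup>+u. ennreal (?N z) * ?\<phi> (?N z * u) * F z (?N z * u) \<partial>lborel \<partial>iid_normal K)"
    by (rule NL.Fubini') measurable
  also have "\<dots> = (\<integral>\<^sup>+z. \<integral>\<^sup>+t. F z t \<partial>std_normal \<partial>iid_normal K)"
    using AE_iid_normal_norm_on[OF K] AE_space
    by (intro nn_integral_cong_AE, eventually_elim) (auto intro!: affine[symmetric] simp: space_iid_normal space_PiM)
  finally show ?thesis .
qed

section \<open>Measurability of closed conditions\<close>

lemma closed_projection_compact:
  fixes S :: "'a::topological_space set" and T :: "('a \<times> 'b::topological_space) set"
  assumes "compact S" "closed T"
  shows "closed {y. \<exists>x\<in>S. (x, y) \<in> T}"
proof -
  have "closed_map (prod_topology (top_of_set S) (euclidean :: 'b topology)) euclidean snd"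
    using assms(1) by (intro Abstract_Topological_Spaces.closed_map_snd) (simp add: compact_space_subtopology)
  moreover have "prod_topology (top_of_set S) (euclidean :: 'b topology) = top_of_set (S \<times> UNIV)"
    by (metis euclidean_product_topology prod_topology_subtopology_eu subtopology_UNIV)
  moreover have "closedin (top_of_set (S \<times> UNIV)) ((S \<times> UNIV) \<inter> T)"
    using assms(2) by (simp add: closedin_closed_Int)
  ultimately have "closed (snd ` ((S \<times> UNIV) \<inter> T))"
    by (metis closed_map_def closed_closedin)
  also have "snd ` ((S \<times> UNIV) \<inter> T) = {y. \<exists>x\<in>S. (x, y) \<in> T}"
    by force
  finally show ?thesis .
qed

text \<open>The index type is countable, so the Borel sets of the product topology on all functions
  are generated by the coordinates. On the product space a coordinate outside \<open>K\<close> is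
  constant and thus measurable as well.\<close>

lemma pred_PiM_closed:
  fixes S :: "('k::countable \<Rightarrow> real) set"
  assumes "closed S"
  shows "Measurable.pred (borel_Pi K) (\<lambda>w. w \<in> S)"
proof -
  have "(\<lambda>w. w) \<in> borel_Pi K \<rightarrow>\<^sub>M (borel :: ('k \<Rightarrow> real) measure)"
  proof (rule measurable_coordinatewise_then_product)
    fix k show "(\<lambda>w. w k) \<in> borel_Pi K \<rightarrow>\<^sub>M (borel :: real measure)"
    proof (cases "k \<in> K")
      case False
      then show ?thesis
        using measurable_cong[of "borel_Pi K" "\<lambda>w. w k" "\<lambda>_. undefined :: real" borel]
        by (auto simp: space_PiM PiE_iff extensional_def)
    qed (rule measurable_component_singleton)
  qed
  moreover have "S \<in> sets borel" using assms by simp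
  ultimately show ?thesis by measurable
qed

lemma rotation_adjoint:
  assumes "rotation I T T'"
  shows "(\<Sum>i\<in>I. u i * T' v i) = (\<Sum>i\<in>I. T u i * v i)"
proof -
  have "(\<Sum>i\<in>I. T u i * T (T' v) i) = (\<Sum>i\<in>I. u i * T' v i)" and "T (T' v) = v"
    using assms unfolding rotation_def by blast+
  then show ?thesis by simp
qed

section \<open>Linear dependencies of Gaussian points\<close>

text \<open>Negative scalars are included because a dependency is determined only up to a nonzero
  factor. Closedness provides measurability. The last clause makes the total functions stand for
  vectors indexed by \<open>I\<close>.\<close>

definition cone_on :: "'i set \<Rightarrow> ('i \<Rightarrow> real) set \<Rightarrow> bool" where
  "cone_on I A \<longleftrightarrow> closed A \<and> (\<forall>v\<in>A. \<forall>c. c \<noteq> 0 \<longrightarrow> (\<lambda>i. c * v i) \<in> A) \<and>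
     (\<forall>v w. (\<forall>i\<in>I. v i = w i) \<longrightarrow> v \<in> A \<longrightarrow> w \<in> A)"

text \<open>The rows of the matrix \<open>w\<close> are the points. Because of the existential
  quantifier the event is meaningful before dependencies are known to be unique up to scaling, and
  it commutes with unions of the sets \<open>A\<close>.\<close>

definition dependent_in :: "'i set \<Rightarrow> 'j set \<Rightarrow> ('i \<Rightarrow> real) set \<Rightarrow> ('i \<times> 'j \<Rightarrow> real) \<Rightarrow> bool" where
  "dependent_in I J A w \<longleftrightarrow> (\<exists>v\<in>A. (\<exists>i\<in>I. v i \<noteq> 0) \<and> (\<forall>j\<in>J. (\<Sum>i\<in>I. v i * w (i, j)) = 0))"

lemma cone_on_cong: "cone_on I A \<Longrightarrow> (\<And>i. i \<in> I \<Longrightarrow> v i = w i) \<Longrightarrow> v \<in> A \<longleftrightarrow> w \<in> A"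
  unfolding cone_on_def by metis

lemma cone_on_scale: "cone_on I A \<Longrightarrow> c \<noteq> 0 \<Longrightarrow> (\<And>i. i \<in> I \<Longrightarrow> w i = c * v i) \<Longrightarrow> w \<in> A \<longleftrightarrow> v \<in> A"
proof -
  assume A: "cone_on I A" "c \<noteq> 0" "\<And>i. i \<in> I \<Longrightarrow> w i = c * v i"
  have *: "(\<lambda>i. k * u i) \<in> A" if "u \<in> A" "k \<noteq> 0" for u k
    using A(1) that unfolding cone_on_def by blast
  have "w \<in> A \<longleftrightarrow> (\<lambda>i. c * v i) \<in> A"
    using A by (intro cone_on_cong[OF A(1)]) auto
  also have "\<dots> \<longleftrightarrow> v \<in> A"
    using *[of v c] *[of "\<lambda>i. c * v i" "1 / c"] A(2) by auto
  finally show ?thesis .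
qed

text \<open>Rescaling a dependency so that its largest coefficient equals 1 confines it to a compact set.\<close>

lemma closed_dependent_in:
  assumes fin: "finite I" and A: "cone_on I A"
  shows "closed {w. dependent_in I J A w}"
proof -
  let ?D = "{(v, w). v \<in> A \<and> (\<forall>j\<in>J. (\<Sum>i\<in>I. v i * w (i, j)) = 0)}"
  \<comment> \<open>A face of the cube: coordinate \<open>i\<close> equals 1 and the others in
    \<open>I\<close> lie between -1 and 1. Coordinates outside \<open>I\<close> are fixed at 0,
    which keeps the set compact and is harmless since \<open>A\<close> does not see them.\<close>
  define B where "B i = PiE UNIV (\<lambda>l. if l = i then {1} else if l \<in> I then {-1..1} else {0::real})" for i
  have B: "compact (B i)" for i
  proof -
    have "compactin (product_topology (\<lambda>_. euclidean) UNIV) (B i)"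
      unfolding B_def by (subst compactin_PiE) auto
    then show ?thesis by (simp add: euclidean_product_topology)
  qed
  have eq: "{w. dependent_in I J A w} =
    (\<Union>i\<in>I. {w. \<exists>v\<in>B i. (v, w) \<in> ?D})"
  proof (intro set_eqI iffI)
    fix w assume "w \<in> {w. dependent_in I J A w}"
    then obtain v i0 where v: "v \<in> A" "i0 \<in> I" "v i0 \<noteq> 0" and dep: "\<forall>j\<in>J. (\<Sum>i\<in>I. v i * w (i, j)) = 0"
      by (auto simp: dependent_in_def)
    define m where "m = Max ((\<lambda>i. \<bar>v i\<bar>) ` I)"
    have "m \<in> (\<lambda>i. \<bar>v i\<bar>) ` I" unfolding m_def using fin v(2) by (intro Max_in) auto
    then obtain i where i: "i \<in> I" "\<bar>v i\<bar> = m" by auto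
    have le: "\<bar>v l\<bar> \<le> m" if "l \<in> I" for l unfolding m_def using fin that by (intro Max_ge) auto
    have m: "m > 0" using le[OF v(2)] v(3) by linarith
    define u where "u = (\<lambda>l. if l \<in> I then v l / v i else 0)"
    have "v i \<noteq> 0" using i m by auto
    then have "u \<in> A"
      using v(1) by (subst cone_on_scale[OF A, of "1 / v i" _ v]) (auto simp: u_def)
    moreover have "u \<in> B i"
    proof -
      have "- 1 \<le> v l / v i \<and> v l / v i \<le> 1" if "l \<in> I" for l
      proof -
        have "\<bar>v l / v i\<bar> \<le> 1" using le[OF that] i(2) m by (simp add: abs_divide)
        then show ?thesis by linarith
      qed
      then show ?thesis
        using i(1) \<open>v i \<noteq> 0\<close> by (auto simp: B_def u_def)
    qed
    moreover have "(\<Sum>i\<in>I. u i * w (i, j)) = 0" if "j \<in> J" for j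
    proof -
      have "(\<Sum>l\<in>I. u l * w (l, j)) = (\<Sum>l\<in>I. v l * w (l, j)) / v i"
        by (simp add: u_def sum_divide_distrib)
      then show ?thesis using dep that by simp
    qed
    ultimately show "w \<in> (\<Union>i\<in>I. {w. \<exists>v\<in>B i. (v, w) \<in> ?D})"
      using i(1) by auto
  next
    fix w assume "w \<in> (\<Union>i\<in>I. {w. \<exists>v\<in>B i. (v, w) \<in> ?D})"
    then obtain i v where iv: "i \<in> I" "v \<in> B i" and v: "v \<in> A" "\<forall>j\<in>J. (\<Sum>i\<in>I. v i * w (i, j)) = 0" by blast
    have "v i \<in> (if i = i then {1} else if i \<in> I then {-1..1} else {0})"
      using iv(2) unfolding B_def PiE_iff by blast
    then have "\<exists>i\<in>I. v i \<noteq> 0" using iv(1) by (intro bexI[of _ i]) auto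
    then show "w \<in> {w. dependent_in I J A w}" using v unfolding dependent_in_def by blast
  qed
  have "closed ?D"
  proof -
    have "?D =
      (A \<times> UNIV) \<inter> (\<Inter>j\<in>J. {p. (\<Sum>i\<in>I. fst p i * snd p (i, j)) = 0})"
      by auto
    moreover have "closed (A \<times> (UNIV :: ('a \<times> 'b \<Rightarrow> real) set))"
      using A by (intro closed_Times) (auto simp: cone_on_def)
    moreover have "closed {p :: ('a \<Rightarrow> real) \<times> ('a \<times> 'b \<Rightarrow> real). (\<Sum>i\<in>I. fst p i * snd p (i, j)) = 0}" for j
    proof (intro closed_Collect_eq continuous_on_sum continuous_on_mult continuous_on_const)
      show "continuous_on UNIV (\<lambda>p :: ('a \<Rightarrow> real) \<times> ('a \<times> 'b \<Rightarrow> real). fst p i)" for i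
        by (rule continuous_on_product_then_coordinatewise[OF continuous_on_fst[OF continuous_on_id]])
      show "continuous_on UNIV (\<lambda>p :: ('a \<Rightarrow> real) \<times> ('a \<times> 'b \<Rightarrow> real). snd p (i, j))" for i
        by (rule continuous_on_product_then_coordinatewise[OF continuous_on_snd[OF continuous_on_id]])
    qed
    ultimately show ?thesis by (simp add: closed_Int closed_INT)
  qed
  \<comment> \<open>The coefficient vector ranges over a compact set, so projecting it away
    preserves closedness; the union over the position \<open>i\<close> of the largest coefficient is
    finite.\<close>
  from closed_projection_compact[OF B this] show ?thesis
    unfolding eq using fin by (intro closed_UN) auto
qed

section \<open>Marginals and linear forms of Gaussian vectors\<close>

lemma nn_integral_iid_normal_reindex:
  assumes "inj_on f I" "f ` I \<subseteq> K" "G \<in> borel_measurable (borel_Pi I)"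
  shows "(\<integral>\<^sup>+w. G (\<lambda>i\<in>I. w (f i)) \<partial>iid_normal K) = (\<integral>\<^sup>+t. G t \<partial>iid_normal I)"
proof -
  have D: "distr (iid_normal K) (iid_normal I) (\<lambda>w. \<lambda>i\<in>I. w (f i)) = iid_normal I"
    unfolding iid_normal_def using assms(1,2)
    by (intro distr_PiM_reindex prob_space_std_normal) auto
  have m: "(\<lambda>w. \<lambda>i\<in>I. w (f i)) \<in> iid_normal K \<rightarrow>\<^sub>M iid_normal I"
    unfolding measurable_iid_normal1 measurable_iid_normal2 using assms(2)
    by (intro measurable_restrict measurable_component_singleton) auto
  have "(\<integral>\<^sup>+t. G t \<partial>iid_normal I) = (\<integral>\<^sup>+t. G t \<partial>distr (iid_normal K) (iid_normal I) (\<lambda>w. \<lambda>i\<in>I. w (f i)))"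
    by (simp only: D)
  also have "\<dots> = (\<integral>\<^sup>+w. G (\<lambda>i\<in>I. w (f i)) \<partial>iid_normal K)"
    using assms(3) by (intro nn_integral_distr m) (simp add: measurable_iid_normal1)
  finally show ?thesis ..
qed

lemma nn_integral_iid_normal_component:
  assumes "b \<in> K" "G \<in> borel_measurable borel"
  shows "(\<integral>\<^sup>+w. G (w b) \<partial>iid_normal K) = (\<integral>\<^sup>+x. G x \<partial>std_normal)"
proof -
  interpret N: product_sigma_finite "\<lambda>_::'a. std_normal" by (rule product_sigma_finite_std_normal)
  have m: "(\<lambda>w. G (w b)) \<in> borel_measurable (borel_Pi {b})"
    using assms(2) by measurable
  have "(\<integral>\<^sup>+w. G (w b) \<partial>iid_normal K) = (\<integral>\<^sup>+w. G ((\<lambda>i\<in>{b}. w (id i)) b) \<partial>iid_normal K)"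
    by simp
  also have "\<dots> = (\<integral>\<^sup>+w. G (w b) \<partial>iid_normal {b})"
    using assms(1) m by (intro nn_integral_iid_normal_reindex) auto
  also have "\<dots> = (\<integral>\<^sup>+x. G x \<partial>std_normal)"
    unfolding iid_normal_def using assms(2) by (intro N.product_nn_integral_singleton) simp
  finally show ?thesis .
qed

text \<open>Rotating \<open>z\<close> onto an axis turns the form into a multiple \<open>r\<close>
  of a single coordinate. If \<open>r\<close> is negative, reflection symmetry turns it into the
  norm.\<close>

lemma nn_integral_iid_normal_linear:
  assumes K: "finite K" "K \<noteq> {}" and G: "G \<in> borel_measurable borel"
  shows "(\<integral>\<^sup>+t. G (\<Sum>i\<in>K. z i * t i) \<partial>iid_normal K) = (\<integral>\<^sup>+x. G (norm_on K z * x) \<partial>std_normal)"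
proof -
  obtain b where b: "b \<in> K" using K by auto
  obtain T T' r where T: "rotation K T T'" and Tz: "\<forall>i\<in>K. T z i = (if i = b then r else 0)"
    and r: "r\<^sup>2 = (\<Sum>i\<in>K. (z i)\<^sup>2)"
    using ex_rotation_to_axis[OF K(1) b] by metis
  note [measurable] = G
  have m: "(\<lambda>t. G (\<Sum>i\<in>K. z i * t i)) \<in> borel_measurable (iid_normal K)"
    unfolding measurable_iid_normal1 by measurable
  have T': "T' \<in> iid_normal K \<rightarrow>\<^sub>M iid_normal K" "distr (iid_normal K) (iid_normal K) T' = iid_normal K"
    using rotation_inverse[OF T] by (auto simp: rotation_def)
  have "(\<integral>\<^sup>+t. G (\<Sum>i\<in>K. z i * t i) \<partial>iid_normal K) =
    (\<integral>\<^sup>+t. G (\<Sum>i\<in>K. z i * t i) \<partial>distr (iid_normal K) (iid_normal K) T')"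
    by (simp only: T')
  also have "\<dots> = (\<integral>\<^sup>+t. G (\<Sum>i\<in>K. z i * T' t i) \<partial>iid_normal K)"
    using T'(1) m by (intro nn_integral_distr) simp_all
  also have "\<dots> = (\<integral>\<^sup>+t. G (r * t b) \<partial>iid_normal K)"
  proof (intro nn_integral_cong arg_cong[where f = G])
    fix t
    have "(\<Sum>i\<in>K. z i * T' t i) = (\<Sum>i\<in>K. T z i * t i)"
      by (rule rotation_adjoint[OF T])
    also have "\<dots> = r * t b"
      using K(1) b Tz by (subst sum.remove[of K b]) (auto intro!: sum.neutral)
    finally show "(\<Sum>i\<in>K. z i * T' t i) = r * t b" .
  qed
  also have "\<dots> = (\<integral>\<^sup>+x. G (r * x) \<partial>std_normal)"
    by (rule nn_integral_iid_normal_component[OF b]) measurable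
  also have "\<dots> = (\<integral>\<^sup>+x. G (norm_on K z * x) \<partial>std_normal)"
  proof (cases "r \<ge> 0")
    case True
    then have "r = norm_on K z" by (simp add: norm_on_def r[symmetric])
    then show ?thesis by simp
  next
    case False
    then have "norm_on K z = - r" by (simp add: norm_on_def r[symmetric])
    then show ?thesis
      using nn_integral_std_normal_reflect[of "\<lambda>x. G (r * x)" "-1"] by simp
  qed
  finally show ?thesis .
qed

lemma measurable_indicator_closed:
  fixes S :: "('k::countable \<Rightarrow> real) set"
  assumes "closed S"
  shows "(\<lambda>w. indicator S w :: ennreal) \<in> borel_measurable (borel_Pi K)"
proof -
  have "(\<lambda>w. if w \<in> S then 1 else 0 :: ennreal) \<in> borel_measurable (borel_Pi K)"
    using pred_PiM_closed[OF assms, of K] by (intro measurable_If) simp_all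
  also have "(\<lambda>w. if w \<in> S then 1 else 0 :: ennreal) = (\<lambda>w. indicator S w)"
    by (simp add: fun_eq_iff)
  finally show ?thesis .
qed

lemma rotation_linear:
  assumes "rotation I T T'"
  shows "T (\<lambda>j. \<Sum>s\<in>S. f s * u s j) = (\<lambda>j. \<Sum>s\<in>S. f s * T (u s) j)"
proof -
  have add: "\<And>u v. T (\<lambda>i. u i + v i) = (\<lambda>i. T u i + T v i)" and scale: "\<And>c u. T (\<lambda>i. c * u i) = (\<lambda>i. c * T u i)"
    using assms unfolding rotation_def by blast+
  have zero: "T (\<lambda>_. 0) = (\<lambda>_. 0)"
    using scale[of 0 "\<lambda>_. 0"] by simp
  show ?thesis
  proof (cases "finite S")
    case True
    then show ?thesis
      by (induction S rule: finite_induct) (simp_all add: zero add scale)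
  qed (simp add: zero)
qed

lemma rotation_eq_0_iff:
  assumes "rotation I T T'" "finite I"
  shows "(\<forall>i\<in>I. T u i = 0) \<longleftrightarrow> (\<forall>i\<in>I. u i = 0)"
proof -
  have "(\<Sum>i\<in>I. T u i * T u i) = (\<Sum>i\<in>I. u i * u i)"
    using assms(1) unfolding rotation_def by blast
  moreover have "(\<Sum>i\<in>I. v i * v i) = 0 \<longleftrightarrow> (\<forall>i\<in>I. v i = 0)" for v :: "'a \<Rightarrow> real"
    using assms(2) by (subst sum_nonneg_eq_0_iff) auto
  ultimately show ?thesis by metis
qed

text \<open>The coefficient inserted at \<open>a\<close> is a linear form in the others: it is
  continuous and scales along with them, so the conditions for a cone are inherited.\<close>

lemma cone_on_eliminate:
  assumes I: "finite I" and A: "cone_on (insert a I) A" and a: "a \<notin> I"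
  shows "cone_on I {v. v(a := (\<Sum>i\<in>I. v i * t i)) \<in> A}"
proof -
  let ?g = "\<lambda>v. v(a := (\<Sum>i\<in>I. v i * t i))"
  have 1: "closed (?g -` A)"
  proof (intro closed_vimage)
    show "closed A" using A by (simp add: cone_on_def)
    show "continuous_on UNIV ?g"
    proof (rule continuous_on_coordinatewise_then_product)
      show "continuous_on UNIV (\<lambda>v. ?g v l)" for l
        by (cases "l = a") (auto intro!: continuous_on_sum continuous_on_mult continuous_on_const)
    qed
  qed
  have 2: "?g (\<lambda>i. c * v i) \<in> A \<longleftrightarrow> ?g v \<in> A" if "c \<noteq> 0" for c v
    by (rule cone_on_scale[OF A that]) (auto simp: sum_distrib_left mult.assoc)
  have 3: "?g v \<in> A \<longleftrightarrow> ?g w \<in> A" if "\<forall>i\<in>I. v i = w i" for v w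
    using that by (intro cone_on_cong[OF A]) (auto intro!: sum.cong)
  have eq: "{v. ?g v \<in> A} = ?g -` A" by auto
  show ?thesis
    unfolding cone_on_def
  proof (intro conjI ballI allI impI)
    show "closed {v. ?g v \<in> A}" unfolding eq by (rule 1)
  next
    fix v and c :: real assume "v \<in> {v. ?g v \<in> A}" "c \<noteq> 0"
    then show "(\<lambda>i. c * v i) \<in> {v. ?g v \<in> A}" using 2[of c v] by blast
  next
    fix v w assume "\<forall>i\<in>I. v i = w i" "v \<in> {v. ?g v \<in> A}"
    then show "w \<in> {v. ?g v \<in> A}" using 3[of v w] by blast
  qed
qed

text \<open>
  After the point \<open>c\<close> with index \<open>a\<close> has been rotated onto the axis \<open>b\<close>, the equation for
  coordinate \<open>b\<close> determines the coefficient of \<open>c\<close>, and the others only involve the points in \<open>I\<close>.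
\<close>

lemma dependent_in_rotate:
  assumes I: "finite I" "I = insert b J" "b \<notin> J" and a: "a \<notin> I"
    and T: "rotation I T T'" and Tc: "\<forall>j\<in>I. T c j = (if j = b then r else 0)" and r: "r \<noteq> 0"
    and m: "\<And>j. j \<in> I \<Longrightarrow> m (a, j) = c j"
      "\<And>i j. i \<in> I \<Longrightarrow> j \<in> I \<Longrightarrow> m (i, j) = T' (\<lambda>j\<in>I. w (i, j)) j"
  shows "dependent_in (insert a I) I A m \<longleftrightarrow>
    dependent_in I J {v. v(a := (\<Sum>i\<in>I. v i * (- w (i, b) / r))) \<in> A} w"
proof -
  let ?t = "\<lambda>v. \<Sum>i\<in>I. v i * (- w (i, b) / r)"
  have TT': "T (T' u) = u" for u using T by (simp add: rotation_def)
  have eqs: "(\<forall>j\<in>I. (\<Sum>i\<in>insert a I. v i * m (i, j)) = 0) \<longleftrightarrow>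
      (\<forall>j\<in>J. (\<Sum>i\<in>I. v i * w (i, j)) = 0) \<and> v a = ?t v" for v
  proof -
    define p where "p i = (if i = a then c else T' (\<lambda>j\<in>I. w (i, j)))" for i
    have "(\<forall>j\<in>I. (\<Sum>i\<in>insert a I. v i * m (i, j)) = 0) \<longleftrightarrow> (\<forall>j\<in>I. (\<Sum>i\<in>insert a I. v i * p i j) = 0)"
      using m a by (intro ball_cong refl arg_cong2[where f = "(=)"] sum.cong) (auto simp: p_def)
    \<comment> \<open>A vector vanishes on \<open>I\<close> iff its rotated image does. After the
      rotation, point \<open>a\<close> is \<open>r\<close> times the axis \<open>b\<close> and point
      \<open>i\<close> is the row \<open>i\<close> of \<open>w\<close>.\<close>
    also have "\<dots> \<longleftrightarrow> (\<forall>j\<in>I. T (\<lambda>j. \<Sum>i\<in>insert a I. v i * p i j) j = 0)"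
      by (rule rotation_eq_0_iff[OF T I(1), symmetric])
    also have "\<dots> \<longleftrightarrow> (\<forall>j\<in>I. v a * (if j = b then r else 0) + (\<Sum>i\<in>I. v i * w (i, j)) = 0)"
    proof (intro ball_cong refl arg_cong2[where f = "(=)"])
      fix j assume j: "j \<in> I"
      have "(\<Sum>i\<in>I. v i * T (p i) j) = (\<Sum>i\<in>I. v i * w (i, j))"
        using a j by (intro sum.cong) (auto simp: p_def TT')
      moreover have "T (p a) j = (if j = b then r else 0)"
        using Tc j by (simp add: p_def)
      ultimately show "T (\<lambda>j. \<Sum>i\<in>insert a I. v i * p i j) j = v a * (if j = b then r else 0) + (\<Sum>i\<in>I. v i * w (i, j))"
        unfolding rotation_linear[OF T] using I(1) a by simp
    qed
    also have "\<dots> \<longleftrightarrow> (\<forall>j\<in>J. (\<Sum>i\<in>I. v i * w (i, j)) = 0) \<and> v a * r + (\<Sum>i\<in>I. v i * w (i, b)) = 0"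
      using I(2,3) by auto
    also have "v a * r + (\<Sum>i\<in>I. v i * w (i, b)) = 0 \<longleftrightarrow> v a = - (\<Sum>i\<in>I. v i * w (i, b)) / r"
      using r by (auto simp: field_simps)
    also have "- (\<Sum>i\<in>I. v i * w (i, b)) / r = ?t v"
      by (simp add: sum_divide_distrib sum_negf)
    finally show ?thesis .
  qed
  show ?thesis
  proof
    assume "dependent_in (insert a I) I A m"
    then obtain v where v: "v \<in> A" "\<exists>i\<in>insert a I. v i \<noteq> 0" "\<forall>j\<in>I. (\<Sum>i\<in>insert a I. v i * m (i, j)) = 0"
      by (auto simp: dependent_in_def)
    then have va: "v a = ?t v" and dep: "\<forall>j\<in>J. (\<Sum>i\<in>I. v i * w (i, j)) = 0"
      using eqs by auto
    \<comment> \<open>Nontriviality is not lost by dropping \<open>a\<close>: the coefficient at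
      \<open>a\<close> is a linear form in the others and would vanish with them.\<close>
    have "\<exists>i\<in>I. v i \<noteq> 0"
    proof (rule ccontr)
      assume "\<not> (\<exists>i\<in>I. v i \<noteq> 0)"
      then have "\<forall>i\<in>I. v i = 0" by blast
      moreover from this have "v a = 0" unfolding va by simp
      ultimately show False using v(2) by blast
    qed
    moreover have "v(a := ?t v) = v"
      using va by (metis fun_upd_triv)
    ultimately show "dependent_in I J {v. v(a := ?t v) \<in> A} w"
      using v(1) dep unfolding dependent_in_def by (intro bexI[of _ v]) auto
  next
    assume "dependent_in I J {v. v(a := ?t v) \<in> A} w"
    then obtain v where v: "v(a := ?t v) \<in> A" "\<exists>i\<in>I. v i \<noteq> 0"
      and dep: "\<forall>j\<in>J. (\<Sum>i\<in>I. v i * w (i, j)) = 0"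
      by (auto simp: dependent_in_def)
    define u where "u = v(a := ?t v)"
    have uI: "u i = v i" if "i \<in> I" for i using that a by (auto simp: u_def)
    have s: "(\<Sum>i\<in>I. u i * g i) = (\<Sum>i\<in>I. v i * g i)" for g
      using uI by (intro sum.cong) auto
    have "\<forall>j\<in>I. (\<Sum>i\<in>insert a I. u i * m (i, j)) = 0"
    proof -
      have "u a = ?t v" by (simp add: u_def)
      then show ?thesis unfolding eqs s using dep by blast
    qed
    moreover have "\<exists>i\<in>insert a I. u i \<noteq> 0"
    proof -
      obtain i where "i \<in> I" "v i \<noteq> 0" using v(2) by blast
      then show ?thesis using uI[of i] by (intro bexI[of _ i]) auto
    qed
    ultimately show "dependent_in (insert a I) I A m"
      using v(1) unfolding dependent_in_def u_def[symmetric] by blast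
  qed
qed

text \<open>Condition on the point \<open>c\<close> with index \<open>a\<close> and rotate the other
  points by the rotation that moves \<open>c\<close> onto axis \<open>b\<close>. Their
  \<open>b\<close>-coordinates \<open>t\<close> are independent of the remaining ones. For fixed
  \<open>t\<close>, elimination leaves a problem in one dimension less for the cone
  \<open>B t\<close>, to which the induction hypothesis applies and supplies a Gaussian vector
  \<open>z\<close>. The coefficient of \<open>c\<close> is then a linear form of \<open>t\<close>
  with coefficients \<open>z\<close>, divided by \<open>r\<close>; averaged over \<open>t\<close> it
  is |z| / |c| times a standard normal variable, and the norms are exchanged at the end.\<close>

lemma nn_integral_dependent_in_step:
  fixes I :: "nat set"
  assumes I: "finite I" "I = insert b J" "b \<notin> J" and a: "a \<notin> I" and A: "cone_on (insert a I) A"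
    and IH: "\<And>B. cone_on I B \<Longrightarrow>
      (\<integral>\<^sup>+w. indicator {w. dependent_in I J B w} w \<partial>iid_normal (I \<times> J)) = (\<integral>\<^sup>+z. indicator B z \<partial>iid_normal I)"
  shows "(\<integral>\<^sup>+w. indicator {w. dependent_in (insert a I) I A w} w \<partial>iid_normal (insert a I \<times> I)) =
    (\<integral>\<^sup>+z. indicator A z \<partial>iid_normal (insert a I))"
proof -
  let ?W = "{w. dependent_in (insert a I) I A w}"
  let ?P = "{a} \<times> I" and ?Q = "I \<times> I"
  have fin: "finite ?P" "finite ?Q" "?P \<inter> ?Q = {}" "insert a I \<times> I = ?P \<union> ?Q"
    using I(1) a by auto
  have In: "I \<noteq> {}" using I(2) by auto
  have Am: "(\<lambda>w. indicator A w :: ennreal) \<in> borel_measurable (borel_Pi (insert a I))"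
    using A by (intro measurable_indicator_closed) (simp add: cone_on_def)
  have WM: "(\<lambda>w. indicator ?W w :: ennreal) \<in> borel_measurable (borel_Pi (?P \<union> ?Q))"
    using I(1) by (intro measurable_indicator_closed closed_dependent_in A) simp
  define E where "E c = (\<lambda>k\<in>?P. c (snd k))" for c :: "nat \<Rightarrow> real"
  \<comment> \<open>\<open>t\<close> is the coefficient of the eliminated point, put in front of the
    coefficients \<open>z\<close> of the others.\<close>
  define F where "F z t = (indicator A (z(a := t)) :: ennreal)" for z t
  have F [measurable]: "(\<lambda>(z, t). F z t) \<in> borel_measurable (borel_Pi I \<Otimes>\<^sub>M borel)"
    unfolding F_def split_beta'
    by (rule measurable_compose[OF measurable_add_dim[unfolded split_beta'] Am])
  have main: "(\<integral>\<^sup>+w. indicator ?W (merge ?P ?Q (E c, w)) \<partial>iid_normal ?Q) =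
      (\<integral>\<^sup>+z. \<integral>\<^sup>+t. F z (norm_on I z * t / norm_on I c) \<partial>std_normal \<partial>iid_normal I)"
    if c: "norm_on I c > 0" for c
  proof -
    obtain T T' r where T: "rotation I T T'" and Tc: "\<forall>j\<in>I. T c j = (if j = b then r else 0)"
      and r2: "r\<^sup>2 = (\<Sum>i\<in>I. (c i)\<^sup>2)"
      using ex_rotation_to_axis[of I b c] I by auto
    have rc: "\<bar>r\<bar> = norm_on I c" by (simp add: norm_on_def r2[symmetric])
    then have r: "r \<noteq> 0" using c by auto
    define B where "B t = {v. v(a := (\<Sum>i\<in>I. v i * (- t i / r))) \<in> A}" for t :: "nat \<Rightarrow> real"
    have B: "cone_on I (B t)" for t
      unfolding B_def by (rule cone_on_eliminate[OF I(1) A a])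
    have mg: "(\<lambda>w. merge ?P ?Q (E c, w)) \<in> borel_Pi ?Q \<rightarrow>\<^sub>M borel_Pi (?P \<union> ?Q)"
    proof -
      have "E c \<in> space (borel_Pi ?P)" by (auto simp: E_def space_PiM)
      then show ?thesis by measurable
    qed
    define f where "f w = (indicator ?W (merge ?P ?Q (E c, w)) :: ennreal)" for w
    define R where "R w = (\<lambda>k\<in>?Q. T' (\<lambda>j\<in>I. w (fst k, j)) (snd k))" for w
    have f: "f \<in> borel_measurable (borel_Pi ?Q)"
      unfolding f_def[abs_def] using measurable_compose[OF mg WM] .
    have R: "R \<in> borel_Pi ?Q \<rightarrow>\<^sub>M borel_Pi ?Q"
      unfolding R_def
    proof (intro measurable_restrict)
      fix k assume "k \<in> ?Q"
      then have k: "fst k \<in> I" "snd k \<in> I" by auto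
      have 1: "(\<lambda>w. \<lambda>j\<in>I. w (fst k, j)) \<in> borel_Pi ?Q \<rightarrow>\<^sub>M borel_Pi I"
        using k by (intro measurable_restrict measurable_component_singleton) auto
      have 2: "T' \<in> borel_Pi I \<rightarrow>\<^sub>M borel_Pi I"
        using T unfolding rotation_def measurable_iid_normal1 measurable_iid_normal2 by blast
      show "(\<lambda>w. T' (\<lambda>j\<in>I. w (fst k, j)) (snd k)) \<in> borel_Pi ?Q \<rightarrow>\<^sub>M borel"
        by (rule measurable_compose[OF measurable_compose[OF 1 2] measurable_component_singleton[OF k(2)]])
    qed
    have fR: "(\<lambda>w. f (R w)) \<in> borel_measurable (borel_Pi ?Q)"
      using measurable_compose[OF R f] .
    have fR_eq: "f (R w) = indicator {w. dependent_in I J (B (\<lambda>i. w (i, b))) w} w" for w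
    proof -
      have "dependent_in (insert a I) I A (merge ?P ?Q (E c, R w)) \<longleftrightarrow> dependent_in I J (B (\<lambda>i. w (i, b))) w"
        unfolding B_def
        by (rule dependent_in_rotate[OF I a T Tc r]) (use a in \<open>auto simp: merge_def E_def R_def\<close>)
      then show ?thesis by (simp add: f_def indicator_def)
    qed
    let ?Q1 = "I \<times> {b}" and ?Q2 = "I \<times> J"
    have Q: "?Q = ?Q1 \<union> ?Q2" "?Q1 \<inter> ?Q2 = {}" "finite ?Q1" "finite ?Q2"
      using I by auto
    define H where "H t = (\<integral>\<^sup>+z. F z (\<Sum>i\<in>I. z i * (- t i / r)) \<partial>iid_normal I)" for t
    have Hm: "H \<in> borel_measurable (borel_Pi I)"
      unfolding H_def[abs_def] by measurable
    \<comment> \<open>The points are replaced by their images under \<open>T'\<close>, which does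
      not change the law; then the column \<open>b\<close> is separated from the columns in
      \<open>J\<close>.\<close>
    have "(\<integral>\<^sup>+w. f w \<partial>iid_normal ?Q) = (\<integral>\<^sup>+w. f (R w) \<partial>iid_normal ?Q)"
      unfolding R_def by (rule rotation_iid_normal_snd[OF I(1) I(1) rotation_inverse[OF T] f])
    also have "\<dots> = (\<integral>\<^sup>+t. \<integral>\<^sup>+w. f (R (merge ?Q1 ?Q2 (t, w))) \<partial>iid_normal ?Q2 \<partial>iid_normal ?Q1)"
      using fR unfolding Q(1) by (rule nn_integral_iid_normal_Un[OF Q(2-4)])
    also have "\<dots> = (\<integral>\<^sup>+t. H (\<lambda>i\<in>I. t (i, b)) \<partial>iid_normal ?Q1)"
    proof (rule nn_integral_cong)
      fix t assume "t \<in> space (iid_normal ?Q1)"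
      have "(\<integral>\<^sup>+w. f (R (merge ?Q1 ?Q2 (t, w))) \<partial>iid_normal ?Q2) =
        (\<integral>\<^sup>+w. indicator {w. dependent_in I J (B (\<lambda>i\<in>I. t (i, b))) w} w \<partial>iid_normal ?Q2)"
      proof (rule nn_integral_cong)
        fix w
        have 1: "B (\<lambda>i. merge ?Q1 ?Q2 (t, w) (i, b)) = B (\<lambda>i\<in>I. t (i, b))"
          using I(3) unfolding B_def by (intro Collect_cong arg_cong2[where f = "(\<in>)"] refl arg_cong2[where f = "\<lambda>x y. x(a := y)"] sum.cong)
            (auto simp: merge_def)
        have "(\<Sum>i\<in>I. v i * merge ?Q1 ?Q2 (t, w) (i, j)) = (\<Sum>i\<in>I. v i * w (i, j))" if "j \<in> J" for v j
          using that I(3) by (intro sum.cong) (auto simp: merge_def)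
        then show "f (R (merge ?Q1 ?Q2 (t, w))) = indicator {w. dependent_in I J (B (\<lambda>i\<in>I. t (i, b))) w} w"
          unfolding fR_eq indicator_def by (simp add: 1 dependent_in_def)
      qed
      also have "\<dots> = (\<integral>\<^sup>+z. indicator (B (\<lambda>i\<in>I. t (i, b))) z \<partial>iid_normal I)"
        by (rule IH[OF B])
      also have "\<dots> = H (\<lambda>i\<in>I. t (i, b))"
        by (simp add: H_def F_def B_def indicator_def)
      finally show "(\<integral>\<^sup>+w. f (R (merge ?Q1 ?Q2 (t, w))) \<partial>iid_normal ?Q2) = H (\<lambda>i\<in>I. t (i, b))" .
    qed
    also have "\<dots> = (\<integral>\<^sup>+t. H t \<partial>iid_normal I)"
      by (rule nn_integral_iid_normal_reindex[OF _ _ Hm]) (auto simp: inj_on_def)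
    also have "\<dots> = (\<integral>\<^sup>+z. \<integral>\<^sup>+t. F z (\<Sum>i\<in>I. z i * (- t i / r)) \<partial>iid_normal I \<partial>iid_normal I)"
    proof -
      interpret NN: pair_sigma_finite "iid_normal I" "iid_normal I" ..
      show ?thesis unfolding H_def by (rule NN.Fubini') measurable
    qed
    also have "\<dots> = (\<integral>\<^sup>+z. \<integral>\<^sup>+t. F z (norm_on I z * t / norm_on I c) \<partial>std_normal \<partial>iid_normal I)"
    proof (rule nn_integral_cong)
      fix z assume "z \<in> space (iid_normal I)"
      then have [measurable]: "z \<in> space (borel_Pi I)" by (simp add: space_iid_normal space_PiM)
      \<comment> \<open>\<open>r\<close> is the norm of \<open>c\<close> up to sign; the sign
        \<open>s\<close>, combined with the minus from solving for the coefficient, is removed by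
        reflection.\<close>
      define s where "s = - norm_on I c / r"
      have s: "s\<^sup>2 = 1" using r unfolding s_def rc[symmetric] by (simp add: power_divide)
      have rs: "- x / r = s * x / norm_on I c" for x
        using c by (simp add: s_def)
      have "(\<integral>\<^sup>+t. F z (\<Sum>i\<in>I. z i * (- t i / r)) \<partial>iid_normal I) =
        (\<integral>\<^sup>+t. F z (- (\<Sum>i\<in>I. z i * t i) / r) \<partial>iid_normal I)"
        by (simp add: sum_divide_distrib sum_negf)
      also have "\<dots> = (\<integral>\<^sup>+t. F z (- (norm_on I z * t) / r) \<partial>std_normal)"
        by (rule nn_integral_iid_normal_linear[OF I(1) In, of "\<lambda>x. F z (- x / r)"]) measurable
      also have "\<dots> = (\<integral>\<^sup>+t. F z (norm_on I z * (s * t) / norm_on I c) \<partial>std_normal)"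
        unfolding rs by (simp add: mult_ac)
      also have "\<dots> = (\<integral>\<^sup>+t. F z (norm_on I z * t / norm_on I c) \<partial>std_normal)"
        by (rule nn_integral_std_normal_reflect[OF _ s]) measurable
      finally show "(\<integral>\<^sup>+t. F z (\<Sum>i\<in>I. z i * (- t i / r)) \<partial>iid_normal I) =
        (\<integral>\<^sup>+t. F z (norm_on I z * t / norm_on I c) \<partial>std_normal)" .
    qed
    finally show ?thesis by (simp add: f_def)
  qed
  define G where "G c = (\<integral>\<^sup>+w. indicator ?W (merge ?P ?Q (E c, w)) \<partial>iid_normal ?Q :: ennreal)" for c
  have Gm: "G \<in> borel_measurable (borel_Pi I)"
  proof -
    have "E \<in> borel_Pi I \<rightarrow>\<^sub>M borel_Pi ?P"
      unfolding E_def[abs_def] by (intro measurable_restrict measurable_component_singleton) auto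
    note [measurable] = this WM
    have "(\<lambda>(c, w). indicator ?W (merge ?P ?Q (E c, w)) :: ennreal) \<in> borel_measurable (borel_Pi I \<Otimes>\<^sub>M borel_Pi ?Q)"
      unfolding split_beta' by (rule measurable_compose[OF _ WM]) measurable
    then show ?thesis unfolding G_def[abs_def] by measurable
  qed
  have "(\<integral>\<^sup>+w. indicator ?W w \<partial>iid_normal (insert a I \<times> I)) =
    (\<integral>\<^sup>+g. \<integral>\<^sup>+w. indicator ?W (merge ?P ?Q (g, w)) \<partial>iid_normal ?Q \<partial>iid_normal ?P)"
    unfolding fin(4) by (rule nn_integral_iid_normal_Un[OF fin(3,1,2) WM])
  also have "\<dots> = (\<integral>\<^sup>+g. G (\<lambda>i\<in>I. g (a, i)) \<partial>iid_normal ?P)"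
  proof (rule nn_integral_cong)
    fix g assume g: "g \<in> space (iid_normal ?P)"
    have "E (\<lambda>i\<in>I. g (a, i)) = g"
      using g by (auto simp: E_def fun_eq_iff space_iid_normal PiE_iff extensional_def)
    then show "(\<integral>\<^sup>+w. indicator ?W (merge ?P ?Q (g, w)) \<partial>iid_normal ?Q) = G (\<lambda>i\<in>I. g (a, i))"
      by (simp add: G_def)
  qed
  also have "\<dots> = (\<integral>\<^sup>+c. G c \<partial>iid_normal I)"
    by (rule nn_integral_iid_normal_reindex[OF _ _ Gm]) (auto simp: inj_on_def)
  also have "\<dots> = (\<integral>\<^sup>+c. \<integral>\<^sup>+z. \<integral>\<^sup>+t. F z (norm_on I z * t / norm_on I c) \<partial>std_normal \<partial>iid_normal I \<partial>iid_normal I)"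
    using AE_iid_normal_norm_on[OF I(1) In]
    by (intro nn_integral_cong_AE) (auto elim!: eventually_mono simp: G_def main)
  also have "\<dots> = (\<integral>\<^sup>+z. \<integral>\<^sup>+t. F z t \<partial>std_normal \<partial>iid_normal I)"
  proof (rule nn_integral_iid_normal_exchange_norm[OF I(1) In F])
    fix s t :: real and w assume "s > 0"
    then show "F (\<lambda>k\<in>I. s * w k) (s * t) = F w t"
      unfolding F_def using a cone_on_scale[OF A, of s "(\<lambda>k\<in>I. s * w k)(a := s * t)" "w(a := t)"]
      by (auto simp: indicator_def)
  qed
  also have "\<dots> = (\<integral>\<^sup>+z. indicator A z \<partial>iid_normal (insert a I))"
    unfolding F_def by (rule nn_integral_iid_normal_insert[OF I(1) a Am, symmetric])
  finally show ?thesis .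
qed

text \<open>For \<open>k + 1\<close> points in dimension \<open>k\<close> this says that the
  direction of a linear dependency is that of a standard Gaussian vector, tested on cones.\<close>

lemma nn_integral_dependent_in:
  assumes "cone_on {..k} A"
  shows "(\<integral>\<^sup>+w. indicator {w. dependent_in {..k} {..<k} A w} w \<partial>iid_normal ({..k} \<times> {..<k})) =
    (\<integral>\<^sup>+z. indicator A z \<partial>iid_normal {..k::nat})"
  using assms
proof (induction k arbitrary: A)
  case 0
  \<comment> \<open>In dimension 0 every coefficient is a dependency of the single point. Invariance
    under nonzero scalars forces \<open>A\<close> to contain all or none of the vectors whose
    coordinate 0 is nonzero, so both sides are 0 or 1.\<close>
  define P where "P \<longleftrightarrow> (\<exists>v\<in>A. v 0 \<noteq> 0)"
  have iff: "z \<in> A \<longleftrightarrow> P" if "z 0 \<noteq> 0" for z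
  proof
    assume P
    then obtain v where v: "v \<in> A" "v 0 \<noteq> 0" by (auto simp: P_def)
    show "z \<in> A"
    proof (subst cone_on_scale[OF 0])
      show "z 0 / v 0 \<noteq> 0" using that v by simp
      show "z i = z 0 / v 0 * v i" if "i \<in> {..0}" for i using that v by simp
    qed fact
  qed (use that in \<open>auto simp: P_def\<close>)
  have "(\<integral>\<^sup>+z. indicator A z \<partial>iid_normal {..0::nat}) = (\<integral>\<^sup>+z. of_bool P \<partial>iid_normal {..0::nat})"
  proof (rule nn_integral_cong_AE)
    show "AE z in iid_normal {..0::nat}. (indicator A z :: ennreal) = of_bool P"
    proof (rule eventually_mono)
      show "AE z in iid_normal {..0::nat}. norm_on {..0} z > 0"
        by (rule AE_iid_normal_norm_on) auto
      show "(indicator A z :: ennreal) = of_bool P" if "norm_on {..0} z > 0" for z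
        using that iff[of z] by (simp add: norm_on_def indicator_def)
    qed
  qed
  moreover have "dependent_in {..0} {..<0} A w \<longleftrightarrow> P" for w :: "nat \<times> nat \<Rightarrow> real"
    by (simp add: dependent_in_def P_def)
  then have "(\<integral>\<^sup>+w. indicator {w. dependent_in {..0} {..<0} A w} w \<partial>iid_normal ({..0} \<times> {..<0::nat})) =
      (\<integral>\<^sup>+w. of_bool P \<partial>iid_normal ({..0::nat} \<times> {..<0::nat}))"
    by (simp only: indicator_def mem_Collect_eq of_bool_def)
  ultimately show ?case
    by (simp add: iid_normal.emeasure_space_1)
next
  case (Suc k)
  have I: "{..Suc k} = insert (Suc k) {..k}" "{..<Suc k} = {..k}" "{..k} = insert k {..<k}"
    by auto
  show ?case
    unfolding I(1,2)
    by (rule nn_integral_dependent_in_step[OF _ I(3)]) (use Suc I in auto)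
qed

lemma rotation_cong:
  assumes T: "rotation I T T'" and I: "finite I" and uv: "\<And>i. i \<in> I \<Longrightarrow> u i = v i" and i: "i \<in> I"
  shows "T u i = T v i"
proof -
  have add: "\<And>u v. T (\<lambda>i. u i + v i) = (\<lambda>i. T u i + T v i)" and scale: "\<And>c u. T (\<lambda>i. c * u i) = (\<lambda>i. c * T u i)"
    using T unfolding rotation_def by blast+
  have "T (\<lambda>i. u i + (- 1) * v i) i = T u i - T v i"
    unfolding add scale by simp
  moreover have "\<forall>i\<in>I. T (\<lambda>i. u i + (- 1) * v i) i = 0"
    unfolding rotation_eq_0_iff[OF T I] using uv by simp
  ultimately show ?thesis using i by simp
qed

lemma cone_on_sum_zero:
  assumes "cone_on I A"
  shows "cone_on I {v \<in> A. (\<Sum>i\<in>I. v i) = 0}"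
  unfolding cone_on_def
proof (intro conjI ballI allI impI)
  have "closed {v::'a \<Rightarrow> real. (\<Sum>i\<in>I. v i) = 0}"
    by (intro closed_Collect_eq continuous_on_sum continuous_on_const) simp
  then have "closed (A \<inter> {v. (\<Sum>i\<in>I. v i) = 0})" using assms by (simp add: closed_Int cone_on_def)
  then show "closed {v \<in> A. (\<Sum>i\<in>I. v i) = 0}" by (simp add: Collect_conj_eq)
next
  fix v and c :: real assume "v \<in> {v \<in> A. (\<Sum>i\<in>I. v i) = 0}" "c \<noteq> 0"
  then show "(\<lambda>i. c * v i) \<in> {v \<in> A. (\<Sum>i\<in>I. v i) = 0}"
    using cone_on_scale[OF assms, of c "\<lambda>i. c * v i" v] by (simp add: sum_distrib_left[symmetric])
next
  fix v w assume "\<forall>i\<in>I. v i = w i" "v \<in> {v \<in> A. (\<Sum>i\<in>I. v i) = 0}"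
  then show "w \<in> {v \<in> A. (\<Sum>i\<in>I. v i) = 0}"
    using cone_on_cong[OF assms, of v w] by simp
qed

text \<open>The rotation \<open>T\<close> sends the all-ones vector to \<open>r\<close> times the
  axis \<open>a\<close>, so the condition that the coefficients sum to zero becomes the vanishing of
  coordinate \<open>a\<close>. Index \<open>a\<close> then drops out, and linear dependencies of
  \<open>d + 1\<close> points in dimension \<open>d\<close> remain. Rotating back, deleting
  coordinate \<open>a\<close> amounts to subtracting the mean.\<close>

lemma nn_integral_affinely_dependent_in:
  fixes d :: nat
  defines "I \<equiv> {..Suc d}"
  assumes A: "cone_on I A"
  shows "(\<integral>\<^sup>+w. indicator {w. dependent_in I {..<d} {v\<in>A. (\<Sum>i\<in>I. v i) = 0} w} w \<partial>iid_normal (I \<times> {..<d})) =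
    (\<integral>\<^sup>+z. indicator A (\<lambda>i. z i - (\<Sum>l\<in>I. z l) / (real d + 2)) \<partial>iid_normal I)"
proof -
  define L J a where "L = {..d}" and "J = {..<d}" and "a = Suc d"
  have IL: "I = insert a L" "a \<notin> L" "finite L" "finite I" "finite J" "a \<in> I" "L \<subseteq> I"
    by (auto simp: I_def L_def a_def J_def)
  define C where "C = {v\<in>A. (\<Sum>i\<in>I. v i) = 0}"
  obtain T T' r where T: "rotation I T T'" and T1: "\<forall>i\<in>I. T (\<lambda>_. 1) i = (if i = a then r else 0)"
    and r2: "r\<^sup>2 = (\<Sum>i\<in>I. 1\<^sup>2)"
    using ex_rotation_to_axis[of I a "\<lambda>_. 1"] IL by auto
  have r2: "r\<^sup>2 = real d + 2" using r2 by (simp add: I_def)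
  then have r: "r \<noteq> 0" by auto
  have T': "rotation I T' T" by (rule rotation_inverse[OF T])
  have inv: "T' (T u) = u" "T (T' u) = u" for u using T by (auto simp: rotation_def)
  have prod: "(\<Sum>i\<in>I. T u i * T v i) = (\<Sum>i\<in>I. u i * v i)" for u v
    using T unfolding rotation_def by blast
  \<comment> \<open>The sum is the inner product with the all-ones vector, computed after
    rotation.\<close>
  have axis: "(\<Sum>i\<in>I. u i) = T u a * r" for u
  proof -
    have "(\<Sum>i\<in>I. u i) = (\<Sum>i\<in>I. T u i * T (\<lambda>_. 1) i)" by (simp add: prod)
    also have "\<dots> = T u a * r" using IL T1 by (simp add: sum.neutral)
    finally show ?thesis .
  qed
  \<comment> \<open>The cone on the reduced index set: a vector is extended by 0 at \<open>a\<close>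
    and rotated back into the hyperplane of sum zero.\<close>
  define A' where "A' = {u. T' (u(a := 0)) \<in> A}"
  have T'c: "continuous_on UNIV T'"
    using T by (intro continuous_on_coordinatewise_then_product) (simp add: rotation_def)
  have A': "cone_on L A'"
    unfolding cone_on_def
  proof (intro conjI ballI allI impI)
    have "continuous_on UNIV (\<lambda>u::nat \<Rightarrow> real. u(a := 0))"
    proof (rule continuous_on_coordinatewise_then_product)
      show "continuous_on UNIV (\<lambda>u::nat \<Rightarrow> real. (u(a := 0)) l)" for l
        by (cases "l = a") (auto intro!: continuous_on_const)
    qed
    then have "continuous_on UNIV (\<lambda>u. T' (u(a := 0)))"
      by (rule continuous_on_compose2[OF T'c]) simp
    then have "closed ((\<lambda>u. T' (u(a := 0))) -` A)"
      using A by (intro closed_vimage) (auto simp: cone_on_def)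
    then show "closed A'" by (simp add: A'_def vimage_def)
  next
    fix v and c :: real assume v: "v \<in> A'" and c: "c \<noteq> 0"
    have "T' ((\<lambda>i. c * v i)(a := 0)) = T' (\<lambda>i. c * (v(a := 0)) i)"
      by (intro arg_cong[where f = T']) auto
    also have "\<dots> = (\<lambda>i. c * T' (v(a := 0)) i)" using T' unfolding rotation_def by blast
    finally have "T' ((\<lambda>i. c * v i)(a := 0)) \<in> A \<longleftrightarrow> T' (v(a := 0)) \<in> A"
      by (intro cone_on_scale[OF A c]) simp
    then show "(\<lambda>i. c * v i) \<in> A'"
      using v by (simp add: A'_def)
  next
    fix v w assume "\<forall>i\<in>L. v i = w i" and v: "v \<in> A'"
    then have "T' (v(a := 0)) i = T' (w(a := 0)) i" if "i \<in> I" for i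
      using that IL by (intro rotation_cong[OF T']) auto
    then show "w \<in> A'" using v cone_on_cong[OF A, of "T' (v(a := 0))" "T' (w(a := 0))"] by (simp add: A'_def)
  qed
  have Cc: "cone_on I C"
    unfolding C_def by (rule cone_on_sum_zero[OF A])
  let ?f = "\<lambda>w. indicator {w. dependent_in I J C w} w :: ennreal"
  have fm: "?f \<in> borel_measurable (borel_Pi (I \<times> J))"
    by (intro measurable_indicator_closed closed_dependent_in Cc IL)
  let ?R = "\<lambda>w. \<lambda>k\<in>I \<times> J. T' (\<lambda>i\<in>I. w (i, snd k)) (fst k)"
  have dep: "dependent_in I J C (?R w) \<longleftrightarrow> dependent_in L J A' w" for w
  proof -
    have R: "(\<Sum>i\<in>I. u i * ?R w (i, j)) = (\<Sum>i\<in>I. T u i * w (i, j))" if "j \<in> J" for u j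
    proof -
      have "(\<Sum>i\<in>I. u i * ?R w (i, j)) = (\<Sum>i\<in>I. u i * T' (\<lambda>i\<in>I. w (i, j)) i)"
        using that by (intro sum.cong) auto
      also have "\<dots> = (\<Sum>i\<in>I. T u i * (\<lambda>i\<in>I. w (i, j)) i)"
        by (rule rotation_adjoint[OF T])
      finally show ?thesis by simp
    qed
    have sumI: "(\<Sum>i\<in>I. (v(a := 0)) i * g i) = (\<Sum>i\<in>L. v i * g i)" for v g :: "nat \<Rightarrow> real"
      unfolding IL(1) using IL by (simp add: sum.insert) (intro sum.cong; auto)
    show ?thesis
    proof
      assume "dependent_in I J C (?R w)"
      then obtain v where v: "v \<in> A" "(\<Sum>i\<in>I. v i) = 0" "\<exists>i\<in>I. v i \<noteq> 0" "\<forall>j\<in>J. (\<Sum>i\<in>I. v i * ?R w (i, j)) = 0"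
        unfolding dependent_in_def C_def by blast
      have a0: "T v a = 0" using axis[of v] v(2) r by simp
      then have upd: "(T v)(a := 0) = T v" by (simp add: fun_upd_idem)
      have "T v \<in> A'" using v(1) by (simp add: A'_def upd inv)
      moreover have "\<exists>i\<in>L. T v i \<noteq> 0"
        using rotation_eq_0_iff[OF T IL(4), of v] v(3) a0 IL(1) by auto
      moreover have "\<forall>j\<in>J. (\<Sum>i\<in>L. T v i * w (i, j)) = 0"
        using v(4) R sumI[of "T v"] by (simp add: upd)
      ultimately show "dependent_in L J A' w" unfolding dependent_in_def by blast
    next
      assume "dependent_in L J A' w"
      then obtain v where v: "v \<in> A'" "\<exists>i\<in>L. v i \<noteq> 0" "\<forall>j\<in>J. (\<Sum>i\<in>L. v i * w (i, j)) = 0"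
        unfolding dependent_in_def by blast
      define u where "u = T' (v(a := 0))"
      have Tu: "T u = v(a := 0)" by (simp add: u_def inv)
      have "u \<in> C" using v(1) axis[of u] by (simp add: C_def A'_def u_def[symmetric] Tu)
      moreover have "\<exists>i\<in>I. u i \<noteq> 0"
      proof -
        obtain i where "i \<in> L" "v i \<noteq> 0" using v(2) by blast
        then have "i \<in> I" "T u i \<noteq> 0" using IL by (auto simp: Tu)
        then show ?thesis using rotation_eq_0_iff[OF T IL(4), of u] by blast
      qed
      moreover have "\<forall>j\<in>J. (\<Sum>i\<in>I. u i * ?R w (i, j)) = 0"
        using v(3) R[of _ u] sumI[of v] by (simp add: Tu)
      ultimately show "dependent_in I J C (?R w)" unfolding dependent_in_def by blast
    qed
  qed
  have "(\<integral>\<^sup>+w. ?f w \<partial>iid_normal (I \<times> J)) = (\<integral>\<^sup>+w. ?f (?R w) \<partial>iid_normal (I \<times> J))"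
    by (rule rotation_iid_normal_fst[OF IL(4,5) T' fm])
  also have "\<dots> = (\<integral>\<^sup>+w. indicator {w. dependent_in L J A' w} (\<lambda>k\<in>L \<times> J. w (id k)) \<partial>iid_normal (I \<times> J))"
  proof (rule nn_integral_cong)
    fix w
    have "dependent_in L J A' (\<lambda>k\<in>L \<times> J. w (id k)) \<longleftrightarrow> dependent_in L J A' w"
      by (simp add: dependent_in_def)
    then show "?f (?R w) = indicator {w. dependent_in L J A' w} (\<lambda>k\<in>L \<times> J. w (id k))"
      by (simp only: indicator_def mem_Collect_eq dep)
  qed
  also have "\<dots> = (\<integral>\<^sup>+w. indicator {w. dependent_in L J A' w} w \<partial>iid_normal (L \<times> J))"
    using IL by (intro nn_integral_iid_normal_reindex measurable_indicator_closed closed_dependent_in A') auto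
  also have "\<dots> = (\<integral>\<^sup>+z. indicator A' z \<partial>iid_normal L)"
    using nn_integral_dependent_in[of d A'] A' by (simp add: L_def J_def)
  also have "\<dots> = (\<integral>\<^sup>+z. indicator A' (\<lambda>i\<in>L. z (id i)) \<partial>iid_normal I)"
    using IL A' by (intro nn_integral_iid_normal_reindex[symmetric] measurable_indicator_closed) (auto simp: cone_on_def)
  also have "\<dots> = (\<integral>\<^sup>+z. indicator A' z \<partial>iid_normal I)"
  proof (rule nn_integral_cong)
    show "indicator A' (\<lambda>i\<in>L. z (id i)) = (indicator A' z :: ennreal)" for z
      using cone_on_cong[OF A', of "\<lambda>i\<in>L. z (id i)" z] by (simp only: indicator_def) simp
  qed
  also have "\<dots> = (\<integral>\<^sup>+z. indicator A' z \<partial>distr (iid_normal I) (iid_normal I) T)"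
    using T by (simp add: rotation_def)
  also have "\<dots> = (\<integral>\<^sup>+z. indicator A' (T z) \<partial>iid_normal I)"
  proof (rule nn_integral_distr)
    show "T \<in> iid_normal I \<rightarrow>\<^sub>M iid_normal I" using T by (simp add: rotation_def)
    have "(\<lambda>z. indicator A' z :: ennreal) \<in> borel_measurable (iid_normal I)"
      unfolding measurable_iid_normal1 using A' by (intro measurable_indicator_closed) (simp add: cone_on_def)
    then show "(\<lambda>z. indicator A' z :: ennreal) \<in> borel_measurable (distr (iid_normal I) (iid_normal I) T)"
      by simp
  qed
  also have "\<dots> = (\<integral>\<^sup>+z. indicator A (\<lambda>i. z i - (\<Sum>l\<in>I. z l) / (real d + 2)) \<partial>iid_normal I)"
  proof (rule nn_integral_cong)
    fix z
    define q where "q = (\<Sum>l\<in>I. z l) / (real d + 2)"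
    \<comment> \<open>Coordinate \<open>a\<close> of \<open>T z\<close> equals \<open>q r\<close>,
      that of \<open>q\<close> times the rotated all-ones vector, so clearing it means subtracting
      \<open>q\<close> from every coordinate of \<open>z\<close>.\<close>
    have "T' ((T z)(a := 0)) i = z i - q" if i: "i \<in> I" for i
    proof -
      have q: "q = T z a / r" using axis[of z] r by (simp add: q_def r2[symmetric] power2_eq_square)
      have add: "T (\<lambda>i. z i + (- q) * 1) = (\<lambda>i. T z i + (- q) * T (\<lambda>_. 1) i)"
      proof -
        have "\<And>u v. T (\<lambda>i. u i + v i) = (\<lambda>i. T u i + T v i)" "\<And>c u. T (\<lambda>i. c * u i) = (\<lambda>i. c * T u i)"
          using T unfolding rotation_def by blast+
        then show ?thesis by presburger
      qed
      have "T' ((T z)(a := 0)) i = T' (T (\<lambda>i. z i + (- q) * 1)) i"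
        unfolding add using T1 q r by (intro rotation_cong[OF T' IL(4) _ i]) auto
      then show ?thesis by (simp add: inv)
    qed
    then have "T z \<in> A' \<longleftrightarrow> (\<lambda>i. z i - q) \<in> A"
      unfolding A'_def mem_Collect_eq by (rule cone_on_cong[OF A])
    then show "indicator A' (T z) = (indicator A (\<lambda>i. z i - (\<Sum>l\<in>I. z l) / (real d + 2)) :: ennreal)"
      by (simp add: indicator_def q_def)
  qed
  finally show ?thesis by (simp add: C_def J_def)
qed

section \<open>Radon partitions\<close>

lemma sum_scaleR_fun_apply:
  fixes p :: "'i \<Rightarrow> 'j \<Rightarrow> real"
  shows "(\<Sum>i\<in>A. u i *\<^sub>R p i) j = (\<Sum>i\<in>A. u i * p i j)"
  by (induction A rule: infinite_finite_induct) (simp_all add: scaleR_fun_def)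

text \<open>Weights belong to indices instead of points, so the description also holds if some of
  the points coincide.\<close>

lemma convex_hull_finite_image:
  fixes p :: "'i \<Rightarrow> 'a::real_vector"
  assumes A: "finite A"
  shows "convex hull (p ` A) = {(\<Sum>i\<in>A. u i *\<^sub>R p i) |u. (\<forall>i\<in>A. u i \<ge> 0) \<and> (\<Sum>i\<in>A. u i) = 1}" (is "_ = ?R")
proof (intro antisym hull_minimal subsetI)
  fix x assume "x \<in> ?R"
  then obtain u where u: "x = (\<Sum>i\<in>A. u i *\<^sub>R p i)" "\<forall>i\<in>A. u i \<ge> 0" "(\<Sum>i\<in>A. u i) = 1" by blast
  show "x \<in> convex hull (p ` A)"
    unfolding u(1) using u A by (intro convex_sum) (auto intro: hull_inc)
next
  fix x assume "x \<in> p ` A"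
  then obtain a where a: "a \<in> A" "x = p a" by auto
  have "x = (\<Sum>i\<in>A. (if i = a then 1 else 0) *\<^sub>R p i)"
    using A a by (subst sum.remove[of A a]) (auto intro!: sum.neutral)
  then show "x \<in> ?R" using A a by (intro CollectI exI[of _ "\<lambda>i. if i = a then 1 else 0"]) auto
next
  show "convex ?R"
  proof (rule convexI)
    fix x y and s t :: real assume "x \<in> ?R" "y \<in> ?R" and st: "0 \<le> s" "0 \<le> t" "s + t = 1"
    then obtain u v where u: "x = (\<Sum>i\<in>A. u i *\<^sub>R p i)" "\<forall>i\<in>A. u i \<ge> 0" "(\<Sum>i\<in>A. u i) = 1"
      and v: "y = (\<Sum>i\<in>A. v i *\<^sub>R p i)" "\<forall>i\<in>A. v i \<ge> 0" "(\<Sum>i\<in>A. v i) = 1" by blast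
    have "s *\<^sub>R x + t *\<^sub>R y = (\<Sum>i\<in>A. (s * u i + t * v i) *\<^sub>R p i)"
      by (simp add: u(1) v(1) scaleR_sum_right sum.distrib scaleR_add_left)
    moreover have "(\<Sum>i\<in>A. s * u i + t * v i) = 1"
      using u v st by (simp add: sum.distrib sum_distrib_left[symmetric])
    ultimately show "s *\<^sub>R x + t *\<^sub>R y \<in> ?R"
      using u v st by (intro CollectI exI[of _ "\<lambda>i. s * u i + t * v i"]) auto
  qed
qed

text \<open>Weak inequalities make the set closed, and adding the opposite pattern makes it
  invariant under negative scalars. The price is that cones of different partitions overlap, but
  only in vectors with a zero coordinate.\<close>

definition sign_cone :: "'i set \<Rightarrow> 'i set \<Rightarrow> ('i \<Rightarrow> real) set" where
  "sign_cone A B = {v. (\<forall>i\<in>A. v i \<ge> 0) \<and> (\<forall>i\<in>B. v i \<le> 0)} \<union> {v. (\<forall>i\<in>A. v i \<le> 0) \<and> (\<forall>i\<in>B. v i \<ge> 0)}"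

lemma cone_on_sign_cone:
  assumes "A \<union> B = I"
  shows "cone_on I (sign_cone A B)"
proof -
  have cl: "closed {v :: 'a \<Rightarrow> real. (\<forall>i\<in>A. v i \<ge> 0) \<and> (\<forall>i\<in>B. v i \<le> 0)}" for A B :: "'a set"
  proof -
    have "{v :: 'a \<Rightarrow> real. (\<forall>i\<in>A. v i \<ge> 0) \<and> (\<forall>i\<in>B. v i \<le> 0)} =
      (\<Inter>i\<in>A. {v. 0 \<le> v i}) \<inter> (\<Inter>i\<in>B. {v. v i \<le> 0})" by auto
    also have "closed \<dots>"
      by (intro closed_Int closed_INT ballI closed_Collect_le continuous_on_const) simp_all
    finally show ?thesis .
  qed
  have "closed (sign_cone A B)"
    unfolding sign_cone_def using cl[of A B] cl[of B A] by (intro closed_Un) (simp_all add: conj_commute)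
  moreover have "(\<lambda>i. c * v i) \<in> sign_cone A B" if "v \<in> sign_cone A B" "c \<noteq> 0" for v c
    using that by (cases "c > 0") (auto simp: sign_cone_def zero_le_mult_iff mult_le_0_iff)
  moreover have "w \<in> sign_cone A B" if "\<forall>i\<in>I. v i = w i" "v \<in> sign_cone A B" for v w
    using that assms by (auto simp: sign_cone_def)
  ultimately show ?thesis unfolding cone_on_def by blast
qed

lemma cone_on_Un: "cone_on I A \<Longrightarrow> cone_on I B \<Longrightarrow> cone_on I (A \<union> B)"
  unfolding cone_on_def by (auto intro: closed_Un)

text \<open>Division by the sum \<open>s\<close> over \<open>A\<close> normalises the weights and
  also selects the right one of the two opposite sign patterns. If \<open>s\<close> were 0, the sums
  over both sides would vanish, and as each side has constant sign all entries would be 0.\<close>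

lemma sign_cone_sum_pos:
  assumes v: "v \<in> sign_cone A B" "(\<Sum>i\<in>A \<union> B. v i) = 0" "\<exists>i\<in>A \<union> B. v i \<noteq> 0"
    and AB: "finite A" "finite B" "A \<inter> B = {}"
  obtains u where "\<forall>i\<in>A. u i \<ge> 0" "\<forall>i\<in>B. u i \<le> 0" "(\<Sum>i\<in>A. u i) = 1" "(\<Sum>i\<in>B. u i) = - 1"
    "\<exists>c. \<forall>i. u i = c * v i"
proof -
  have split: "(\<Sum>i\<in>A. v i) + (\<Sum>i\<in>B. v i) = 0"
    using v(2) AB by (simp add: sum.union_disjoint)
  define s where "s = (\<Sum>i\<in>A. v i)"
  have sB: "(\<Sum>i\<in>B. v i) = - s" using split by (simp add: s_def)
  have "s \<noteq> 0"
  proof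
    assume "s = 0"
    then have z: "(\<Sum>i\<in>A. v i) = 0" "(\<Sum>i\<in>B. v i) = 0" using sB by (simp_all add: s_def)
    from v(1) have "(\<forall>i\<in>A. v i = 0) \<and> (\<forall>i\<in>B. v i = 0)"
      unfolding sign_cone_def
    proof
      assume "v \<in> {v. (\<forall>i\<in>A. v i \<ge> 0) \<and> (\<forall>i\<in>B. v i \<le> 0)}"
      then show ?thesis using z AB sum_nonneg_eq_0_iff[of A v] sum_nonneg_eq_0_iff[of B "\<lambda>i. - v i"] by (auto simp: sum_negf)
    next
      assume "v \<in> {v. (\<forall>i\<in>A. v i \<le> 0) \<and> (\<forall>i\<in>B. v i \<ge> 0)}"
      then show ?thesis using z AB sum_nonneg_eq_0_iff[of B v] sum_nonneg_eq_0_iff[of A "\<lambda>i. - v i"] by (auto simp: sum_negf)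
    qed
    with v(3) show False by auto
  qed
  have sgn: "(\<forall>i\<in>A. v i / s \<ge> 0) \<and> (\<forall>i\<in>B. v i / s \<le> 0)"
    using v(1) unfolding sign_cone_def
  proof
    assume *: "v \<in> {v. (\<forall>i\<in>A. v i \<ge> 0) \<and> (\<forall>i\<in>B. v i \<le> 0)}"
    then have "s > 0" using sum_nonneg[of A v] \<open>s \<noteq> 0\<close> unfolding s_def by force
    with * show ?thesis by (auto simp: divide_le_0_iff)
  next
    assume *: "v \<in> {v. (\<forall>i\<in>A. v i \<le> 0) \<and> (\<forall>i\<in>B. v i \<ge> 0)}"
    then have "s < 0" using sum_nonpos[of A v] \<open>s \<noteq> 0\<close> unfolding s_def by force
    with * show ?thesis by (auto simp: divide_le_0_iff zero_le_divide_iff)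
  qed
  show ?thesis
  proof (rule that[of "\<lambda>i. v i / s"])
    show "(\<Sum>i\<in>A. v i / s) = 1" "(\<Sum>i\<in>B. v i / s) = - 1"
      using \<open>s \<noteq> 0\<close> sB by (simp_all add: sum_divide_distrib[symmetric] s_def)
    show "\<exists>c. \<forall>i. v i / s = c * v i" by (intro exI[of _ "1 / s"]) simp
  qed (use sgn in auto)
qed

text \<open>A common point of the two hulls is an affine dependency with its positive terms on one
  side and its negative terms on the other.\<close>

lemma radon_partition_iff_dependent_in:
  fixes p :: "'i \<Rightarrow> 'j \<Rightarrow> real"
  assumes I: "finite I" "A \<union> B = I" "A \<inter> B = {}"
    and p: "\<And>i. i \<in> I \<Longrightarrow> p i \<in> extensional J"
  shows "radon_partition I p A B \<longleftrightarrow>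
    dependent_in I J {v \<in> sign_cone A B. (\<Sum>i\<in>I. v i) = 0} (\<lambda>k\<in>I \<times> J. p (fst k) (snd k))"
    (is "_ \<longleftrightarrow> dependent_in _ _ _ ?w")
proof -
  have fin: "finite A" "finite B" using I by auto
  have sumI: "(\<Sum>i\<in>I. g i) = (\<Sum>i\<in>A. g i) + (\<Sum>i\<in>B. g i)" for g :: "'i \<Rightarrow> real"
    using I(2,3) fin by (auto simp: sum.union_disjoint)
  have wI: "(\<Sum>i\<in>I. v i * ?w (i, j)) = (\<Sum>i\<in>I. v i * p i j)" if "j \<in> J" for v j
    using that by (intro sum.cong) auto
  show ?thesis
  proof
    assume "radon_partition I p A B"
    then obtain u w where u: "\<forall>i\<in>A. u i \<ge> 0" "(\<Sum>i\<in>A. u i) = 1" and w: "\<forall>i\<in>B. w i \<ge> 0" "(\<Sum>i\<in>B. w i) = 1"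
      and eq: "(\<Sum>i\<in>A. u i *\<^sub>R p i) = (\<Sum>i\<in>B. w i *\<^sub>R p i)"
      unfolding radon_partition_def convex_hull_finite_image[OF fin(1)] convex_hull_finite_image[OF fin(2)]
      by (auto simp: set_eq_iff)
    define v where "v i = (if i \<in> A then u i else - w i)" for i
    have vA: "(\<Sum>i\<in>A. v i * g i) = (\<Sum>i\<in>A. u i * g i)" for g
      by (intro sum.cong) (auto simp: v_def)
    have vB: "(\<Sum>i\<in>B. v i * g i) = - (\<Sum>i\<in>B. w i * g i)" for g
      unfolding sum_negf[symmetric] using I(3) by (intro sum.cong) (auto simp: v_def)
    have "v \<in> sign_cone A B"
      using u w I(3) by (auto simp: sign_cone_def v_def)
    moreover have "(\<Sum>i\<in>I. v i) = 0"
      using vA[of "\<lambda>_. 1"] vB[of "\<lambda>_. 1"] u w by (simp add: sumI)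
    moreover have "\<exists>i\<in>I. v i \<noteq> 0"
    proof (rule ccontr)
      assume "\<not> (\<exists>i\<in>I. v i \<noteq> 0)"
      then have "(\<Sum>i\<in>A. v i * 1) = 0" using I(2) by (intro sum.neutral) auto
      then show False using vA[of "\<lambda>_. 1"] u by simp
    qed
    moreover have "(\<Sum>i\<in>I. v i * ?w (i, j)) = 0" if "j \<in> J" for j
      using arg_cong[OF eq, of "\<lambda>f. f j"] unfolding wI[OF that] sumI vA vB sum_scaleR_fun_apply by simp
    ultimately show "dependent_in I J {v \<in> sign_cone A B. (\<Sum>i\<in>I. v i) = 0} ?w"
      unfolding dependent_in_def by blast
  next
    assume "dependent_in I J {v \<in> sign_cone A B. (\<Sum>i\<in>I. v i) = 0} ?w"
    then obtain v where v: "v \<in> sign_cone A B" "(\<Sum>i\<in>A \<union> B. v i) = 0" "\<exists>i\<in>A \<union> B. v i \<noteq> 0"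
      and dep: "\<forall>j\<in>J. (\<Sum>i\<in>I. v i * ?w (i, j)) = 0"
      unfolding dependent_in_def I(2) by blast
    obtain u c where u: "\<forall>i\<in>A. u i \<ge> 0" "\<forall>i\<in>B. u i \<le> 0" "(\<Sum>i\<in>A. u i) = 1" "(\<Sum>i\<in>B. u i) = - 1"
      and uc: "\<forall>i. u i = c * v i"
      using sign_cone_sum_pos[OF v fin I(3)] by metis
    have "(\<Sum>i\<in>A. u i * p i j) = (\<Sum>i\<in>B. (- u i) * p i j)" for j
    proof (cases "j \<in> J")
      case True
      have "(\<Sum>i\<in>I. u i * p i j) = c * (\<Sum>i\<in>I. v i * ?w (i, j))"
        unfolding wI[OF True] by (simp add: sum_distrib_left uc mult.assoc)
      also have "\<dots> = 0" using dep True by simp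
      finally show ?thesis unfolding sumI by (simp add: sum_negf)
    next
      case False
      \<comment> \<open>Off \<open>J\<close> all points have the same value, and the weights sum to
        1 on both sides, so the two combinations agree there without any equation.\<close>
      then have pu: "p i j = undefined" if "i \<in> I" for i using p[OF that] by (auto simp: extensional_def)
      have "(\<Sum>i\<in>A. u i * p i j) = (\<Sum>i\<in>A. u i) * undefined"
        unfolding sum_distrib_right using pu I(2) by (intro sum.cong) auto
      moreover have "(\<Sum>i\<in>B. (- u i) * p i j) = - (\<Sum>i\<in>B. u i) * undefined"
        unfolding sum_distrib_right sum_negf[symmetric] using pu I(2) by (intro sum.cong) auto
      ultimately show ?thesis using u by simp
    qed
    then have "(\<Sum>i\<in>A. u i *\<^sub>R p i) = (\<Sum>i\<in>B. (- u i) *\<^sub>R p i)"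
      unfolding fun_eq_iff sum_scaleR_fun_apply by blast
    moreover have "(\<Sum>i\<in>A. u i *\<^sub>R p i) \<in> convex hull (p ` A)"
      unfolding convex_hull_finite_image[OF fin(1)] using u by blast
    moreover have "(\<Sum>i\<in>B. (- u i) *\<^sub>R p i) \<in> convex hull (p ` B)"
      unfolding convex_hull_finite_image[OF fin(2)] using u
      by (intro CollectI exI[of _ "\<lambda>i. - u i"]) (auto simp: sum_negf)
    ultimately show "radon_partition I p A B"
      unfolding radon_partition_def using I(2,3) by auto
  qed
qed

lemma not_convex_position_iff:
  "\<not> convex_position I p \<longleftrightarrow> (\<exists>i\<in>I. radon_partition I p {i} (I - {i}))"
  by (auto simp: convex_position_def radon_partition_def)

section \<open>The centred Gaussian vector and almost sure properties of Radon partitions\<close>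

definition center :: "nat \<Rightarrow> (nat \<Rightarrow> real) \<Rightarrow> nat \<Rightarrow> real" where
  "center d z = (\<lambda>i. z i - (\<Sum>l<d + 2. z l) / (real d + 2))"

lemma closed_center_vimage:
  assumes "closed A"
  shows "closed {z. center d z \<in> A}"
proof -
  have "continuous_on UNIV (center d)"
  proof (rule continuous_on_coordinatewise_then_product)
    show "continuous_on UNIV (\<lambda>z. center d z i)" for i
      unfolding center_def by (intro continuous_on_diff continuous_on_divide continuous_on_sum continuous_on_const) auto
  qed
  from closed_vimage[OF assms this] show ?thesis by (simp add: vimage_def)
qed

text \<open>Coordinate \<open>i\<close> is a linear form in \<open>z\<close> whose own coefficient
  is 1 - 1 / (d + 2), hence nonzero; so it is a Gaussian variable with positive variance and has no
  atom at 0.\<close>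

lemma AE_center_nonzero:
  "AE z in iid_normal {..<d + 2}. \<forall>i<d + 2. center d z i \<noteq> 0"
proof -
  have "AE z in iid_normal {..<d + 2}. center d z i \<noteq> 0" if i: "i < d + 2" for i
  proof -
    define c where "c l = (if l = i then 1 else 0) - 1 / (real d + 2)" for l
    have lin: "center d z i = (\<Sum>l\<in>{..<d + 2}. c l * z l)" for z
    proof -
      have "(\<Sum>l\<in>{..<d + 2}. c l * z l) = (\<Sum>l\<in>{..<d + 2}. (if l = i then z l else 0) - z l / (real d + 2))"
        by (intro sum.cong) (auto simp: c_def left_diff_distrib)
      also have "\<dots> = z i - (\<Sum>l\<in>{..<d + 2}. z l / (real d + 2))"
        unfolding sum_subtractf using i by (subst sum.delta) (auto simp del: add_2_eq_Suc')
      finally show ?thesis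
        by (simp only: center_def sum_divide_distrib)
    qed
    have "c i \<noteq> 0" by (simp add: c_def)
    then have c: "norm_on {..<d + 2} c \<noteq> 0"
      using i by (subst norm_on_eq_0_iff) auto
    have [measurable]: "indicator {0::real} \<in> borel_measurable (borel :: real measure)"
      "(indicator {0::real} :: _ \<Rightarrow> ennreal) \<in> borel_measurable borel" by simp_all
    have "(\<integral>\<^sup>+z. indicator {0} (center d z i) \<partial>iid_normal {..<d + 2}) =
      (\<integral>\<^sup>+x. indicator {0} (norm_on {..<d + 2} c * x) \<partial>std_normal)"
      unfolding lin by (rule nn_integral_iid_normal_linear) auto
    also have "\<dots> = (\<integral>\<^sup>+x. indicator {0} x \<partial>std_normal)"
      using c by (intro nn_integral_cong) (auto simp: indicator_def)
    also have "\<dots> = (\<integral>\<^sup>+x. ennreal (std_normal_density x) * indicator {0} x \<partial>lborel)"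
      by (rule nn_integral_std_normal) simp
    also have "\<dots> = 0"
      by (subst nn_integral_indicator_singleton) auto
    finally have "(\<integral>\<^sup>+z. indicator {0} (center d z i) \<partial>iid_normal {..<d + 2}) = 0" .
    moreover have m: "(\<lambda>z. indicator {0} (center d z i) :: ennreal) \<in> borel_measurable (iid_normal {..<d + 2})"
      unfolding measurable_iid_normal1 lin by measurable
    ultimately have "AE z in iid_normal {..<d + 2}. (indicator {0} (center d z i) :: ennreal) = 0"
      using nn_integral_0_iff_AE[OF m] by blast
    then show ?thesis by (auto elim!: eventually_mono simp: indicator_def split: if_splits)
  qed
  then have "AE z in iid_normal {..<d + 2}. \<forall>i\<in>{..<d + 2}. center d z i \<noteq> 0"
    by (intro AE_finite_allI) auto
  then show ?thesis by (auto elim!: eventually_mono)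
qed

definition flat :: "nat \<Rightarrow> (nat \<Rightarrow> nat \<Rightarrow> real) \<Rightarrow> nat \<times> nat \<Rightarrow> real" where
  "flat d p = (\<lambda>k\<in>{..<d + 2} \<times> {..<d}. p (fst k) (snd k))"

lemma gaussian_points_eq: "gaussian_points d = Pi\<^sub>M {..<d + 2} (\<lambda>_. iid_normal {..<d})"
  by (simp add: gaussian_points_def std_gaussian_def iid_normal_def)

lemma measurable_flat: "flat d \<in> gaussian_points d \<rightarrow>\<^sub>M iid_normal ({..<d + 2} \<times> {..<d})"
  and distr_flat: "distr (gaussian_points d) (iid_normal ({..<d + 2} \<times> {..<d})) (flat d) = iid_normal ({..<d + 2} \<times> {..<d})"
  using iid_normal_nested[of "{..<d + 2}" "{..<d}" fst snd "{..<d + 2} \<times> {..<d}"]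
  by (simp_all add: gaussian_points_eq flat_def[abs_def] bij_betw_def)

lemma prob_space_gaussian_points: "prob_space (gaussian_points d)"
  unfolding gaussian_points_eq by (intro prob_space_PiM prob_space_iid_normal)

interpretation gaussian_points: prob_space "gaussian_points d" for d
  by (rule prob_space_gaussian_points)

definition dependent_points :: "nat \<Rightarrow> (nat \<Rightarrow> real) set \<Rightarrow> (nat \<Rightarrow> nat \<Rightarrow> real) \<Rightarrow> bool" where
  "dependent_points d A p \<longleftrightarrow>
     dependent_in {..<d + 2} {..<d} {v \<in> A. (\<Sum>i<d + 2. v i) = 0} (flat d p)"

lemma dependent_points_Un: "dependent_points d (A \<union> B) p \<longleftrightarrow> dependent_points d A p \<or> dependent_points d B p"
  unfolding dependent_points_def dependent_in_def by blast

text \<open>The bridge between the two models: pulling the identity for affine dependencies back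
  along \<open>flat\<close> transfers the probability of a cone from the random points to the
  centred vector.\<close>

lemma
  assumes A: "cone_on {..<d + 2} A"
  shows pred_dependent_points: "Measurable.pred (gaussian_points d) (dependent_points d A)"
    and prob_dependent_points: "\<P>(p in gaussian_points d. dependent_points d A p) =
      \<P>(z in iid_normal {..<d + 2}. center d z \<in> A)"
    and pred_center: "Measurable.pred (iid_normal {..<d + 2}) (\<lambda>z. center d z \<in> A)"
proof -
  let ?I = "{..<d + 2}" and ?J = "{..<d}"
  define S where "S = {w. dependent_in ?I ?J {v \<in> A. (\<Sum>i<d + 2. v i) = 0} w}"
  have cl: "closed S" unfolding S_def by (intro closed_dependent_in cone_on_sum_zero A) simp
  have Sp: "Measurable.pred (iid_normal (?I \<times> ?J)) (\<lambda>w. w \<in> S)"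
    using pred_PiM_closed[OF cl, of "?I \<times> ?J"] unfolding measurable_iid_normal1 .
  have Sm: "{w \<in> space (iid_normal (?I \<times> ?J)). w \<in> S} \<in> sets (iid_normal (?I \<times> ?J))"
    using Sp by measurable
  have ev: "dependent_points d A p \<longleftrightarrow> flat d p \<in> S" for p
    by (simp add: dependent_points_def S_def)
  show "Measurable.pred (gaussian_points d) (dependent_points d A)"
    using measurable_compose[OF measurable_flat Sp] by (simp add: ev[abs_def])
  have clA: "closed {z. center d z \<in> A}"
    using A by (intro closed_center_vimage) (simp add: cone_on_def)
  show C: "Measurable.pred (iid_normal ?I) (\<lambda>z. center d z \<in> A)"
    using pred_PiM_closed[OF clA, of ?I] unfolding measurable_iid_normal1 by simp
  have "emeasure (gaussian_points d) {p \<in> space (gaussian_points d). dependent_points d A p} =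
    emeasure (distr (gaussian_points d) (iid_normal (?I \<times> ?J)) (flat d)) {w \<in> space (iid_normal (?I \<times> ?J)). w \<in> S}"
    by (subst emeasure_distr[OF measurable_flat Sm], rule arg_cong[where f = "emeasure _"])
       (use measurable_space[OF measurable_flat[of d]] in \<open>auto simp: ev\<close>)
  also have "\<dots> = emeasure (iid_normal (?I \<times> ?J)) {w \<in> space (iid_normal (?I \<times> ?J)). w \<in> S}"
    by (simp only: distr_flat)
  also have "\<dots> = (\<integral>\<^sup>+w. indicator {w \<in> space (iid_normal (?I \<times> ?J)). w \<in> S} w \<partial>iid_normal (?I \<times> ?J))"
    by (rule nn_integral_indicator[OF Sm, symmetric])
  also have "\<dots> = (\<integral>\<^sup>+w. indicator S w \<partial>iid_normal (?I \<times> ?J))"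
    by (intro nn_integral_cong) (auto simp: indicator_def)
  also have "\<dots> = (\<integral>\<^sup>+z. indicator A (center d z) \<partial>iid_normal ?I)"
    using nn_integral_affinely_dependent_in[of d A] A
    by (simp add: S_def center_def lessThan_Suc_atMost)
  also have "\<dots> = (\<integral>\<^sup>+z. indicator {z \<in> space (iid_normal ?I). center d z \<in> A} z \<partial>iid_normal ?I)"
    by (intro nn_integral_cong) (auto simp: indicator_def)
  also have "\<dots> = emeasure (iid_normal ?I) {z \<in> space (iid_normal ?I). center d z \<in> A}"
    by (rule nn_integral_indicator[OF predE[OF C]])
  finally show "\<P>(p in gaussian_points d. dependent_points d A p) = \<P>(z in iid_normal ?I. center d z \<in> A)"
    by (simp add: measure_def)
qed

text \<open>For the points only the probability of each single cone is known, but this includes the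
  cone \<open>A \<union> B\<close>. In the Gaussian model the events of \<open>A\<close> and
  \<open>B\<close> overlap in a null set, since an overlap requires a zero coordinate; so the
  probability of the union is the sum. The same three numbers occur for the points, and
  inclusion-exclusion leaves probability 0 for the intersection.\<close>

lemma AE_not_both_dependent_points:
  assumes A: "cone_on {..<d + 2} A" and B: "cone_on {..<d + 2} B"
    and zero: "\<And>v. v \<in> A \<Longrightarrow> v \<in> B \<Longrightarrow> \<exists>i<d + 2. v i = 0"
  shows "AE p in gaussian_points d. \<not> (dependent_points d A p \<and> dependent_points d B p)"
proof -
  let ?M = "gaussian_points d" and ?N = "iid_normal {..<d + 2}"
  let ?E = "\<lambda>A. {p \<in> space ?M. dependent_points d A p}" and ?F = "\<lambda>A. {z \<in> space ?N. center d z \<in> A}"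
  have E: "?E C \<in> sets ?M" and F: "?F C \<in> sets ?N" and P: "measure ?M (?E C) = measure ?N (?F C)"
    if "cone_on {..<d + 2} C" for C
    using pred_dependent_points[OF that] pred_center[OF that] prob_dependent_points[OF that] by auto
  have "measure ?N (?F A \<inter> ?F B) = 0"
  proof -
    have "AE z in ?N. z \<notin> ?F A \<inter> ?F B"
      using AE_center_nonzero[of d] by eventually_elim (use zero in blast)
    then have "?F A \<inter> ?F B \<in> null_sets ?N"
      using AE_iff_null_sets[OF sets.Int[OF F[OF A] F[OF B]]] by blast
    then show ?thesis by (rule measure_eq_0_null_sets)
  qed
  then have "measure ?N (?F A \<union> ?F B) = measure ?N (?F A) + measure ?N (?F B)"
    using F[OF A] F[OF B] by (subst measure_Un3) (auto simp: fmeasurable_def less_top[symmetric])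
  moreover have "?F A \<union> ?F B = ?F (A \<union> B)" "?E A \<union> ?E B = ?E (A \<union> B)"
    by (auto simp: dependent_points_Un)
  ultimately have "measure ?M (?E A \<union> ?E B) = measure ?M (?E A) + measure ?M (?E B)"
    using P[OF A] P[OF B] P[OF cone_on_Un[OF A B]] by simp
  then have "measure ?M (?E A \<inter> ?E B) = 0"
    using E[OF A] E[OF B] measure_Un3[of "?E A" ?M "?E B"] by (auto simp: fmeasurable_def less_top[symmetric])
  then have "?E A \<inter> ?E B \<in> null_sets ?M"
    using E[OF A] E[OF B] by (intro null_setsI) (auto simp: gaussian_points.emeasure_eq_measure)
  then have "AE p in ?M. p \<notin> ?E A \<inter> ?E B"
    by (rule AE_not_in)
  then show ?thesis using AE_space by eventually_elim auto
qed

text \<open>If no coordinate vanishes, the signs of \<open>v\<close> determine the partition up to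
  swapping its sides.\<close>

lemma sign_cone_zero:
  assumes "A \<union> B = I" "A \<inter> B = {}" "A' \<union> B' = I" "A' \<inter> B' = {}" "A' \<noteq> A" "A' \<noteq> B"
    and v: "v \<in> sign_cone A B" "v \<in> sign_cone A' B'"
  shows "\<exists>i\<in>I. v i = 0"
proof (rule ccontr)
  assume nz: "\<not> (\<exists>i\<in>I. v i = 0)"
  have *: "(X = {i\<in>I. v i > 0} \<and> Y = {i\<in>I. v i < 0}) \<or> (X = {i\<in>I. v i < 0} \<and> Y = {i\<in>I. v i > 0})"
    if "X \<union> Y = I" "X \<inter> Y = {}" "v \<in> sign_cone X Y" for X Y
    using that(3) unfolding sign_cone_def
  proof
    assume "v \<in> {v. (\<forall>i\<in>X. v i \<ge> 0) \<and> (\<forall>i\<in>Y. v i \<le> 0)}"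
    then have "(\<forall>i\<in>X. v i > 0) \<and> (\<forall>i\<in>Y. v i < 0)"
      using nz that(1) by (force simp: less_le)
    then show ?thesis using that(1) by (intro disjI1) force
  next
    assume "v \<in> {v. (\<forall>i\<in>X. v i \<le> 0) \<and> (\<forall>i\<in>Y. v i \<ge> 0)}"
    then have "(\<forall>i\<in>X. v i < 0) \<and> (\<forall>i\<in>Y. v i > 0)"
      using nz that(1) by (force simp: less_le)
    then show ?thesis using that(1) by (intro disjI2) force
  qed
  show False
    using *[OF assms(1,2) v(1)] *[OF assms(3,4) v(2)] assms(5,6) by auto
qed

declare add_2_eq_Suc' [simp del]

lemma radon_partition_iff_dependent_points:
  assumes p: "p \<in> space (gaussian_points d)" and AB: "A \<union> B = {..<d + 2}" "A \<inter> B = {}"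
  shows "radon_partition {..<d + 2} p A B \<longleftrightarrow> dependent_points d (sign_cone A B) p"
  unfolding dependent_points_def flat_def
proof (rule radon_partition_iff_dependent_in[OF _ AB])
  show "p i \<in> extensional {..<d}" if "i \<in> {..<d + 2}" for i
    using p that by (auto simp: gaussian_points_eq space_PiM space_iid_normal PiE_iff)
qed simp

text \<open>Radon's theorem up to a null set: the cone of all vectors has probability 1 in the
  Gaussian model, so some affine dependency exists almost surely, and its signs give the
  partition.\<close>

lemma AE_ex_radon_partition: "AE p in gaussian_points d. \<exists>A B. radon_partition {..<d + 2} p A B"
proof -
  have U: "cone_on {..<d + 2} UNIV" by (simp add: cone_on_def)
  have "\<P>(p in gaussian_points d. dependent_points d UNIV p) = 1"
    unfolding prob_dependent_points[OF U] by (simp add: iid_normal.prob_space)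
  then have "AE p in gaussian_points d. dependent_points d UNIV p"
    using pred_dependent_points[OF U] by (subst (asm) gaussian_points.prob_Collect_eq_1) auto
  then show ?thesis
    using AE_space
  proof eventually_elim
    case (elim p)
    then obtain v where v: "(\<Sum>i<d + 2. v i) = 0" "\<exists>i\<in>{..<d + 2}. v i \<noteq> 0"
      "\<forall>j\<in>{..<d}. (\<Sum>i\<in>{..<d + 2}. v i * flat d p (i, j)) = 0"
      unfolding dependent_points_def dependent_in_def by blast
    define A B where "A = {i\<in>{..<d + 2}. v i \<ge> 0}" and "B = {i\<in>{..<d + 2}. \<not> v i \<ge> 0}"
    have AB: "A \<union> B = {..<d + 2}" "A \<inter> B = {}" by (auto simp: A_def B_def)
    have "v \<in> sign_cone A B" by (auto simp: sign_cone_def A_def B_def)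
    with v have "dependent_points d (sign_cone A B) p"
      unfolding dependent_points_def dependent_in_def by blast
    then show ?case using radon_partition_iff_dependent_points[OF elim(2) AB] by blast
  qed
qed

definition partitions2 :: "nat \<Rightarrow> (nat set \<times> nat set) set" where
  "partitions2 d = {(A, B). A \<union> B = {..<d + 2} \<and> A \<inter> B = {}}"

lemma finite_partitions2: "finite (partitions2 d)"
  by (rule finite_subset[of _ "Pow {..<d + 2} \<times> Pow {..<d + 2}"]) (auto simp: partitions2_def)

text \<open>There are finitely many pairs of partitions, and for each pair that differs by more than
  a swap the sign cones meet only in vectors with a zero coordinate.\<close>

lemma AE_radon_partition_unique:
  "AE p in gaussian_points d. \<forall>A B A' B'. radon_partition {..<d + 2} p A B \<longrightarrow>
     radon_partition {..<d + 2} p A' B' \<longrightarrow> A' = A \<or> A' = B"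
proof -
  let ?S = "\<lambda>q. sign_cone (fst q) (snd q)"
  have cone: "cone_on {..<d + 2} (?S q)" if "q \<in> partitions2 d" for q
    using that by (intro cone_on_sign_cone) (auto simp: partitions2_def)
  have "AE p in gaussian_points d. fst q' \<noteq> fst q \<longrightarrow> fst q' \<noteq> snd q \<longrightarrow>
    \<not> (dependent_points d (?S q) p \<and> dependent_points d (?S q') p)"
    if q: "q \<in> partitions2 d" "q' \<in> partitions2 d" for q q'
  proof (cases "fst q' \<noteq> fst q \<and> fst q' \<noteq> snd q")
    case True
    have "AE p in gaussian_points d. \<not> (dependent_points d (?S q) p \<and> dependent_points d (?S q') p)"
    proof (rule AE_not_both_dependent_points[OF cone[OF q(1)] cone[OF q(2)]])
      fix v assume "v \<in> ?S q" "v \<in> ?S q'"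
      then have "\<exists>i\<in>{..<d + 2}. v i = 0"
        using q True by (intro sign_cone_zero[of "fst q" "snd q" _ "fst q'" "snd q'"]) (auto simp: partitions2_def)
      then show "\<exists>i<d + 2. v i = 0" by blast
    qed
    then show ?thesis by eventually_elim blast
  next
    case False
    then show ?thesis by (intro AE_I2) blast
  qed
  then have "AE p in gaussian_points d. \<forall>q\<in>partitions2 d. \<forall>q'\<in>partitions2 d. fst q' \<noteq> fst q \<longrightarrow> fst q' \<noteq> snd q \<longrightarrow>
    \<not> (dependent_points d (?S q) p \<and> dependent_points d (?S q') p)"
    by (intro AE_finite_allI finite_partitions2)
  then show ?thesis
    using AE_space
  proof eventually_elim
    case (elim p)
    show ?case
    proof (intro allI impI)
      fix A B A' B' assume R: "radon_partition {..<d + 2} p A B" "radon_partition {..<d + 2} p A' B'"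
      then have q: "(A, B) \<in> partitions2 d" "(A', B') \<in> partitions2 d"
        by (auto simp: partitions2_def radon_partition_def)
      have "dependent_points d (sign_cone A B) p" "dependent_points d (sign_cone A' B') p"
        using R q radon_partition_iff_dependent_points[OF elim(2)] by (auto simp: partitions2_def)
      then show "A' = A \<or> A' = B"
        using elim(1) q by fastforce
    qed
  qed
qed

lemma pred_radon_partition:
  "Measurable.pred (gaussian_points d) (\<lambda>p. radon_partition {..<d + 2} p A B)"
proof (cases "A \<union> B = {..<d + 2} \<and> A \<inter> B = {}")
  case True
  then have "Measurable.pred (gaussian_points d) (dependent_points d (sign_cone A B))"
    by (intro pred_dependent_points cone_on_sign_cone) simp
  then show ?thesis
    using True by (subst measurable_cong[OF radon_partition_iff_dependent_points]) auto
next
  case False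
  then have "\<not> radon_partition {..<d + 2} p A B" for p :: "nat \<Rightarrow> nat \<Rightarrow> real"
    by (auto simp: radon_partition_def)
  then show ?thesis by simp
qed

lemma pred_convex_position: "Measurable.pred (gaussian_points d) (convex_position {..<d + 2})"
proof -
  have "Measurable.pred (gaussian_points d) (\<lambda>p. \<exists>i\<in>{..<d + 2}. radon_partition {..<d + 2} p {i} ({..<d + 2} - {i}))"
    by (intro pred_intros_finite finite_lessThan pred_radon_partition)
  then have "Measurable.pred (gaussian_points d) (\<lambda>p. \<not> \<not> convex_position {..<d + 2} p)"
    unfolding not_convex_position_iff by (rule pred_intros_logic)
  then show ?thesis by simp
qed

text \<open>
  The size is a function of the finite set of all Radon partitions, so it is measurable
  even where \<open>THE\<close> is applied to a predicate without a unique solution.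
\<close>

lemma pred_radon_size: "Measurable.pred (gaussian_points d) (\<lambda>p. P (radon_size d p))"
proof -
  define R where "R p = {(A, B). radon_partition {..<d + 2} p A B}" for p :: "nat \<Rightarrow> nat \<Rightarrow> real"
  define g where "g Q = (THE k. \<exists>A B. (A, B) \<in> Q \<and> k = min (card A) (card B))" for Q :: "(nat set \<times> nat set) set"
  have size: "radon_size d p = g (R p)" for p
    by (simp add: radon_size_def g_def R_def)
  have R: "R p \<subseteq> partitions2 d" for p
    by (auto simp: R_def partitions2_def radon_partition_def)
  have eq: "P (radon_size d p) \<longleftrightarrow> (\<exists>Q\<in>Pow (partitions2 d) \<inter> {Q. P (g Q)}. \<forall>q\<in>partitions2 d.
      radon_partition {..<d + 2} p (fst q) (snd q) \<longleftrightarrow> q \<in> Q)" for p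
  proof
    assume "P (radon_size d p)"
    then show "\<exists>Q\<in>Pow (partitions2 d) \<inter> {Q. P (g Q)}. \<forall>q\<in>partitions2 d.
      radon_partition {..<d + 2} p (fst q) (snd q) \<longleftrightarrow> q \<in> Q"
      using R[of p] by (intro bexI[of _ "R p"]) (auto simp: size R_def)
  next
    assume "\<exists>Q\<in>Pow (partitions2 d) \<inter> {Q. P (g Q)}. \<forall>q\<in>partitions2 d.
      radon_partition {..<d + 2} p (fst q) (snd q) \<longleftrightarrow> q \<in> Q"
    then obtain Q where Q: "Q \<subseteq> partitions2 d" "P (g Q)"
      "\<And>q. q \<in> partitions2 d \<Longrightarrow> radon_partition {..<d + 2} p (fst q) (snd q) \<longleftrightarrow> q \<in> Q" by blast
    have "R p = Q"
    proof (intro set_eqI iffI)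
      fix q assume q: "q \<in> R p"
      then have "q \<in> partitions2 d" using R[of p] by blast
      then show "q \<in> Q" using q Q(3)[of q] by (auto simp: R_def)
    next
      fix q assume "q \<in> Q"
      then show "q \<in> R p" using Q(1) Q(3)[of q] by (auto simp: R_def)
    qed
    then show "P (radon_size d p)" using Q(2) by (simp add: size)
  qed
  show ?thesis
    unfolding eq
    by (intro pred_intros_finite pred_intros_logic finite_Int finite_Pow_iff[THEN iffD2] disjI1 finite_partitions2 pred_radon_partition measurable_const) simp
qed

lemma AE_radon_size_eq_1_iff:
  "AE p in gaussian_points d. radon_size d p = 1 \<longleftrightarrow> \<not> convex_position {..<d + 2} p"
  using AE_ex_radon_partition[of d] AE_radon_partition_unique[of d]
proof eventually_elim
  case (elim p)
  let ?N = "{..<d + 2}"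
  obtain A B where AB: "radon_partition ?N p A B" using elim(1) by blast
  have other: "(A' = A \<and> B' = B) \<or> (A' = B \<and> B' = A)" if "radon_partition ?N p A' B'" for A' B'
  proof -
    have "A' = A \<or> A' = B" using elim(2) AB that by blast
    moreover have "A \<union> B = ?N" "A \<inter> B = {}" "A' \<union> B' = ?N" "A' \<inter> B' = {}"
      using AB that by (auto simp: radon_partition_def)
    ultimately show ?thesis by blast
  qed
  have size: "radon_size d p = min (card A) (card B)"
    unfolding radon_size_def
  proof (rule the_equality)
    show "\<exists>I J. radon_partition ?N p I J \<and> min (card A) (card B) = min (card I) (card J)"
      using AB by blast
    show "k = min (card A) (card B)" if h: "\<exists>I J. radon_partition ?N p I J \<and> k = min (card I) (card J)" for k
    proof -
      obtain I J where IJ: "radon_partition ?N p I J" "k = min (card I) (card J)" using h by blast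
      from other[OF IJ(1)] show ?thesis using IJ(2) by (auto simp: min.commute)
    qed
  qed
  show ?case
  proof
    assume "radon_size d p = 1"
    then consider "card A = 1" | "card B = 1" unfolding size by (auto simp: min_def split: if_splits)
    then show "\<not> convex_position ?N p"
    proof cases
      case 1
      then obtain i where "A = {i}" by (auto simp: card_1_singleton_iff)
      moreover from this have "i \<in> ?N" "B = ?N - {i}" using AB by (auto simp: radon_partition_def)
      ultimately show ?thesis using AB unfolding not_convex_position_iff by blast
    next
      case 2
      then obtain i where "B = {i}" by (auto simp: card_1_singleton_iff)
      moreover from this have "i \<in> ?N" "A = ?N - {i}" using AB by (auto simp: radon_partition_def)
      moreover have "radon_partition ?N p B A" using AB by (auto simp: radon_partition_def)
      ultimately show ?thesis unfolding not_convex_position_iff by blast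
    qed
  next
    assume "\<not> convex_position ?N p"
    then obtain i where i: "i \<in> ?N" "radon_partition ?N p {i} (?N - {i})"
      unfolding not_convex_position_iff by blast
    from other[OF i(2)] have "radon_size d p = min (card {i}) (card (?N - {i}))"
      unfolding size by (auto simp: min.commute)
    \<comment> \<open>\<open>d + 1\<close> is at least 1, so the minimum is 1; in dimension 0 both
      sides are singletons.\<close>
    also have "card (?N - {i}) = d + 1" using i(1) by (subst card_Diff_singleton) auto
    finally show "radon_size d p = 1" by simp
  qed
qed

lemma prob_radon_size_eq_prob_convex_position:
  "\<P>(p in gaussian_points d. radon_size d p \<noteq> 1) = \<P>(p in gaussian_points d. convex_position {..<d + 2} p)"
proof (rule measure_eq_AE)
  show "AE p in gaussian_points d. p \<in> {p \<in> space (gaussian_points d). radon_size d p \<noteq> 1} \<longleftrightarrow>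
      p \<in> {p \<in> space (gaussian_points d). convex_position {..<d + 2} p}"
    using AE_radon_size_eq_1_iff[of d] by eventually_elim auto
  show "{p \<in> space (gaussian_points d). radon_size d p \<noteq> 1} \<in> sets (gaussian_points d)"
    by (rule predE[OF pred_radon_size])
  show "{p \<in> space (gaussian_points d). convex_position {..<d + 2} p} \<in> sets (gaussian_points d)"
    by (rule predE[OF pred_convex_position])
qed

text \<open>The sign cones of all singletons are united into one cone \<open>C\<close> before the
  transfer, because the transfer gives the probability of one cone at a time.\<close>

lemma prob_not_convex_position:
  "1 - \<P>(p in gaussian_points d. convex_position {..<d + 2} p) =
    \<P>(z in iid_normal {..<d + 2}. \<exists>i<d + 2. center d z \<in> sign_cone {i} ({..<d + 2} - {i}))"
proof -
  let ?N = "{..<d + 2}"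
  define C where "C = (\<Union>i\<in>?N. sign_cone {i} (?N - {i}))"
  have cone: "cone_on ?N (\<Union>i\<in>S. sign_cone {i} (?N - {i}))" if "finite S" "S \<subseteq> ?N" for S
    using that
  proof (induction S rule: finite_induct)
    case empty
    then show ?case by (simp add: cone_on_def)
  next
    case (insert i S)
    then have "cone_on ?N (sign_cone {i} (?N - {i}))" by (intro cone_on_sign_cone) auto
    then show ?case using insert by (simp add: cone_on_Un)
  qed
  have C: "cone_on ?N C" unfolding C_def by (rule cone) auto
  have iff: "\<not> convex_position ?N p \<longleftrightarrow> dependent_points d C p" if p: "p \<in> space (gaussian_points d)" for p
  proof -
    have "\<not> convex_position ?N p \<longleftrightarrow> (\<exists>i\<in>?N. dependent_points d (sign_cone {i} (?N - {i})) p)"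
      unfolding not_convex_position_iff
      by (intro bex_cong refl radon_partition_iff_dependent_points[OF p]) auto
    also have "\<dots> \<longleftrightarrow> dependent_points d C p"
      unfolding dependent_points_def dependent_in_def C_def by blast
    finally show ?thesis .
  qed
  have "1 - \<P>(p in gaussian_points d. convex_position ?N p) = \<P>(p in gaussian_points d. \<not> convex_position ?N p)"
    by (rule gaussian_points.prob_neg[symmetric, OF predE[OF pred_convex_position]])
  also have "{p \<in> space (gaussian_points d). \<not> convex_position ?N p} = {p \<in> space (gaussian_points d). dependent_points d C p}"
    using iff by blast
  also have "measure (gaussian_points d) \<dots> = \<P>(z in iid_normal ?N. center d z \<in> C)"
    by (rule prob_dependent_points[OF C])
  finally show ?thesis by (simp only: C_def UN_iff Bex_def lessThan_iff)
qed

section \<open>Coordinates below the mean\<close>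

lemma nn_integral_iid_normal_reflect:
  assumes K: "finite K" and f: "f \<in> borel_measurable (borel_Pi K)"
  shows "(\<integral>\<^sup>+z. f (\<lambda>k\<in>K. - z k) \<partial>iid_normal K) = (\<integral>\<^sup>+z. f z \<partial>iid_normal K)"
proof -
  note [measurable] = f
  have "(\<integral>\<^sup>+z. f z \<partial>iid_normal K) = (\<integral>\<^sup>+z. ennreal (\<Prod>k\<in>K. std_normal_density (z k)) * f z \<partial>lborel_Pi K)"
    by (rule nn_integral_iid_normal_eq_lborel_Pi[OF K f])
  also have "\<dots> = ennreal (\<bar>- 1\<bar> ^ card K) *
      (\<integral>\<^sup>+z. ennreal (\<Prod>k\<in>K. std_normal_density ((\<lambda>k\<in>K. 0 + (- 1) * z k) k)) * f (\<lambda>k\<in>K. 0 + (- 1) * z k) \<partial>lborel_Pi K)"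
    using K by (intro nn_integral_lborel_Pi_affine) (simp, simp, measurable)
  also have "\<dots> = (\<integral>\<^sup>+z. ennreal (\<Prod>k\<in>K. std_normal_density (z k)) * f (\<lambda>k\<in>K. - z k) \<partial>lborel_Pi K)"
    by (simp add: std_normal_density_def)
  also have "\<dots> = (\<integral>\<^sup>+z. f (\<lambda>k\<in>K. - z k) \<partial>iid_normal K)"
    by (intro nn_integral_iid_normal_eq_lborel_Pi[OF K, symmetric]) measurable
  finally show ?thesis ..
qed

text \<open>The arguments are \<open>u\<close> plus deviations that add up to zero, so the terms
  linear in \<open>u\<close> cancel in the sum of squares: it is (card L + 1) u^2 plus the square of
  the sum of \<open>y\<close> plus the sum of the squares of \<open>y\<close>.\<close>

lemma std_normal_density_affine_product:
  fixes y :: "'i \<Rightarrow> real"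
  assumes L: "finite L"
  shows "(\<Prod>l\<in>L. std_normal_density (u - y l)) * std_normal_density (u + (\<Sum>l\<in>L. y l)) =
    (1 / sqrt (2 * pi)) ^ card L * exp (- ((\<Sum>l\<in>L. y l)\<^sup>2 + (\<Sum>l\<in>L. (y l)\<^sup>2)) / 2) *
    std_normal_density (sqrt (real (card L) + 1) * u)"
proof -
  let ?s = "\<Sum>l\<in>L. y l" and ?q = "\<Sum>l\<in>L. (y l)\<^sup>2" and ?m = "real (card L)"
  have sq: "(\<Sum>l\<in>L. (u - y l)\<^sup>2) = ?m * u\<^sup>2 - 2 * u * ?s + ?q"
    by (simp add: power2_diff sum.distrib sum_subtractf sum_distrib_left mult.assoc)
  have "(\<Prod>l\<in>L. std_normal_density (u - y l)) = (1 / sqrt (2 * pi)) ^ card L * (\<Prod>l\<in>L. exp (- (u - y l)\<^sup>2 / 2))"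
    by (simp only: std_normal_density_def prod.distrib prod_constant)
  also have "(\<Prod>l\<in>L. exp (- (u - y l)\<^sup>2 / 2)) = exp (- (\<Sum>l\<in>L. (u - y l)\<^sup>2) / 2)"
    using L by (simp add: exp_sum[symmetric] sum_negf sum_divide_distrib)
  finally have 1: "(\<Prod>l\<in>L. std_normal_density (u - y l)) =
    (1 / sqrt (2 * pi)) ^ card L * exp (- (?m * u\<^sup>2 - 2 * u * ?s + ?q) / 2)" unfolding sq .
  have "(sqrt (?m + 1) * u)\<^sup>2 = (?m + 1) * u\<^sup>2" by (simp add: power_mult_distrib)
  then have 2: "exp (- (?m * u\<^sup>2 - 2 * u * ?s + ?q) / 2) * exp (- (u + ?s)\<^sup>2 / 2) =
    exp (- (?s\<^sup>2 + ?q) / 2) * exp (- (sqrt (?m + 1) * u)\<^sup>2 / 2)"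
    unfolding exp_add[symmetric] by (simp add: power2_sum field_simps)
  have 3: "X * a * (c * b) = X * a' * (c * b')" if "a * b = a' * b'" for X a b c a' b' :: real
    using that by (metis mult.assoc mult.left_commute)
  show ?thesis
    unfolding 1 unfolding std_normal_density_def by (rule 3[OF 2])
qed

lemma nn_integral_std_normal_density_scale:
  assumes "c > 0"
  shows "(\<integral>\<^sup>+u. ennreal (std_normal_density (c * u)) \<partial>lborel) = ennreal (1 / c)"
proof -
  have "1 = (\<integral>\<^sup>+u. 1 \<partial>std_normal)" using std_normal.emeasure_space_1 by simp
  also have "\<dots> = (\<integral>\<^sup>+u. ennreal (std_normal_density u) \<partial>lborel)"
    by (subst nn_integral_std_normal) simp_all
  also have "\<dots> = ennreal \<bar>c\<bar> * (\<integral>\<^sup>+u. ennreal (std_normal_density (0 + c * u)) \<partial>lborel)"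
    using assms by (intro nn_integral_real_affine) auto
  finally have "ennreal (1 / c) = ennreal (1 / c) * (ennreal c * (\<integral>\<^sup>+u. ennreal (std_normal_density (c * u)) \<partial>lborel))"
    using assms by simp
  also have "\<dots> = (\<integral>\<^sup>+u. ennreal (std_normal_density (c * u)) \<partial>lborel)"
    using assms unfolding mult.assoc[symmetric] by (simp add: ennreal_mult[symmetric])
  finally show ?thesis ..
qed

text \<open>
  The substitutions are \<open>z\<^sub>i = n u - \<Sum> z\<close>, where \<open>u\<close> is the mean of all \<open>n\<close> coordinates,
  and \<open>z\<^sub>l = u - y\<^sub>l\<close> for \<open>l \<noteq> i\<close>; afterwards \<open>u\<close> is integrated out.
\<close>

lemma nn_integral_iid_normal_all_below_mean:
  fixes L :: "'i::countable set"
  assumes L: "finite L" "i \<notin> L"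
  defines "n \<equiv> real (card L) + 1"
  shows "(\<integral>\<^sup>+z. indicator {z. \<forall>l\<in>L. z l \<le> (\<Sum>k\<in>insert i L. z k) / n} z \<partial>iid_normal (insert i L)) =
    ennreal (sqrt n * (1 / sqrt (2 * pi)) ^ card L) *
    (\<integral>\<^sup>+y. indicator {y. \<forall>l\<in>L. 0 \<le> y l} y * ennreal (exp (- ((\<Sum>l\<in>L. y l)\<^sup>2 + (\<Sum>l\<in>L. (y l)\<^sup>2)) / 2)) \<partial>lborel_Pi L)"
proof -
  interpret LP: sigma_finite_measure "lborel_Pi L" by (rule sigma_finite_lborel_Pi[OF L(1)])
  interpret P1: pair_sigma_finite "lborel_Pi L" lborel ..
  interpret P2: pair_sigma_finite lborel "lborel_Pi L" ..
  have n: "n > 0" by (simp add: n_def)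
  let ?B = "Pi\<^sub>M L (\<lambda>_. borel :: real measure)"
  let ?S = "\<lambda>w. \<Sum>l\<in>L. w l"
  let ?Z = "{z. \<forall>l\<in>L. z l \<le> (\<Sum>k\<in>insert i L. z k) / n}" and ?Y = "{y. \<forall>l\<in>L. 0 \<le> (y l :: real)}"
  let ?e = "\<lambda>y. exp (- ((?S y)\<^sup>2 + (\<Sum>l\<in>L. (y l)\<^sup>2)) / 2 :: real)"
  define G where "G w x = ennreal (\<Prod>l\<in>L. std_normal_density (w l)) * ennreal (std_normal_density x) *
    of_bool (\<forall>l\<in>L. w l \<le> (x + ?S w) / n)" for w x
  have G [measurable]: "(\<lambda>(w, x). G w x) \<in> borel_measurable (?B \<Otimes>\<^sub>M borel)"
    unfolding G_def split_beta' using L(1) by measurable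
  have fm: "(\<lambda>z. indicator ?Z z :: ennreal)
      \<in> borel_measurable (borel_Pi (insert i L))"
  proof (rule measurable_indicator_closed)
    have "?Z = (\<Inter>l\<in>L. {z. z l \<le> (\<Sum>k\<in>insert i L. z k) / n})" by auto
    also have "closed \<dots>"
      using n by (intro closed_INT ballI closed_Collect_le continuous_on_divide continuous_on_sum continuous_on_const) auto
    finally show "closed ?Z" .
  qed
  have fm2: "(\<lambda>z. ennreal (\<Prod>k\<in>insert i L. std_normal_density (z k)) *
      indicator ?Z z) \<in> borel_measurable (borel_Pi (insert i L))"
    by (intro borel_measurable_times_ennreal fm) measurable
  have "(\<integral>\<^sup>+z. indicator ?Z z \<partial>iid_normal (insert i L)) =
    (\<integral>\<^sup>+z. ennreal (\<Prod>k\<in>insert i L. std_normal_density (z k)) *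
      indicator ?Z z \<partial>lborel_Pi (insert i L))"
    using L by (intro nn_integral_iid_normal_eq_lborel_Pi fm) simp
  also have "\<dots> = (\<integral>\<^sup>+w. \<integral>\<^sup>+x. ennreal (\<Prod>k\<in>insert i L. std_normal_density ((w(i := x)) k)) *
      indicator ?Z (w(i := x)) \<partial>lborel \<partial>lborel_Pi L)"
    by (rule nn_integral_lborel_Pi_insert[OF L fm2])
  also have "\<dots> = (\<integral>\<^sup>+w. \<integral>\<^sup>+x. G w x \<partial>lborel \<partial>lborel_Pi L)"
  proof (intro nn_integral_cong)
    fix w x
    have "(\<Prod>k\<in>L. std_normal_density ((w(i := x)) k)) = (\<Prod>k\<in>L. std_normal_density (w k))"
      using L(2) by (intro prod.cong) auto
    moreover have "(\<Sum>k\<in>L. (w(i := x)) k) = ?S w"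
      using L(2) by (intro sum.cong) auto
    moreover have "(\<forall>l\<in>L. (w(i := x)) l \<le> q) \<longleftrightarrow> (\<forall>l\<in>L. w l \<le> q)" for q
      using L(2) by (intro ball_cong) auto
    ultimately show "ennreal (\<Prod>k\<in>insert i L. std_normal_density ((w(i := x)) k)) *
      indicator ?Z (w(i := x)) = G w x"
      unfolding G_def indicator_def mem_Collect_eq using L
      by (simp only: prod.insert sum.insert fun_upd_same) (simp add: ennreal_mult prod_nonneg mult_ac)
  qed
  also have "\<dots> = (\<integral>\<^sup>+w. \<integral>\<^sup>+u. ennreal n * G w (n * u - ?S w) \<partial>lborel \<partial>lborel_Pi L)"
  proof (rule nn_integral_cong)
    fix w assume "w \<in> space (lborel_Pi L)"
    then have [measurable]: "w \<in> space ?B" by (simp add: space_PiM)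
    have "(\<integral>\<^sup>+x. G w x \<partial>lborel) = ennreal \<bar>n\<bar> * (\<integral>\<^sup>+u. G w (- ?S w + n * u) \<partial>lborel)"
      by (intro nn_integral_real_affine) (measurable, use n in simp)
    also have "\<dots> = (\<integral>\<^sup>+u. ennreal n * G w (- ?S w + n * u) \<partial>lborel)"
      using n by (subst nn_integral_cmult) simp_all
    finally show "(\<integral>\<^sup>+x. G w x \<partial>lborel) = (\<integral>\<^sup>+u. ennreal n * G w (n * u - ?S w) \<partial>lborel)"
      by (simp add: add.commute)
  qed
  also have "\<dots> = (\<integral>\<^sup>+u. \<integral>\<^sup>+w. ennreal n * G w (n * u - ?S w) \<partial>lborel_Pi L \<partial>lborel)"
    by (rule P2.Fubini') measurable
  also have "\<dots> = (\<integral>\<^sup>+u. \<integral>\<^sup>+y. ennreal n * G (\<lambda>l\<in>L. u - y l) (u + ?S y) \<partial>lborel_Pi L \<partial>lborel)"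
  proof (rule nn_integral_cong)
    fix u :: real
    have "(\<integral>\<^sup>+w. ennreal n * G w (n * u - ?S w) \<partial>lborel_Pi L) = ennreal (\<bar>- 1\<bar> ^ card L) *
      (\<integral>\<^sup>+y. ennreal n * G (\<lambda>l\<in>L. u + (- 1) * y l) (n * u - ?S (\<lambda>l\<in>L. u + (- 1) * y l)) \<partial>lborel_Pi L)"
      by (rule nn_integral_lborel_Pi_affine[OF L(1)]) (simp, measurable)
    moreover have "n * u - ?S (\<lambda>l\<in>L. u + (- 1) * y l) = u + ?S y" for y :: "'i \<Rightarrow> real"
      by (simp add: sum_subtractf n_def algebra_simps)
    ultimately show "(\<integral>\<^sup>+w. ennreal n * G w (n * u - ?S w) \<partial>lborel_Pi L) =
      (\<integral>\<^sup>+y. ennreal n * G (\<lambda>l\<in>L. u - y l) (u + ?S y) \<partial>lborel_Pi L)"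
      by simp
  qed
  also have "\<dots> = (\<integral>\<^sup>+y. \<integral>\<^sup>+u. ennreal n * G (\<lambda>l\<in>L. u - y l) (u + ?S y) \<partial>lborel \<partial>lborel_Pi L)"
    by (rule P1.Fubini') measurable
  also have "\<dots> = (\<integral>\<^sup>+y. ennreal (sqrt n * (1 / sqrt (2 * pi)) ^ card L) * (indicator ?Y y *
      ennreal (?e y)) \<partial>lborel_Pi L)"
  proof (rule nn_integral_cong)
    fix y :: "'i \<Rightarrow> real"
    define E where "E = (1 / sqrt (2 * pi)) ^ card L * ?e y"
    have E: "E \<ge> 0" by (simp add: E_def)
    have "ennreal n * G (\<lambda>l\<in>L. u - y l) (u + ?S y) =
      (ennreal (n * E) * indicator ?Y y) * ennreal (std_normal_density (sqrt n * u))" for u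
    proof -
      \<comment> \<open>After the substitutions the mean of all coordinates is \<open>u\<close>
        itself, so lying below the mean becomes \<open>0 \<le> y l\<close>.\<close>
      have "(u + ?S y + ?S (\<lambda>l\<in>L. u - y l)) / n = u"
        using n by (simp add: sum_subtractf n_def field_simps)
      then have "(\<forall>l\<in>L. (\<lambda>l\<in>L. u - y l) l \<le> (u + ?S y + ?S (\<lambda>l\<in>L. u - y l)) / n) \<longleftrightarrow> (\<forall>l\<in>L. 0 \<le> y l)"
        by simp
      moreover have "ennreal (\<Prod>l\<in>L. std_normal_density ((\<lambda>l\<in>L. u - y l) l)) * ennreal (std_normal_density (u + ?S y)) =
        ennreal (E * std_normal_density (sqrt n * u))"
        using std_normal_density_affine_product[OF L(1), of u y]
        by (simp add: ennreal_mult[symmetric] prod_nonneg E_def n_def)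
      ultimately show ?thesis
        unfolding G_def using n E by (simp add: ennreal_mult indicator_def mult.assoc)
    qed
    then have "(\<integral>\<^sup>+u. ennreal n * G (\<lambda>l\<in>L. u - y l) (u + ?S y) \<partial>lborel) =
      (ennreal (n * E) * indicator ?Y y) * (\<integral>\<^sup>+u. ennreal (std_normal_density (sqrt n * u)) \<partial>lborel)"
      by (simp add: nn_integral_cmult)
    also have "\<dots> = ennreal (n * E) * ennreal (1 / sqrt n) * indicator ?Y y"
      using n by (subst nn_integral_std_normal_density_scale) (simp_all add: mult_ac)
    also have "ennreal (n * E) * ennreal (1 / sqrt n) = ennreal (sqrt n * E)"
    proof -
      have "n * E * (1 / sqrt n) = (n / sqrt n) * E" by simp
      also have "\<dots> = sqrt n * E" using n by (simp only: real_div_sqrt less_imp_le)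
      finally show ?thesis using n E by (simp add: ennreal_mult[symmetric])
    qed
    also have "ennreal (sqrt n * E) * indicator ?Y y =
      ennreal (sqrt n * (1 / sqrt (2 * pi)) ^ card L) * (indicator ?Y y *
      ennreal (?e y))"
      using n by (simp add: E_def ennreal_mult mult_ac)
    finally show "(\<integral>\<^sup>+u. ennreal n * G (\<lambda>l\<in>L. u - y l) (u + ?S y) \<partial>lborel) =
      ennreal (sqrt n * (1 / sqrt (2 * pi)) ^ card L) * (indicator ?Y y *
      ennreal (?e y))" .
  qed
  also have "\<dots> = ennreal (sqrt n * (1 / sqrt (2 * pi)) ^ card L) *
    (\<integral>\<^sup>+y. indicator ?Y y * ennreal (?e y) \<partial>lborel_Pi L)"
  proof (rule nn_integral_cmult)
    have "(\<lambda>y. of_bool (\<forall>l\<in>L. 0 \<le> y l) * ennreal (?e y))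
      \<in> borel_measurable ?B"
      using L(1) by measurable
    then show "(\<lambda>y. indicator ?Y y * ennreal (?e y))
      \<in> borel_measurable (lborel_Pi L)"
      by (simp add: measurable_lborel_Pi indicator_def)
  qed
  finally show ?thesis .
qed

section \<open>Dirichlet integrals\<close>

text \<open>The Erlang density of rate 1 without its exponential factor. For \<open>k = 0\<close> it
  is the indicator of the closed half-line.\<close>

definition power_over_fact :: "nat \<Rightarrow> real \<Rightarrow> real" where
  "power_over_fact k x = (if x < 0 then 0 else x ^ k / fact k)"

lemma power_over_fact_nonneg: "power_over_fact k x \<ge> 0"
  by (simp add: power_over_fact_def)

lemma measurable_power_over_fact [measurable]: "power_over_fact k \<in> borel_measurable borel"
  unfolding power_over_fact_def[abs_def] by measurable

text \<open>The beta integral, read off from the convolution of Erlang densities: the exponential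
  factors combine to exp (- t), which does not depend on \<open>r\<close> and can be divided
  out.\<close>

lemma power_over_fact_convolution:
  "(\<integral>\<^sup>+r. ennreal (power_over_fact p (t - r)) * ennreal (power_over_fact q r) \<partial>lborel) =
    ennreal (power_over_fact (p + q + 1) t)"
proof -
  have erlang: "erlang_density k 1 x = power_over_fact k x * exp (- x)" for k x
    by (simp add: erlang_density_def power_over_fact_def)
  have conv: "(\<integral>\<^sup>+r. ennreal (erlang_density p 1 (t - r)) * ennreal (erlang_density q 1 r) \<partial>lborel) =
      ennreal (erlang_density (p + q + 1) 1 t)"
    using fun_cong[OF convolution_erlang_density[of 1 p q], of t] by simp
  have eq: "ennreal (power_over_fact p (t - r)) * ennreal (power_over_fact q r) =
      ennreal (exp t) * (ennreal (erlang_density p 1 (t - r)) * ennreal (erlang_density q 1 r))" for r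
  proof -
    have "exp t * (exp (- (t - r)) * exp (- r)) = 1"
      unfolding exp_add[symmetric] by simp
    then have "power_over_fact p (t - r) * power_over_fact q r =
      exp t * (erlang_density p 1 (t - r) * erlang_density q 1 r)"
      unfolding erlang by (metis (no_types, opaque_lifting) mult.assoc mult.left_commute mult.right_neutral)
    then show ?thesis
      by (simp add: ennreal_mult[symmetric] power_over_fact_nonneg)
  qed
  have "(\<integral>\<^sup>+r. ennreal (power_over_fact p (t - r)) * ennreal (power_over_fact q r) \<partial>lborel) =
      ennreal (exp t) * ennreal (erlang_density (p + q + 1) 1 t)"
    unfolding eq conv[symmetric] by (rule nn_integral_cmult) measurable
  also have "\<dots> = ennreal (power_over_fact (p + q + 1) t)"
  proof -
    have "exp t * erlang_density (p + q + 1) 1 t = power_over_fact (p + q + 1) t"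
      unfolding erlang by (simp add: exp_minus)
    then show ?thesis by (simp add: ennreal_mult[symmetric])
  qed
  finally show ?thesis .
qed

text \<open>A function of the sum alone is integrated against the iterated convolution of the
  factors, and each convolution adds the exponents and 1.\<close>

lemma nn_integral_Dirichlet:
  assumes "finite L" "L \<noteq> {}" "h \<in> borel_measurable borel"
  shows "(\<integral>\<^sup>+y. ennreal (\<Prod>l\<in>L. power_over_fact (a l) (y l)) * h (\<Sum>l\<in>L. y l) \<partial>lborel_Pi L) =
    (\<integral>\<^sup>+r. ennreal (power_over_fact ((\<Sum>l\<in>L. Suc (a l)) - 1) r) * h r \<partial>lborel)"
  using assms
proof (induction L arbitrary: h rule: finite_ne_induct)
  case (singleton b)
  note [measurable] = singleton.prems
  interpret product_sigma_finite "\<lambda>_::'a. lborel :: real measure" by (rule product_sigma_finite_lborel)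
  show ?case
    using product_nn_integral_singleton[of "\<lambda>x. ennreal (power_over_fact (a b) x) * h x" b] by simp
next
  case (insert b L)
  note [measurable] = insert.prems
  let ?p = "a b" and ?q = "(\<Sum>l\<in>L. Suc (a l)) - 1"
  have fin: "finite L" "b \<notin> L" "L \<noteq> {}" using insert by auto
  \<comment> \<open>\<open>L\<close> is nonempty, so the subtraction of 1 on natural numbers is not
    truncated.\<close>
  have "(\<Sum>l\<in>L. Suc (a l)) > 0" using fin by (subst sum_pos) auto
  then have idx: "(\<Sum>l\<in>insert b L. Suc (a l)) - 1 = ?p + ?q + 1"
    using fin by simp
  define g where "g r = (\<integral>\<^sup>+x. ennreal (power_over_fact ?p x) * h (x + r) \<partial>lborel)" for r
  have gm [measurable]: "g \<in> borel_measurable borel"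
    unfolding g_def[abs_def] by measurable
  have fm: "(\<lambda>y. ennreal (\<Prod>l\<in>insert b L. power_over_fact (a l) (y l)) * h (\<Sum>l\<in>insert b L. y l))
    \<in> borel_measurable (borel_Pi (insert b L))" by measurable
  have "(\<integral>\<^sup>+y. ennreal (\<Prod>l\<in>insert b L. power_over_fact (a l) (y l)) * h (\<Sum>l\<in>insert b L. y l) \<partial>lborel_Pi (insert b L)) =
    (\<integral>\<^sup>+y. \<integral>\<^sup>+x. ennreal (\<Prod>l\<in>insert b L. power_over_fact (a l) ((y(b := x)) l)) *
      h (\<Sum>l\<in>insert b L. (y(b := x)) l) \<partial>lborel \<partial>lborel_Pi L)"
    by (rule nn_integral_lborel_Pi_insert[OF fin(1,2) fm])
  also have "\<dots> = (\<integral>\<^sup>+y. ennreal (\<Prod>l\<in>L. power_over_fact (a l) (y l)) * g (\<Sum>l\<in>L. y l) \<partial>lborel_Pi L)"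
  proof (rule nn_integral_cong)
    fix y
    have 1: "(\<Prod>l\<in>L. power_over_fact (a l) ((y(b := x)) l)) = (\<Prod>l\<in>L. power_over_fact (a l) (y l))"
      "(\<Sum>l\<in>L. (y(b := x)) l) = (\<Sum>l\<in>L. y l)" for x
      using fin(2) by (auto intro!: prod.cong sum.cong)
    have "(\<integral>\<^sup>+x. ennreal (\<Prod>l\<in>insert b L. power_over_fact (a l) ((y(b := x)) l)) *
        h (\<Sum>l\<in>insert b L. (y(b := x)) l) \<partial>lborel) =
      (\<integral>\<^sup>+x. ennreal (\<Prod>l\<in>L. power_over_fact (a l) (y l)) * (ennreal (power_over_fact ?p x) * h (x + (\<Sum>l\<in>L. y l))) \<partial>lborel)"
      unfolding prod.insert[OF fin(1,2)] sum.insert[OF fin(1,2)] 1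
      by (simp add: ennreal_mult power_over_fact_nonneg prod_nonneg mult_ac)
    also have "\<dots> = ennreal (\<Prod>l\<in>L. power_over_fact (a l) (y l)) * g (\<Sum>l\<in>L. y l)"
      unfolding g_def by (rule nn_integral_cmult) measurable
    finally show "(\<integral>\<^sup>+x. ennreal (\<Prod>l\<in>insert b L. power_over_fact (a l) ((y(b := x)) l)) *
        h (\<Sum>l\<in>insert b L. (y(b := x)) l) \<partial>lborel) = ennreal (\<Prod>l\<in>L. power_over_fact (a l) (y l)) * g (\<Sum>l\<in>L. y l)" .
  qed
  also have "\<dots> = (\<integral>\<^sup>+r. ennreal (power_over_fact ?q r) * g r \<partial>lborel)"
    by (rule insert.IH[OF gm])
  also have "\<dots> = (\<integral>\<^sup>+r. \<integral>\<^sup>+t. ennreal (power_over_fact ?p (t - r)) * ennreal (power_over_fact ?q r) * h t \<partial>lborel \<partial>lborel)"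
  proof (rule nn_integral_cong)
    fix r :: real
    have "g r = (\<integral>\<^sup>+t. ennreal (power_over_fact ?p (- r + 1 * t)) * h (- r + 1 * t + r) \<partial>lborel)"
      unfolding g_def by (subst nn_integral_real_affine[where c = 1 and t = "- r"]) simp_all
    then have "ennreal (power_over_fact ?q r) * g r =
      ennreal (power_over_fact ?q r) * (\<integral>\<^sup>+t. ennreal (power_over_fact ?p (t - r)) * h t \<partial>lborel)" by simp
    also have "\<dots> = (\<integral>\<^sup>+t. ennreal (power_over_fact ?q r) * (ennreal (power_over_fact ?p (t - r)) * h t) \<partial>lborel)"
      by (rule nn_integral_cmult[symmetric]) measurable
    finally show "ennreal (power_over_fact ?q r) * g r =
      (\<integral>\<^sup>+t. ennreal (power_over_fact ?p (t - r)) * ennreal (power_over_fact ?q r) * h t \<partial>lborel)"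
      by (simp add: mult_ac)
  qed
  also have "\<dots> = (\<integral>\<^sup>+t. \<integral>\<^sup>+r. ennreal (power_over_fact ?p (t - r)) * ennreal (power_over_fact ?q r) * h t \<partial>lborel \<partial>lborel)"
    by (rule lborel_pair.Fubini') measurable
  also have "\<dots> = (\<integral>\<^sup>+t. (\<integral>\<^sup>+r. ennreal (power_over_fact ?p (t - r)) * ennreal (power_over_fact ?q r) \<partial>lborel) * h t \<partial>lborel)"
    by (intro nn_integral_cong nn_integral_multc) measurable
  also have "\<dots> = (\<integral>\<^sup>+t. ennreal (power_over_fact (?p + ?q + 1) t) * h t \<partial>lborel)"
    by (simp only: power_over_fact_convolution)
  finally show ?case unfolding idx .
qed

lemma power_over_fact_product:
  assumes "finite L"
  shows "(\<forall>l\<in>L. 0 \<le> y l) \<Longrightarrow> (\<Prod>l\<in>L. power_over_fact (a l) (y l)) = (\<Prod>l\<in>L. y l ^ a l / fact (a l))"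
    and "\<not> (\<forall>l\<in>L. 0 \<le> y l) \<Longrightarrow> (\<Prod>l\<in>L. power_over_fact (a l) (y l)) = 0"
  using assms by (auto intro!: prod.cong prod_zero simp: power_over_fact_def not_le)

section \<open>Gaussian moments on the half-line and their growth\<close>

definition half_moment :: "nat \<Rightarrow> real" where
  "half_moment p = (\<integral>x. indicator {0..} x * (x ^ p * exp (- x\<^sup>2 / 2)) \<partial>lborel)"

text \<open>The substitution x / sqrt 2 passes from the weight exp (- x^2) to exp (- x^2 / 2);
  \<open>p\<close> factors sqrt 2 come from the power and one from the Jacobian.\<close>

lemma has_bochner_integral_half_moment_rescale:
  assumes "has_bochner_integral lborel (\<lambda>x::real. indicator {0..} x *\<^sub>R (exp (- x\<^sup>2) * x ^ p)) I"
  shows "has_bochner_integral lborel (\<lambda>x. indicator {0..} x * (x ^ p * exp (- x\<^sup>2 / 2))) (sqrt 2 ^ (p + 1) * I)"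
proof -
  have eq: "indicator {0..} (1 / sqrt 2 * x) *\<^sub>R (exp (- (1 / sqrt 2 * x)\<^sup>2) * (1 / sqrt 2 * x) ^ p) =
      (1 / sqrt 2 ^ p) * (indicator {0..} x * (x ^ p * exp (- x\<^sup>2 / 2)))" for x :: real
    by (simp add: indicator_def power_divide power_mult_distrib zero_le_divide_iff)
  have "has_bochner_integral lborel (\<lambda>x. (1 / sqrt 2 ^ p) * (indicator {0..} x * (x ^ p * exp (- x\<^sup>2 / 2)))) (I /\<^sub>R \<bar>1 / sqrt 2\<bar>)"
    using lborel_has_bochner_integral_real_affine_iff[of "1 / sqrt 2" "\<lambda>x. indicator {0..} x *\<^sub>R (exp (- x\<^sup>2) * x ^ p)" I 0] assms
    unfolding add_0 eq by simp
  then have "has_bochner_integral lborel (\<lambda>x. sqrt 2 ^ p * ((1 / sqrt 2 ^ p) * (indicator {0..} x * (x ^ p * exp (- x\<^sup>2 / 2)))))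
      (sqrt 2 ^ p * (I /\<^sub>R \<bar>1 / sqrt 2\<bar>))"
    by (rule has_bochner_integral_mult_right)
  then show ?thesis
    by (simp add: mult_ac)
qed

lemma has_bochner_integral_half_moment:
  "has_bochner_integral lborel (\<lambda>x. indicator {0..} x * (x ^ p * exp (- x\<^sup>2 / 2))) (half_moment p)"
  and half_moment_even: "half_moment (2 * k) = sqrt (pi / 2) * fact (2 * k) / (2 ^ k * fact k)"
  and half_moment_odd: "half_moment (2 * k + 1) = 2 ^ k * fact k"
proof -
  have even: "has_bochner_integral lborel (\<lambda>x. indicator {0..} x * (x ^ (2 * k) * exp (- x\<^sup>2 / 2)))
      (sqrt (pi / 2) * fact (2 * k) / (2 ^ k * fact k))" for k
  proof -
    have "sqrt 2 ^ (2 * k + 1) * (sqrt pi / 2 * (fact (2 * k) / (2 ^ (2 * k) * fact k))) =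
      sqrt (pi / 2) * fact (2 * k) / (2 ^ k * fact k)"
    proof -
      have "sqrt 2 ^ (2 * k + 1) = 2 ^ k * sqrt 2" by (simp add: power_mult)
      moreover have "(2::real) ^ (2 * k) = 2 ^ k * 2 ^ k" by (simp add: power_add[symmetric] mult_2)
      moreover have "sqrt 2 * (sqrt pi / 2) = sqrt (pi / 2)"
        by (simp add: real_sqrt_divide field_simps)
      ultimately show ?thesis by (simp add: field_simps)
    qed
    with has_bochner_integral_half_moment_rescale[OF gaussian_moment_even_pos[of k]] show ?thesis by simp
  qed
  have odd: "has_bochner_integral lborel (\<lambda>x::real. indicator {0..} x * (x ^ (2 * k + 1) * exp (- x\<^sup>2 / 2)))
      (2 ^ k * fact k)" for k
  proof -
    have "sqrt 2 ^ (2 * k + 1 + 1) * (fact k / 2) = 2 ^ k * fact k"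
      by (simp add: power_mult)
    with has_bochner_integral_half_moment_rescale[OF gaussian_moment_odd_pos[of k]] show ?thesis by simp
  qed
  show "half_moment (2 * k) = sqrt (pi / 2) * fact (2 * k) / (2 ^ k * fact k)"
    "half_moment (2 * k + 1) = 2 ^ k * fact k"
    unfolding half_moment_def using even[of k] odd[of k] by (auto dest: has_bochner_integral_integral_eq)
  have "integrable lborel (\<lambda>x. indicator {0..} x * (x ^ p * exp (- x\<^sup>2 / 2)) :: real)"
  proof (cases "even p")
    case True
    then obtain k where "p = 2 * k" by blast
    then show ?thesis using even[of k] by (auto dest: integrable.intros)
  next
    case False
    then obtain k where "p = 2 * k + 1" by (rule oddE)
    then show ?thesis using odd[of k] by (auto dest: integrable.intros)
  qed
  then show "has_bochner_integral lborel (\<lambda>x. indicator {0..} x * (x ^ p * exp (- x\<^sup>2 / 2))) (half_moment p)"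
    unfolding half_moment_def by (rule has_bochner_integral_integrable)
qed

lemma fact_double_Suc:
  "fact (2 * Suc k) / (2 ^ Suc k * fact (Suc k)) = real (2 * k + 1) * (fact (2 * k) / (2 ^ k * fact k))"
proof -
  have "(fact (2 * Suc k) :: real) = (2 * (real k + 1)) * (real (2 * k + 1) * fact (2 * k))"
    by (simp add: algebra_simps)
  moreover have "(2 ^ Suc k * fact (Suc k) :: real) = (2 * (real k + 1)) * (2 ^ k * fact k)"
    by (simp add: algebra_simps)
  ultimately have "(fact (2 * Suc k) / (2 ^ Suc k * fact (Suc k)) :: real) =
      ((2 * (real k + 1)) * (real (2 * k + 1) * fact (2 * k))) / ((2 * (real k + 1)) * (2 ^ k * fact k))"
    by (simp only:)
  also have "\<dots> = (real (2 * k + 1) * fact (2 * k)) / (2 ^ k * fact k)"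
    by (rule mult_divide_mult_cancel_left) simp
  finally show ?thesis by simp
qed

lemma half_moment_Suc_Suc: "half_moment (Suc (Suc p)) = real (Suc p) * half_moment p"
proof (cases "even p")
  case True
  then obtain k where p: "p = 2 * k" by blast
  have "half_moment (2 * Suc k) = real (2 * k + 1) * half_moment (2 * k)"
    unfolding half_moment_even times_divide_eq_right[symmetric] fact_double_Suc by (simp only: mult_ac)
  then show ?thesis by (simp add: p)
next
  case False
  then obtain k where p: "p = 2 * k + 1" by (rule oddE)
  have "half_moment (2 * Suc k + 1) = real (2 * k + 1 + 1) * half_moment (2 * k + 1)"
    unfolding half_moment_odd by (simp add: field_simps)
  then show ?thesis by (simp add: p)
qed

text \<open>One of the two neighbouring orders is even and the other odd, and their closed forms
  multiply to a plain factorial. This later turns \<open>half_moment d / fact d\<close> into a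
  constant over \<open>half_moment (Suc d)\<close>, so a single moment has to be estimated.\<close>

lemma half_moment_mult_Suc: "half_moment p * half_moment (Suc p) = sqrt (pi / 2) * fact p"
proof (cases "even p")
  case True
  then obtain k where p: "p = 2 * k" by blast
  show ?thesis
    using half_moment_even[of k] half_moment_odd[of k] by (simp add: p)
next
  case False
  then obtain k where p: "p = 2 * k + 1" by (rule oddE)
  have "half_moment (2 * k + 1) * half_moment (2 * Suc k) = sqrt (pi / 2) * fact (2 * k + 1)"
  proof -
    have cancel: "a * (s * (c * (d / a))) = s * (c * d)" if "a \<noteq> 0" for a s c d :: real
      using that by simp
    have "half_moment (2 * k + 1) * half_moment (2 * Suc k) =
      (2 ^ k * fact k) * (sqrt (pi / 2) * (real (2 * k + 1) * (fact (2 * k) / (2 ^ k * fact k))))"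
      unfolding half_moment_even half_moment_odd times_divide_eq_right[symmetric] fact_double_Suc ..
    also have "\<dots> = sqrt (pi / 2) * (real (2 * k + 1) * fact (2 * k))"
      by (rule cancel) simp
    finally show ?thesis by simp
  qed
  then show ?thesis by (simp add: p)
qed

lemma half_moment_pos: "half_moment p > 0"
proof (cases "even p")
  case True
  then obtain k where p: "p = 2 * k" by blast
  show ?thesis unfolding p half_moment_even by simp
next
  case False
  then obtain k where p: "p = 2 * k + 1" by (rule oddE)
  show ?thesis unfolding p half_moment_odd by simp
qed

lemma nn_integral_power_over_fact_exp:
  "(\<integral>\<^sup>+r. ennreal (power_over_fact p r) * ennreal (exp (- r\<^sup>2 / 2)) \<partial>lborel) = ennreal (half_moment p / fact p)"
proof -
  have "has_bochner_integral lborel (\<lambda>x. indicator {0..} x * (x ^ p * exp (- x\<^sup>2 / 2)) / fact p) (half_moment p / fact p)"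
    by (intro has_bochner_integral_divide_zero has_bochner_integral_half_moment)
  then have "(\<integral>\<^sup>+x. ennreal (indicator {0..} x * (x ^ p * exp (- x\<^sup>2 / 2)) / fact p) \<partial>lborel) = ennreal (half_moment p / fact p)"
    by (subst nn_integral_eq_integral) (auto simp: has_bochner_integral_iff indicator_def)
  also have "(\<integral>\<^sup>+x. ennreal (indicator {0..} x * (x ^ p * exp (- x\<^sup>2 / 2)) / fact p) \<partial>lborel) =
    (\<integral>\<^sup>+r. ennreal (power_over_fact p r) * ennreal (exp (- r\<^sup>2 / 2)) \<partial>lborel)"
    by (intro nn_integral_cong) (auto simp: power_over_fact_def indicator_def ennreal_mult[symmetric])
  finally show ?thesis .
qed

text \<open>
  Laplace's method: with \<open>r = sqrt m + x\<close> the bound \<open>1 + t \<le> exp t\<close> makes the integrand at most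
  \<open>exp (- x\<^sup>2 / 2)\<close>, so that dominated convergence applies.
\<close>

lemma half_moment_asymp:
  "(\<lambda>m. half_moment m / (sqrt (real m) ^ m * exp (- real m / 2))) \<longlonglongrightarrow> sqrt pi"
proof -
  \<comment> \<open>The integrand of \<open>half_moment m\<close> at sqrt m + x, divided by its
    maximum, which is attained at x = 0.\<close>
  define f where "f m x = indicator {- sqrt (real m)..} x * ((1 + x / sqrt (real m)) ^ m * exp (- sqrt (real m) * x - x\<^sup>2 / 2))"
    for m :: nat and x :: real
  have eq: "half_moment m / (sqrt (real m) ^ m * exp (- real m / 2)) = (\<integral>x. f m x \<partial>lborel)" if m: "m > 0" for m
  proof -
    let ?s = "sqrt (real m)"
    have s: "?s > 0" using m by simp
    have "half_moment m = (\<integral>x. indicator {0..} (?s + 1 * x) * ((?s + 1 * x) ^ m * exp (- (?s + 1 * x)\<^sup>2 / 2)) \<partial>lborel)"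
      unfolding half_moment_def by (subst lborel_integral_real_affine[where c = 1 and t = ?s]) simp_all
    also have "\<dots> = (\<integral>x. (?s ^ m * exp (- real m / 2)) * f m x \<partial>lborel)"
    proof (rule Bochner_Integration.integral_cong[OF refl])
      fix x
      have "?s + x = ?s * (1 + x / ?s)" using s by (simp add: distrib_left)
      then have "(?s + x) ^ m = ?s ^ m * (1 + x / ?s) ^ m"
        by (metis power_mult_distrib)
      moreover have "exp (- (?s + x)\<^sup>2 / 2) = exp (- real m / 2) * exp (- ?s * x - x\<^sup>2 / 2)"
        unfolding exp_add[symmetric] by (simp add: power2_sum field_simps)
      ultimately show "indicator {0..} (?s + 1 * x) * ((?s + 1 * x) ^ m * exp (- (?s + 1 * x)\<^sup>2 / 2)) =
        (?s ^ m * exp (- real m / 2)) * f m x"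
        by (simp add: f_def indicator_def)
    qed
    also have "\<dots> = (?s ^ m * exp (- real m / 2)) * (\<integral>x. f m x \<partial>lborel)" by simp
    finally show ?thesis using s by simp
  qed
  have "(\<lambda>m. \<integral>x. f m x \<partial>lborel) \<longlonglongrightarrow> (\<integral>x. exp (- x\<^sup>2) \<partial>lborel)"
  proof (rule integral_dominated_convergence[where w = "\<lambda>x. exp (- x\<^sup>2 / 2)"])
    show "integrable lborel (\<lambda>x::real. exp (- x\<^sup>2 / 2))"
    proof -
      have "integrable lborel (\<lambda>x. sqrt (2 * pi) * std_normal_density x)" by simp
      then show ?thesis by (simp add: std_normal_density_def)
    qed
    show "AE x in lborel. (\<lambda>m. f m x) \<longlonglongrightarrow> exp (- x\<^sup>2)"
    proof (rule AE_I2)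
      fix x :: real
      \<comment> \<open>Expanding the logarithm, the linear terms cancel and the quadratic one
        contributes a second - x^2 / 2; this is why the limit integral is that of exp (- x^2), with
        value sqrt pi.\<close>
      have "(\<lambda>m. exp (real m * ln (1 + x / sqrt (real m)) - sqrt (real m) * x - x\<^sup>2 / 2)) \<longlonglongrightarrow> exp (- (x * x / 2) - x\<^sup>2 / 2)"
        by real_asymp
      also have "exp (- (x * x / 2) - x\<^sup>2 / 2) = exp (- x\<^sup>2)"
        by (simp add: power2_eq_square)
      finally have "(\<lambda>m. exp (real m * ln (1 + x / sqrt (real m)) - sqrt (real m) * x - x\<^sup>2 / 2)) \<longlonglongrightarrow> exp (- x\<^sup>2)" .
      moreover have "eventually (\<lambda>m. exp (real m * ln (1 + x / sqrt (real m)) - sqrt (real m) * x - x\<^sup>2 / 2) = f m x) sequentially"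
      proof -
        have "eventually (\<lambda>m. 1 + x / sqrt (real m) > 0 \<and> - sqrt (real m) \<le> x) sequentially"
          by (intro eventually_conj) real_asymp+
        then show ?thesis
        proof eventually_elim
          case (elim m)
          then have "(1 + x / sqrt (real m)) ^ m = exp (real m * ln (1 + x / sqrt (real m)))"
            by (simp add: exp_of_nat_mult)
          then show ?case using elim by (simp add: f_def exp_add[symmetric] exp_diff[symmetric] algebra_simps)
        qed
      qed
      ultimately show "(\<lambda>m. f m x) \<longlonglongrightarrow> exp (- x\<^sup>2)"
        by (rule Lim_transform_eventually)
    qed
    show "AE x in lborel. norm (f m x) \<le> exp (- x\<^sup>2 / 2)" for m
    proof (rule AE_I2)
      fix x :: real
      show "norm (f m x) \<le> exp (- x\<^sup>2 / 2)"
      \<comment> \<open>For \<open>m = 0\<close> the power is 1 and the bound holds directly;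
        otherwise the complementary case lies outside the indicator.\<close>
      proof (cases "x \<ge> - sqrt (real m) \<and> m > 0")
        case True
        let ?s = "sqrt (real m)"
        have s: "?s > 0" using True by simp
        have nn: "1 + x / ?s \<ge> 0" using True s by (simp add: field_simps)
        have "(1 + x / ?s) ^ m \<le> exp (x / ?s) ^ m"
          using nn by (intro power_mono) (auto simp: exp_ge_add_one_self)
        also have "\<dots> = exp (?s * x)"
          unfolding exp_of_nat_mult[symmetric] using s by (simp add: field_simps)
        finally have "(1 + x / ?s) ^ m * exp (- ?s * x - x\<^sup>2 / 2) \<le> exp (?s * x) * exp (- ?s * x - x\<^sup>2 / 2)"
          by (intro mult_right_mono) auto
        also have "\<dots> = exp (- x\<^sup>2 / 2)" unfolding exp_add[symmetric] by simp
        finally show ?thesis using True nn by (simp add: f_def)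
      next
        case False
        then show ?thesis by (auto simp: f_def indicator_def)
      qed
    qed
    show "f m \<in> borel_measurable lborel" for m
      unfolding f_def[abs_def] by measurable
  qed simp
  moreover have "(\<integral>x. exp (- x\<^sup>2) \<partial>lborel) = sqrt pi"
  proof -
    have "has_bochner_integral lborel (\<lambda>x::real. exp (- x\<^sup>2)) (2 *\<^sub>R (sqrt pi / 2))"
      by (rule has_bochner_integral_even_function[OF gaussian_moment_0]) simp
    then show ?thesis by (auto dest: has_bochner_integral_integral_eq)
  qed
  ultimately have "(\<lambda>m. \<integral>x. f m x \<partial>lborel) \<longlonglongrightarrow> sqrt pi" by simp
  moreover have "eventually (\<lambda>m. (\<integral>x. f m x \<partial>lborel) = half_moment m / (sqrt (real m) ^ m * exp (- real m / 2))) sequentially"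
    using eventually_gt_at_top[of 0] by eventually_elim (simp only: eq)
  ultimately show ?thesis by (rule Lim_transform_eventually)
qed

text \<open>With w = 1 - x these are 1 + w \<le> exp w \<le> 1 + w + w^2, the latter for w \<le> 1.
  Both polynomials touch exp (- x) at x = 1, where half the sum of squares will concentrate, and
  their degrees mean that only its first two moments enter.\<close>

lemma exp_minus_bounds:
  fixes x :: real
  assumes "x \<ge> 0"
  shows "exp (- 1) * (2 - x) \<le> exp (- x)" and "exp (- x) \<le> exp (- 1) * (3 - 3 * x + x\<^sup>2)"
proof -
  have e: "exp (- x) = exp (- 1) * exp (1 - x)" by (simp add: exp_add[symmetric])
  have "2 - x \<le> exp (1 - x)" using exp_ge_add_one_self[of "1 - x"] by simp
  then show "exp (- 1) * (2 - x) \<le> exp (- x)" unfolding e by simp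
  have "exp w \<le> 1 + w + w\<^sup>2" if "w \<le> 1" for w :: real
  proof (cases "w \<ge> 0")
    case True
    then show ?thesis using exp_bound[of w] that by simp
  next
    case False
    have "1 - w \<le> exp (- w)" using exp_ge_add_one_self[of "- w"] by simp
    moreover have "1 - w > 0" using False by simp
    ultimately have "exp w \<le> 1 / (1 - w)"
      by (simp add: exp_minus field_simps)
    also have "\<dots> \<le> 1 + w + w\<^sup>2"
    proof -
      have "(1 + w + w\<^sup>2) * (1 - w) = 1 - w ^ 3" by (simp add: algebra_simps power2_eq_square power3_eq_cube)
      moreover have "w ^ 3 \<le> 0" using False by (simp add: power3_eq_cube mult_nonneg_nonpos)
      ultimately show ?thesis using \<open>1 - w > 0\<close> by (simp add: divide_le_eq)
    qed
    finally show ?thesis .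
  qed
  from this[of "1 - x"] have "exp (1 - x) \<le> 3 - 3 * x + x\<^sup>2"
    using assms by (simp add: power2_eq_square algebra_simps)
  then show "exp (- x) \<le> exp (- 1) * (3 - 3 * x + x\<^sup>2)" unfolding e by simp
qed

section \<open>The Gaussian integral over the orthant\<close>

context
  fixes L :: "'i set"
  assumes L: "finite L" "L \<noteq> {}"
begin

text \<open>An unnormalised density on the orthant: conditionally on the sum it is a Dirichlet
  distribution with parameters \<open>a l + 1\<close>. The exponential depends on the sum only, so
  every total mass reduces to a one-dimensional moment. All exponents 0 gives the part of the
  integrand that is kept exactly.\<close>

definition Dirichlet_weight :: "('i \<Rightarrow> nat) \<Rightarrow> ('i \<Rightarrow> real) \<Rightarrow> real" where
  "Dirichlet_weight a y = (\<Prod>l\<in>L. power_over_fact (a l) (y l)) * exp (- (\<Sum>l\<in>L. y l)\<^sup>2 / 2)"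

lemma Dirichlet_weight_nonneg: "Dirichlet_weight a y \<ge> 0"
  by (simp add: Dirichlet_weight_def prod_nonneg power_over_fact_nonneg)

lemma measurable_Dirichlet_weight [measurable]:
  "Dirichlet_weight a \<in> borel_measurable (borel_Pi L)"
  unfolding Dirichlet_weight_def[abs_def] by measurable

lemma nn_integral_Dirichlet_weight:
  "(\<integral>\<^sup>+y. ennreal (Dirichlet_weight a y) \<partial>lborel_Pi L) =
    ennreal (half_moment ((\<Sum>l\<in>L. Suc (a l)) - 1) / fact ((\<Sum>l\<in>L. Suc (a l)) - 1))"
proof -
  have "ennreal (Dirichlet_weight a y) =
    ennreal (\<Prod>l\<in>L. power_over_fact (a l) (y l)) * ennreal (exp (- (\<Sum>l\<in>L. y l)\<^sup>2 / 2))" for y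
    unfolding Dirichlet_weight_def by (rule ennreal_mult) (simp_all add: prod_nonneg power_over_fact_nonneg)
  then show ?thesis
    using nn_integral_Dirichlet[OF L, of "\<lambda>s. ennreal (exp (- s\<^sup>2 / 2))" a]
    by (simp only: nn_integral_power_over_fact_exp) simp
qed

definition half_square_sum :: "('i \<Rightarrow> real) \<Rightarrow> real" where
  "half_square_sum y = (\<Sum>l\<in>L. (y l)\<^sup>2) / 2"

text \<open>As \<open>power_over_fact 2\<close> is y^2 / 2, multiplying by half a square raises one
  exponent from 0 to 2 without a further constant.\<close>

lemma Dirichlet_weight_square:
  "Dirichlet_weight (\<lambda>_. 0) y * half_square_sum y =
    (\<Sum>l\<in>L. Dirichlet_weight (\<lambda>k. if k = l then 2 else 0) y)"
proof (cases "\<forall>l\<in>L. 0 \<le> y l")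
  case True
  have sq: "(\<Prod>k\<in>L. power_over_fact (if k = l then 2 else 0) (y k)) = (y l)\<^sup>2 / 2" if "l \<in> L" for l
    unfolding power_over_fact_product(1)[OF L(1) True] using L(1) that
    by (subst prod.remove[of L l]) (auto intro!: prod.neutral)
  have "(\<Sum>l\<in>L. Dirichlet_weight (\<lambda>k. if k = l then 2 else 0) y) =
      (\<Sum>l\<in>L. (y l)\<^sup>2 / 2 * exp (- (\<Sum>l\<in>L. y l)\<^sup>2 / 2))"
    unfolding Dirichlet_weight_def by (intro sum.cong refl) (simp only: sq)
  also have "\<dots> = half_square_sum y * exp (- (\<Sum>l\<in>L. y l)\<^sup>2 / 2)"
    by (simp only: half_square_sum_def sum_distrib_right sum_divide_distrib)
  moreover have "(\<Prod>k\<in>L. power_over_fact 0 (y k)) = 1"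
    unfolding power_over_fact_product(1)[OF L(1) True] by simp
  ultimately show ?thesis
    by (simp add: Dirichlet_weight_def)
next
  case False
  then show ?thesis
    by (simp add: Dirichlet_weight_def power_over_fact_product(2)[OF L(1)])
qed

text \<open>Off the diagonal two exponents become 2. On the diagonal one exponent becomes 4, and the
  constant 6 compensates for the factorial: (y^2 / 2)^2 = 6 y^4 / 24.\<close>

lemma Dirichlet_weight_fourth:
  "Dirichlet_weight (\<lambda>_. 0) y * (half_square_sum y)\<^sup>2 =
    (\<Sum>l\<in>L. \<Sum>k\<in>L. (if k = l then 6 else 1) *
       Dirichlet_weight (\<lambda>j. (if j = l then 2 else 0) + (if j = k then 2 else 0)) y)"
proof (cases "\<forall>l\<in>L. 0 \<le> y l")
  case True
  have fourth: "(if k = l then 6 else 1) * (\<Prod>j\<in>L. power_over_fact ((if j = l then 2 else 0) + (if j = k then 2 else 0)) (y j)) =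
      (y l)\<^sup>2 / 2 * ((y k)\<^sup>2 / 2)" if "l \<in> L" "k \<in> L" for l k
  proof (cases "k = l")
    case True
    have "(\<Prod>j\<in>L. power_over_fact ((if j = l then 2 else 0) + (if j = l then 2 else 0)) (y j)) = (y l) ^ 4 / 24"
      unfolding power_over_fact_product(1)[OF L(1) \<open>\<forall>l\<in>L. 0 \<le> y l\<close>] using L(1) that
      by (subst prod.remove[of L l]) (auto intro!: prod.neutral simp: fact_numeral)
    then show ?thesis using True by (simp add: power2_eq_square power4_eq_xxxx)
  next
    case False
    have "(\<Prod>j\<in>L. power_over_fact ((if j = l then 2 else 0) + (if j = k then 2 else 0)) (y j)) = (y l)\<^sup>2 / 2 * ((y k)\<^sup>2 / 2)"
      unfolding power_over_fact_product(1)[OF L(1) \<open>\<forall>l\<in>L. 0 \<le> y l\<close>] using L(1) that False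
      by (subst prod.remove[of L l]; (subst prod.remove[of "L - {l}" k])?) (auto intro!: prod.neutral)
    then show ?thesis using False by simp
  qed
  have "(\<Sum>l\<in>L. \<Sum>k\<in>L. (if k = l then 6 else 1) *
      Dirichlet_weight (\<lambda>j. (if j = l then 2 else 0) + (if j = k then 2 else 0)) y) =
    (\<Sum>l\<in>L. \<Sum>k\<in>L. (y l)\<^sup>2 / 2 * ((y k)\<^sup>2 / 2) * exp (- (\<Sum>l\<in>L. y l)\<^sup>2 / 2))"
  proof (intro sum.cong refl)
    fix l k assume lk: "l \<in> L" "k \<in> L"
    show "(if k = l then 6 else 1) * Dirichlet_weight (\<lambda>j. (if j = l then 2 else 0) + (if j = k then 2 else 0)) y =
        (y l)\<^sup>2 / 2 * ((y k)\<^sup>2 / 2) * exp (- (\<Sum>l\<in>L. y l)\<^sup>2 / 2)"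
      unfolding Dirichlet_weight_def mult.assoc[symmetric] fourth[OF lk, symmetric] ..
  qed
  also have "\<dots> = (half_square_sum y)\<^sup>2 * exp (- (\<Sum>l\<in>L. y l)\<^sup>2 / 2)"
  proof -
    have "half_square_sum y = (\<Sum>l\<in>L. (y l)\<^sup>2 / 2)"
      by (simp only: half_square_sum_def sum_divide_distrib)
    then have "(half_square_sum y)\<^sup>2 = (\<Sum>l\<in>L. \<Sum>k\<in>L. (y l)\<^sup>2 / 2 * ((y k)\<^sup>2 / 2))"
      unfolding power2_eq_square[of "half_square_sum y"] by (simp only: sum_product)
    then show ?thesis by (simp only: sum_distrib_right)
  qed
  moreover have "(\<Prod>k\<in>L. power_over_fact 0 (y k)) = 1"
    unfolding power_over_fact_product(1)[OF L(1) True] by simp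
  ultimately show ?thesis
    by (simp add: Dirichlet_weight_def)
next
  case False
  then show ?thesis
    by (simp add: Dirichlet_weight_def power_over_fact_product(2)[OF L(1)])
qed

definition orthant_mass :: real where
  "orthant_mass = half_moment (card L - 1) / fact (card L - 1)"

lemma card_L: obtains p where "card L = Suc p"
  using L by (cases "card L") auto

lemma nn_integral_Dirichlet_weight_0:
  "(\<integral>\<^sup>+y. ennreal (Dirichlet_weight (\<lambda>_. 0) y) \<partial>lborel_Pi L) = ennreal orthant_mass"
  unfolding nn_integral_Dirichlet_weight by (simp add: orthant_mass_def)

text \<open>With m = card L, each of the m terms has its order raised by 2, which multiplies the
  moment by m and the factorial by m (m + 1). The mean of half the sum of squares is thus m / (m +
  1), which tends to 1.\<close>

lemma nn_integral_Dirichlet_weight_square: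
  "(\<integral>\<^sup>+y. ennreal (Dirichlet_weight (\<lambda>_. 0) y * half_square_sum y) \<partial>lborel_Pi L) =
    ennreal (orthant_mass * (real (card L) / (real (card L) + 1)))"
proof -
  obtain p where p: "card L = Suc p" by (rule card_L)
  have idx: "(\<Sum>k\<in>L. Suc (if k = l then 2 else 0)) - 1 = Suc (Suc p)" if "l \<in> L" for l
  proof -
    have "(\<Sum>k\<in>L. Suc (if k = l then 2 else 0)) = (\<Sum>k\<in>L. if k = l then 2 else 0) + (\<Sum>k\<in>L. 1)"
      by (simp only: Suc_eq_plus1 sum.distrib)
    then show ?thesis using L(1) that p by simp
  qed
  have "(\<integral>\<^sup>+y. ennreal (Dirichlet_weight (\<lambda>_. 0) y * half_square_sum y) \<partial>lborel_Pi L) =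
    (\<Sum>l\<in>L. \<integral>\<^sup>+y. ennreal (Dirichlet_weight (\<lambda>k. if k = l then 2 else 0) y) \<partial>lborel_Pi L)"
    unfolding Dirichlet_weight_square sum_ennreal[OF Dirichlet_weight_nonneg, symmetric]
    by (rule nn_integral_sum) measurable
  also have "\<dots> = (\<Sum>l\<in>L. ennreal (half_moment (Suc (Suc p)) / fact (Suc (Suc p))))"
    by (intro sum.cong refl) (simp only: nn_integral_Dirichlet_weight idx)
  also have "\<dots> = ennreal (real (Suc p) * (half_moment (Suc (Suc p)) / fact (Suc (Suc p))))"
    using half_moment_pos[of "Suc (Suc p)"]
    by (simp only: sum_constant p ennreal_of_nat_eq_real_of_nat) (subst ennreal_mult, auto)
  also have "real (Suc p) * (half_moment (Suc (Suc p)) / fact (Suc (Suc p))) =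
    orthant_mass * (real (card L) / (real (card L) + 1))"
  proof -
    have alg: "m * ((m * M) / ((m + 1) * (m * F))) = M / F * (m / (m + 1))" if "m > 0" for m M F :: real
    proof -
      have "(m * M) / ((m + 1) * (m * F)) = (m * M) / (m * ((m + 1) * F))" by (simp only: mult_ac)
      also have "\<dots> = M / ((m + 1) * F)" using that by (intro mult_divide_mult_cancel_left) auto
      finally have *: "(m * M) / ((m + 1) * (m * F)) = M / ((m + 1) * F)" .
      show ?thesis unfolding * by (simp only: divide_inverse inverse_mult_distrib mult_ac)
    qed
    have hm: "half_moment (Suc (Suc p)) = real (Suc p) * half_moment p"
      by (rule half_moment_Suc_Suc)
    have fc: "fact (Suc (Suc p)) = (real (Suc p) + 1) * (real (Suc p) * fact p)"
      by (simp add: algebra_simps)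
    show ?thesis
      unfolding hm fc p orthant_mass_def diff_Suc_1 by (rule alg) simp
  qed
  finally show ?thesis .
qed

text \<open>The order rises by 4, multiplying the moment by m (m + 2) and the factorial by m (m + 1)
  (m + 2) (m + 3). The second moment tends to 1 as well, so the variance tends to 0.\<close>

lemma nn_integral_Dirichlet_weight_fourth:
  "(\<integral>\<^sup>+y. ennreal (Dirichlet_weight (\<lambda>_. 0) y * (half_square_sum y)\<^sup>2) \<partial>lborel_Pi L) =
    ennreal (orthant_mass * (real (card L) * (real (card L) + 5) / ((real (card L) + 1) * (real (card L) + 3))))"
proof -
  obtain p where p: "card L = Suc p" by (rule card_L)
  let ?q = "Suc (Suc (Suc (Suc p)))"
  let ?c = "\<lambda>l k. if k = l then 6 else 1 :: real"
  let ?a = "\<lambda>l k j. (if j = l then 2 else 0) + (if j = k then 2 else 0 :: nat)"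
  have idx: "(\<Sum>j\<in>L. Suc (?a l k j)) - 1 = ?q" if "l \<in> L" "k \<in> L" for l k
  proof -
    have "(\<Sum>j\<in>L. Suc (?a l k j)) = (\<Sum>j\<in>L. if j = l then 2 else 0) + (\<Sum>j\<in>L. if j = k then 2 else 0) + (\<Sum>j\<in>L. 1)"
      by (simp only: Suc_eq_plus1 sum.distrib)
    then show ?thesis using L(1) that p by simp
  qed
  have "(\<integral>\<^sup>+y. ennreal (Dirichlet_weight (\<lambda>_. 0) y * (half_square_sum y)\<^sup>2) \<partial>lborel_Pi L) =
    (\<integral>\<^sup>+y. (\<Sum>l\<in>L. \<Sum>k\<in>L. ennreal (?c l k) * ennreal (Dirichlet_weight (?a l k) y)) \<partial>lborel_Pi L)"
  proof (rule nn_integral_cong)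
    fix y
    show "ennreal (Dirichlet_weight (\<lambda>_. 0) y * (half_square_sum y)\<^sup>2) =
      (\<Sum>l\<in>L. \<Sum>k\<in>L. ennreal (?c l k) * ennreal (Dirichlet_weight (?a l k) y))"
    proof -
      have 1: "0 \<le> ?c l k * Dirichlet_weight (?a l k) y" for l k
        by (simp add: Dirichlet_weight_nonneg)
      have "ennreal (?c l k * Dirichlet_weight (?a l k) y) = ennreal (?c l k) * ennreal (Dirichlet_weight (?a l k) y)" for l k
        by (rule ennreal_mult) (simp_all add: Dirichlet_weight_nonneg)
      then show ?thesis
        unfolding Dirichlet_weight_fourth sum_ennreal[OF sum_nonneg[OF 1], symmetric] sum_ennreal[OF 1, symmetric] by simp
    qed
  qed
  also have "\<dots> = (\<Sum>l\<in>L. \<Sum>k\<in>L. \<integral>\<^sup>+y. ennreal (?c l k) * ennreal (Dirichlet_weight (?a l k) y) \<partial>lborel_Pi L)"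
  proof -
    have m: "(\<lambda>y. ennreal (?c l k) * ennreal (Dirichlet_weight (?a l k) y)) \<in> borel_measurable (lborel_Pi L)" for l k
      by measurable
    show ?thesis
      by (subst nn_integral_sum) (auto intro!: m borel_measurable_sum nn_integral_sum sum.cong)
  qed
  also have "\<dots> = (\<Sum>l\<in>L. \<Sum>k\<in>L. ennreal (?c l k) * ennreal (half_moment ?q / fact ?q))"
  proof (intro sum.cong refl)
    fix l k assume lk: "l \<in> L" "k \<in> L"
    have "(\<integral>\<^sup>+y. ennreal (?c l k) * ennreal (Dirichlet_weight (?a l k) y) \<partial>lborel_Pi L) =
      ennreal (?c l k) * (\<integral>\<^sup>+y. ennreal (Dirichlet_weight (?a l k) y) \<partial>lborel_Pi L)"
      by (rule nn_integral_cmult) measurable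
    then show "(\<integral>\<^sup>+y. ennreal (?c l k) * ennreal (Dirichlet_weight (?a l k) y) \<partial>lborel_Pi L) =
      ennreal (?c l k) * ennreal (half_moment ?q / fact ?q)"
      by (simp only: nn_integral_Dirichlet_weight idx[OF lk])
  qed
  also have "\<dots> = ennreal (\<Sum>l\<in>L. \<Sum>k\<in>L. ?c l k * (half_moment ?q / fact ?q))"
  proof -
    have 1: "0 \<le> ?c l k * (half_moment ?q / fact ?q)" for l k :: 'i
      using half_moment_pos[of ?q] by simp
    have "ennreal (?c l k * (half_moment ?q / fact ?q)) = ennreal (?c l k) * ennreal (half_moment ?q / fact ?q)" for l k :: 'i
      using half_moment_pos[of ?q] by (intro ennreal_mult) simp_all
    then show ?thesis
      unfolding sum_ennreal[OF sum_nonneg[OF 1], symmetric] sum_ennreal[OF 1, symmetric] by simp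
  qed
  also have "(\<Sum>l\<in>L. \<Sum>k\<in>L. ?c l k * (half_moment ?q / fact ?q)) =
    real (Suc p) * (real (Suc p) + 5) * (half_moment ?q / fact ?q)"
  proof -
    have "(\<Sum>k\<in>L. ?c l k) = real (Suc p) + 5" if "l \<in> L" for l
    proof -
      \<comment> \<open>Each \<open>l\<close> contributes 6 from the diagonal and 1 from each of the
        m - 1 other indices, together m + 5.\<close>
      have "(\<Sum>k\<in>L. ?c l k) = (\<Sum>k\<in>L. 1 + (if k = l then 5 else 0))"
        by (intro sum.cong) auto
      then show ?thesis using L(1) that by (simp add: sum.distrib p)
    qed
    then have "(\<Sum>l\<in>L. \<Sum>k\<in>L. ?c l k) = (\<Sum>l\<in>L. real (Suc p) + 5)"
      by (intro sum.cong refl)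
    also have "\<dots> = real (Suc p) * (real (Suc p) + 5)"
      by (simp only: sum_constant p)
    finally show ?thesis
      by (simp only: sum_distrib_right[symmetric])
  qed
  also have "\<dots> = orthant_mass * (real (card L) * (real (card L) + 5) / ((real (card L) + 1) * (real (card L) + 3)))"
  proof -
    have alg: "m * (m + 5) * (((m + 2) * (m * M)) / ((m + 3) * ((m + 2) * ((m + 1) * (m * F))))) =
      M / F * (m * (m + 5) / ((m + 1) * (m + 3)))" if "F > 0" "m > 0" for m M F :: real
    proof -
      have "((m + 2) * (m * M)) / ((m + 3) * ((m + 2) * ((m + 1) * (m * F)))) = ((m + 2) * m * M) / ((m + 2) * m * ((m + 1) * (m + 3) * F))"
        by (simp add: mult_ac)
      also have "\<dots> = M / ((m + 1) * (m + 3) * F)"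
        using that by (intro mult_divide_mult_cancel_left) auto
      finally have *: "((m + 2) * (m * M)) / ((m + 3) * ((m + 2) * ((m + 1) * (m * F)))) = M / ((m + 1) * (m + 3) * F)" .
      show ?thesis unfolding * by (simp only: divide_inverse inverse_mult_distrib mult_ac)
    qed
    have hm: "half_moment ?q = (real (Suc p) + 2) * (real (Suc p) * half_moment p)"
      by (simp add: half_moment_Suc_Suc algebra_simps)
    have fc: "fact ?q = (real (Suc p) + 3) * ((real (Suc p) + 2) * ((real (Suc p) + 1) * (real (Suc p) * fact p)))"
      by (simp add: algebra_simps)
    show ?thesis
      unfolding hm fc p orthant_mass_def diff_Suc_1 by (rule alg) simp_all
  qed
  finally show ?thesis .
qed

text \<open>The factor exp (- q / 2) is enclosed between the two polynomials of
  \<open>exp_minus_bounds\<close>, and these are integrated by the moments of order 0, 1 and 2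
  computed above.\<close>

lemma nn_integral_orthant_bounds:
  obtains r where
    "(\<integral>\<^sup>+y. indicator {y. \<forall>l\<in>L. 0 \<le> y l} y * ennreal (exp (- ((\<Sum>l\<in>L. y l)\<^sup>2 + (\<Sum>l\<in>L. (y l)\<^sup>2)) / 2)) \<partial>lborel_Pi L) = ennreal r"
    and "orthant_mass * exp (- 1) * (2 - real (card L) / (real (card L) + 1)) \<le> r"
    and "r \<le> orthant_mass * exp (- 1) * (3 - 3 * (real (card L) / (real (card L) + 1)) +
      real (card L) * (real (card L) + 5) / ((real (card L) + 1) * (real (card L) + 3)))"
    and "r \<ge> 0"
proof -
  let ?w = "Dirichlet_weight (\<lambda>_. 0)" and ?q = "half_square_sum"
  let ?a = "real (card L) / (real (card L) + 1)"
  let ?b = "real (card L) * (real (card L) + 5) / ((real (card L) + 1) * (real (card L) + 3))"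
  have Z: "orthant_mass \<ge> 0" using half_moment_pos[of "card L - 1"] by (simp add: orthant_mass_def)
  have q0: "?q y \<ge> 0" for y by (simp add: half_square_sum_def sum_nonneg)
  have qm [measurable]: "half_square_sum \<in> borel_measurable (borel_Pi L)"
    unfolding half_square_sum_def[abs_def] by measurable
  define V where "V = (\<integral>\<^sup>+y. ennreal (?w y * exp (- ?q y)) \<partial>lborel_Pi L)"
  have eq: "(\<integral>\<^sup>+y. indicator {y. \<forall>l\<in>L. 0 \<le> y l} y * ennreal (exp (- ((\<Sum>l\<in>L. y l)\<^sup>2 + (\<Sum>l\<in>L. (y l)\<^sup>2)) / 2)) \<partial>lborel_Pi L) = V"
    unfolding V_def
  proof (rule nn_integral_cong)
    fix y :: "'i \<Rightarrow> real"
    have "exp (- ((\<Sum>l\<in>L. y l)\<^sup>2 + (\<Sum>l\<in>L. (y l)\<^sup>2)) / 2) = exp (- (\<Sum>l\<in>L. y l)\<^sup>2 / 2) * exp (- ?q y)"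
      unfolding exp_add[symmetric] half_square_sum_def by (simp add: field_simps)
    moreover have "(\<Prod>l\<in>L. power_over_fact 0 (y l)) = indicator {y. \<forall>l\<in>L. 0 \<le> y l} y"
      using power_over_fact_product[OF L(1), of y "\<lambda>_. 0"] by (auto simp: indicator_def)
    ultimately show "indicator {y. \<forall>l\<in>L. 0 \<le> y l} y * ennreal (exp (- ((\<Sum>l\<in>L. y l)\<^sup>2 + (\<Sum>l\<in>L. (y l)\<^sup>2)) / 2)) =
      ennreal (?w y * exp (- ?q y))"
      by (simp add: Dirichlet_weight_def indicator_def)
  qed
  \<comment> \<open>The integrals take values in the extended nonnegative reals, so the negative
    terms of the polynomial bounds are moved to the other side, here and in \<open>high\<close>;
    subtraction is done only after passing to reals.\<close>
  have low: "ennreal (2 * exp (- 1)) * ennreal orthant_mass \<le> V + ennreal (exp (- 1)) * ennreal (orthant_mass * ?a)"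
  proof -
    have "ennreal (2 * exp (- 1)) * ennreal orthant_mass = (\<integral>\<^sup>+y. ennreal (2 * exp (- 1)) * ennreal (?w y) \<partial>lborel_Pi L)"
      unfolding nn_integral_Dirichlet_weight_0[symmetric] by (rule nn_integral_cmult[symmetric]) measurable
    also have "\<dots> \<le> (\<integral>\<^sup>+y. ennreal (?w y * exp (- ?q y)) + ennreal (exp (- 1)) * ennreal (?w y * ?q y) \<partial>lborel_Pi L)"
    proof (rule nn_integral_mono)
      fix y
      have "?w y * (exp (- 1) * (2 - ?q y)) \<le> ?w y * exp (- ?q y)"
        by (intro mult_left_mono exp_minus_bounds(1) q0 Dirichlet_weight_nonneg)
      then have "2 * exp (- 1) * ?w y \<le> ?w y * exp (- ?q y) + exp (- 1) * (?w y * ?q y)"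
        by (simp add: algebra_simps)
      then show "ennreal (2 * exp (- 1)) * ennreal (?w y) \<le> ennreal (?w y * exp (- ?q y)) + ennreal (exp (- 1)) * ennreal (?w y * ?q y)"
        by (simp add: ennreal_mult[symmetric] ennreal_plus[symmetric] Dirichlet_weight_nonneg q0 ennreal_leI del: ennreal_plus)
    qed
    also have "\<dots> = V + (\<integral>\<^sup>+y. ennreal (exp (- 1)) * ennreal (?w y * ?q y) \<partial>lborel_Pi L)"
      unfolding V_def by (rule nn_integral_add) measurable
    also have "(\<integral>\<^sup>+y. ennreal (exp (- 1)) * ennreal (?w y * ?q y) \<partial>lborel_Pi L) = ennreal (exp (- 1)) * ennreal (orthant_mass * ?a)"
      unfolding nn_integral_Dirichlet_weight_square[symmetric] by (rule nn_integral_cmult) measurable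
    finally show ?thesis .
  qed
  have high: "V + ennreal (3 * exp (- 1)) * ennreal (orthant_mass * ?a) \<le>
    ennreal (3 * exp (- 1)) * ennreal orthant_mass + ennreal (exp (- 1)) * ennreal (orthant_mass * ?b)"
  proof -
    have "V + ennreal (3 * exp (- 1)) * ennreal (orthant_mass * ?a) =
      V + (\<integral>\<^sup>+y. ennreal (3 * exp (- 1)) * ennreal (?w y * ?q y) \<partial>lborel_Pi L)"
      unfolding nn_integral_Dirichlet_weight_square[symmetric]
      by (intro arg_cong2[where f = "(+)"] refl nn_integral_cmult[symmetric]) measurable
    also have "\<dots> = (\<integral>\<^sup>+y. ennreal (?w y * exp (- ?q y)) + ennreal (3 * exp (- 1)) * ennreal (?w y * ?q y) \<partial>lborel_Pi L)"
      unfolding V_def by (rule nn_integral_add[symmetric]) measurable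
    also have "\<dots> \<le> (\<integral>\<^sup>+y. ennreal (3 * exp (- 1)) * ennreal (?w y) + ennreal (exp (- 1)) * ennreal (?w y * (?q y)\<^sup>2) \<partial>lborel_Pi L)"
    proof (rule nn_integral_mono)
      fix y
      have "?w y * exp (- ?q y) \<le> ?w y * (exp (- 1) * (3 - 3 * ?q y + (?q y)\<^sup>2))"
        by (intro mult_left_mono exp_minus_bounds(2) q0 Dirichlet_weight_nonneg)
      then have "?w y * exp (- ?q y) + 3 * exp (- 1) * (?w y * ?q y) \<le> 3 * exp (- 1) * ?w y + exp (- 1) * (?w y * (?q y)\<^sup>2)"
        by (simp add: algebra_simps)
      then show "ennreal (?w y * exp (- ?q y)) + ennreal (3 * exp (- 1)) * ennreal (?w y * ?q y) \<le>
        ennreal (3 * exp (- 1)) * ennreal (?w y) + ennreal (exp (- 1)) * ennreal (?w y * (?q y)\<^sup>2)"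
        by (simp add: ennreal_mult[symmetric] ennreal_plus[symmetric] Dirichlet_weight_nonneg q0 ennreal_leI del: ennreal_plus)
    qed
    also have "\<dots> = (\<integral>\<^sup>+y. ennreal (3 * exp (- 1)) * ennreal (?w y) \<partial>lborel_Pi L) +
      (\<integral>\<^sup>+y. ennreal (exp (- 1)) * ennreal (?w y * (?q y)\<^sup>2) \<partial>lborel_Pi L)"
      by (rule nn_integral_add) measurable
    also have "\<dots> = ennreal (3 * exp (- 1)) * ennreal orthant_mass + ennreal (exp (- 1)) * ennreal (orthant_mass * ?b)"
      unfolding nn_integral_Dirichlet_weight_0[symmetric] nn_integral_Dirichlet_weight_fourth[symmetric]
      by (intro arg_cong2[where f = "(+)"] nn_integral_cmult) measurable
    finally show ?thesis .
  qed
  \<comment> \<open>Finiteness comes from the upper bound, whose right side consists of finite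
    moments.\<close>
  have "V < \<infinity>"
  proof -
    have "V \<le> V + ennreal (3 * exp (- 1)) * ennreal (orthant_mass * ?a)" by simp
    also note high
    also have "ennreal (3 * exp (- 1)) * ennreal orthant_mass + ennreal (exp (- 1)) * ennreal (orthant_mass * ?b) < \<infinity>"
      by (simp add: ennreal_mult_less_top)
    finally show ?thesis .
  qed
  then obtain r where r: "V = ennreal r" "r \<ge> 0" by (cases V) auto
  have ab: "?a \<ge> 0" "?b \<ge> 0" by simp_all
  have "2 * exp (- 1) * orthant_mass \<le> r + exp (- 1) * (orthant_mass * ?a)"
    using low r(2) Z ab
    by (simp add: r(1) ennreal_mult[symmetric] ennreal_plus[symmetric] ennreal_le_iff del: ennreal_plus times_divide_eq_right)
  then have 1: "orthant_mass * exp (- 1) * (2 - ?a) \<le> r"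
    by (simp add: algebra_simps)
  have "r + 3 * exp (- 1) * (orthant_mass * ?a) \<le> 3 * exp (- 1) * orthant_mass + exp (- 1) * (orthant_mass * ?b)"
    using high r(2) Z ab
    by (simp add: r(1) ennreal_mult[symmetric] ennreal_plus[symmetric] ennreal_le_iff del: ennreal_plus times_divide_eq_right)
  then have 2: "r \<le> orthant_mass * exp (- 1) * (3 - 3 * ?a + ?b)"
    by (simp add: algebra_simps)
  show ?thesis
    by (rule that[OF _ 1 2 r(2)]) (simp only: eq r(1))
qed

end

section \<open>Asymptotics\<close>

text \<open>\<open>r\<close> is the orthant integral in dimension d + 1, so the number called
  \<open>n\<close> before is d + 2; the prefactor stems from integrating out the mean.\<close>

lemma prob_center_le_0:
  assumes i: "i < d + 2"
  defines "L \<equiv> {..<d + 2} - {i}"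
  shows "\<exists>r. \<P>(z in iid_normal {..<d + 2}. \<forall>l\<in>L. center d z l \<le> 0) =
      sqrt (real d + 2) * (1 / sqrt (2 * pi)) ^ (d + 1) * r \<and>
    half_moment d / fact d * exp (- 1) * (2 - (real d + 1) / (real d + 2)) \<le> r \<and>
    r \<le> half_moment d / fact d * exp (- 1) * (3 - 3 * ((real d + 1) / (real d + 2)) +
      (real d + 1) * (real d + 6) / ((real d + 2) * (real d + 4)))"
proof -
  let ?N = "{..<d + 2}"
  have L: "finite L" "i \<notin> L" "insert i L = ?N" using i by (auto simp: L_def)
  have cL: "card L = d + 1" using i by (simp add: L_def card_Diff_singleton)
  then have Ln: "L \<noteq> {}" by auto
  have n: "real (card L) + 1 = real d + 2" by (simp add: cL)
  obtain r where r: "(\<integral>\<^sup>+y. indicator {y. \<forall>l\<in>L. 0 \<le> y l} y *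
      ennreal (exp (- ((\<Sum>l\<in>L. y l)\<^sup>2 + (\<Sum>l\<in>L. (y l)\<^sup>2)) / 2)) \<partial>lborel_Pi L) = ennreal r"
    and lo: "orthant_mass L * exp (- 1) * (2 - real (card L) / (real (card L) + 1)) \<le> r"
    and hi: "r \<le> orthant_mass L * exp (- 1) * (3 - 3 * (real (card L) / (real (card L) + 1)) +
      real (card L) * (real (card L) + 5) / ((real (card L) + 1) * (real (card L) + 3)))"
    and r0: "r \<ge> 0"
    by (rule nn_integral_orthant_bounds[OF L(1) Ln])
  have mass: "orthant_mass L = half_moment d / fact d"
    by (simp add: orthant_mass_def[OF L(1) Ln] cL)
  have card: "real (card L) = real d + 1" "real d + 1 + 1 = real d + 2" "real d + 1 + 5 = real d + 6" "real d + 1 + 3 = real d + 4"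
    by (simp_all add: cL)
  have iff: "(\<forall>l\<in>L. center d z l \<le> 0) \<longleftrightarrow> (\<forall>l\<in>L. z l \<le> (\<Sum>k\<in>insert i L. z k) / (real (card L) + 1))" for z
    unfolding L(3) n by (simp add: center_def)
  define S where "S = {z. \<forall>l\<in>L. z l \<le> (\<Sum>k\<in>insert i L. z k) / (real (card L) + 1)}"
  have clS: "closed S"
  proof -
    have "S = {z. center d z \<in> (\<Inter>l\<in>L. {v. v l \<le> 0})}" using iff by (auto simp: S_def)
    moreover have "closed (\<Inter>l\<in>L. {v :: nat \<Rightarrow> real. v l \<le> 0})"
      by (intro closed_INT ballI closed_Collect_le continuous_on_const) simp
    ultimately show ?thesis by (simp only: closed_center_vimage)
  qed
  have m: "{z \<in> space (iid_normal ?N). z \<in> S} \<in> sets (iid_normal ?N)"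
    using pred_PiM_closed[OF clS, of ?N] by (intro predE) (simp add: measurable_iid_normal1)
  have "emeasure (iid_normal ?N) {z \<in> space (iid_normal ?N). z \<in> S} = (\<integral>\<^sup>+z. indicator {z \<in> space (iid_normal ?N). z \<in> S} z \<partial>iid_normal ?N)"
    by (rule nn_integral_indicator[OF m, symmetric])
  also have "\<dots> = (\<integral>\<^sup>+z. indicator S z \<partial>iid_normal (insert i L))"
    unfolding L(3) by (intro nn_integral_cong) (auto simp: indicator_def)
  also have "\<dots> = ennreal (sqrt (real (card L) + 1) * (1 / sqrt (2 * pi)) ^ card L) * ennreal r"
    unfolding S_def r[symmetric] by (rule nn_integral_iid_normal_all_below_mean[OF L(1,2)])
  also have "\<dots> = ennreal (sqrt (real d + 2) * (1 / sqrt (2 * pi)) ^ (d + 1) * r)"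
    unfolding n unfolding cL using r0 by (intro ennreal_mult[symmetric]) auto
  finally have "\<P>(z in iid_normal ?N. z \<in> S) = sqrt (real d + 2) * (1 / sqrt (2 * pi)) ^ (d + 1) * r"
    using r0 by (simp add: measure_def)
  then have "\<P>(z in iid_normal ?N. \<forall>l\<in>L. center d z l \<le> 0) = sqrt (real d + 2) * (1 / sqrt (2 * pi)) ^ (d + 1) * r"
    by (simp only: S_def iff mem_Collect_eq)
  then show ?thesis
    using lo hi unfolding mass card by blast
qed

lemma sum_center: "(\<Sum>i<d + 2. center d z i) = 0"
  by (simp add: center_def sum_subtractf)

text \<open>The centred coordinates sum to zero, so if all others have one weak sign, coordinate
  \<open>i\<close> automatically has the opposite one. The two cases are exchanged by z \<mapsto> -z
  and overlap in a null set.\<close>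

lemma prob_center_sign_cone:
  assumes i: "i < d + 2"
  defines "L \<equiv> {..<d + 2} - {i}"
  shows "\<P>(z in iid_normal {..<d + 2}. center d z \<in> sign_cone {i} L) =
    2 * \<P>(z in iid_normal {..<d + 2}. \<forall>l\<in>L. center d z l \<le> 0)"
proof -
  let ?N = "{..<d + 2}" and ?M = "iid_normal {..<d + 2}"
  have L: "finite L" "i \<notin> L" "insert i L = ?N" using i by (auto simp: L_def)
  have "card L = d + 1" using i by (simp add: L_def card_Diff_singleton)
  then obtain l where l: "l \<in> L" by fastforce
  have ci: "center d z i = - (\<Sum>l\<in>L. center d z l)" for z
    using sum_center[of d z] L unfolding L(3)[symmetric] by simp
  have iff: "center d z \<in> sign_cone {i} L \<longleftrightarrow> (\<forall>l\<in>L. center d z l \<le> 0) \<or> (\<forall>l\<in>L. center d z l \<ge> 0)" for z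
    using ci[of z] sum_nonneg[of L "center d z"] sum_nonpos[of L "center d z"] by (auto simp: sign_cone_def)
  define S T where "S = {z. center d z \<in> (\<Inter>l\<in>L. {v. v l \<le> 0})}" and "T = {z. center d z \<in> (\<Inter>l\<in>L. {v. 0 \<le> v l})}"
  have cl: "closed S" "closed T"
    unfolding S_def T_def by (intro closed_center_vimage closed_INT ballI closed_Collect_le continuous_on_const; simp)+
  have m: "{z \<in> space ?M. z \<in> X} \<in> sets ?M" if "closed X" for X
    using pred_PiM_closed[OF that, of ?N] by (intro predE) (simp add: measurable_iid_normal1)
  have em: "emeasure ?M {z \<in> space ?M. z \<in> X} = (\<integral>\<^sup>+z. indicator X z \<partial>?M)" if "closed X" for X
  proof -
    have "emeasure ?M {z \<in> space ?M. z \<in> X} = (\<integral>\<^sup>+z. indicator {z \<in> space ?M. z \<in> X} z \<partial>?M)"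
      by (rule nn_integral_indicator[OF m[OF that], symmetric])
    also have "\<dots> = (\<integral>\<^sup>+z. indicator X z \<partial>?M)"
      by (intro nn_integral_cong) (auto simp: indicator_def)
    finally show ?thesis .
  qed
  have refl: "center d (\<lambda>k\<in>?N. - z k) l = - center d z l" if "l \<in> L" for z l
    using that by (simp add: center_def L_def sum_negf)
  have "(\<integral>\<^sup>+z. indicator T z \<partial>?M) = (\<integral>\<^sup>+z. indicator T (\<lambda>k\<in>?N. - z k) \<partial>?M)"
    using cl by (intro nn_integral_iid_normal_reflect[symmetric] measurable_indicator_closed) auto
  also have "\<dots> = (\<integral>\<^sup>+z. indicator S z \<partial>?M)"
    by (intro nn_integral_cong) (simp add: S_def T_def indicator_def refl)
  finally have ST: "\<P>(z in ?M. z \<in> T) = \<P>(z in ?M. z \<in> S)"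
    unfolding measure_def em[OF cl(1)] em[OF cl(2)] by simp
  have "AE z in ?M. z \<notin> {z \<in> space ?M. z \<in> S} \<inter> {z \<in> space ?M. z \<in> T}"
    using AE_center_nonzero[of d]
  proof eventually_elim
    case (elim z)
    have "l < d + 2" using l by (auto simp: L_def)
    then have "center d z l \<noteq> 0" using elim by blast
    then show ?case using l by (force simp: S_def T_def)
  qed
  then have "{z \<in> space ?M. z \<in> S} \<inter> {z \<in> space ?M. z \<in> T} \<in> null_sets ?M"
    using AE_iff_null_sets[OF sets.Int[OF m[OF cl(1)] m[OF cl(2)]]] by blast
  then have null: "measure ?M ({z \<in> space ?M. z \<in> S} \<inter> {z \<in> space ?M. z \<in> T}) = 0"
    by (rule measure_eq_0_null_sets)
  have "{z \<in> space ?M. center d z \<in> sign_cone {i} L} = {z \<in> space ?M. z \<in> S} \<union> {z \<in> space ?M. z \<in> T}"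
    using iff by (auto simp: S_def T_def)
  then have "\<P>(z in ?M. center d z \<in> sign_cone {i} L) = \<P>(z in ?M. z \<in> S) + \<P>(z in ?M. z \<in> T)"
    using null m[OF cl(1)] m[OF cl(2)] measure_Un3[of "{z \<in> space ?M. z \<in> S}" ?M "{z \<in> space ?M. z \<in> T}"]
    by (simp add: fmeasurable_def less_top[symmetric] iid_normal.emeasure_eq_measure)
  then show ?thesis unfolding ST by (simp add: S_def)
qed

text \<open>The events for different \<open>i\<close> overlap in null sets, since their partitions
  are different even up to swapping.\<close>

lemma prob_not_convex_position_eq_sum:
  assumes d: "d \<ge> 1"
  shows "1 - \<P>(p in gaussian_points d. convex_position {..<d + 2} p) =
    (\<Sum>i<d + 2. 2 * \<P>(z in iid_normal {..<d + 2}. \<forall>l\<in>{..<d + 2} - {i}. center d z l \<le> 0))"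
proof -
  let ?N = "{..<d + 2}" and ?M = "iid_normal {..<d + 2}"
  define F where "F i = {z \<in> space ?M. center d z \<in> sign_cone {i} (?N - {i})}" for i
  have F: "F i \<in> sets ?M" if "i \<in> ?N" for i
    unfolding F_def using that by (intro predE pred_center cone_on_sign_cone) auto
  have dis: "AE z in ?M. z \<notin> F i \<or> z \<notin> F j" if ij: "i \<in> ?N" "j \<in> ?N" "i \<noteq> j" for i j
    using AE_center_nonzero[of d]
  proof eventually_elim
    case (elim z)
    show ?case
    proof (rule ccontr)
      assume "\<not> (z \<notin> F i \<or> z \<notin> F j)"
      then have *: "center d z \<in> sign_cone {i} (?N - {i})" "center d z \<in> sign_cone {j} (?N - {j})"
        by (auto simp: F_def)
      have "card (?N - {i}) = d + 1" using ij by (simp add: card_Diff_singleton)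
      \<comment> \<open>Here \<open>d \<ge> 1\<close> is essential: in dimension 0 the complement of
        one index is the other one, and both indices give the same event.\<close>
      then have "{j} \<noteq> ?N - {i}" using d by (metis card_1_singleton_iff One_nat_def add_is_1 not_one_le_zero)
      then have "\<exists>l\<in>?N. center d z l = 0"
        using ij by (intro sign_cone_zero[OF _ _ _ _ _ _ *]) auto
      with elim show False by blast
    qed
  qed
  have "1 - \<P>(p in gaussian_points d. convex_position ?N p) = measure ?M (\<Union>i\<in>?N. F i)"
    unfolding prob_not_convex_position by (rule arg_cong[where f = "measure _"]) (auto simp: F_def)
  also have "\<dots> = (\<Sum>i\<in>?N. measure ?M (F i))"
    using F dis by (intro measure_UNION_AE) (auto simp: fmeasurable_def less_top[symmetric] iid_normal.emeasure_eq_measure pairwise_def)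
  also have "\<dots> = (\<Sum>i\<in>?N. 2 * \<P>(z in ?M. \<forall>l\<in>?N - {i}. center d z l \<le> 0))"
    unfolding F_def by (intro sum.cong refl prob_center_sign_cone) auto
  finally show ?thesis .
qed

text \<open>With n = d + 2: the factor 2 n counts the exceptional point and its sign, sqrt n and the
  power of 2 pi come from integrating out the mean, \<open>half_moment d / fact d\<close> is the
  mass of the orthant without the sum of squares, and exp (- 1) is the limit of the neglected
  factor.\<close>

definition leading_term :: "nat \<Rightarrow> real" where
  "leading_term d = 2 * (real d + 2) * sqrt (real d + 2) * (1 / sqrt (2 * pi)) ^ (d + 1) *
     (half_moment d / fact d) * exp (- 1)"

lemma leading_term_pos: "leading_term d > 0"
  using half_moment_pos[of d] by (simp add: leading_term_def)

lemma prob_not_convex_position_bounds: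
  assumes d: "d \<ge> 1"
  shows "leading_term d * (2 - (real d + 1) / (real d + 2)) \<le> 1 - \<P>(p in gaussian_points d. convex_position {..<d + 2} p)"
    and "1 - \<P>(p in gaussian_points d. convex_position {..<d + 2} p) \<le> leading_term d *
      (3 - 3 * ((real d + 1) / (real d + 2)) + (real d + 1) * (real d + 6) / ((real d + 2) * (real d + 4)))"
proof -
  let ?Q = "\<lambda>i. 2 * \<P>(z in iid_normal {..<d + 2}. \<forall>l\<in>{..<d + 2} - {i}. center d z l \<le> 0)"
  let ?lo = "2 - (real d + 1) / (real d + 2)"
  let ?hi = "3 - 3 * ((real d + 1) / (real d + 2)) + (real d + 1) * (real d + 6) / ((real d + 2) * (real d + 4))"
  define c where "c = sqrt (real d + 2) * (1 / sqrt (2 * pi)) ^ (d + 1)"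
  define Z where "Z = half_moment d / fact d * exp (- 1)"
  have c: "c \<ge> 0" by (simp add: c_def)
  have Q: "2 * (c * (Z * ?lo)) \<le> ?Q i \<and> ?Q i \<le> 2 * (c * (Z * ?hi))" if "i \<in> {..<d + 2}" for i
  proof -
    have "i < d + 2" using that by simp
    from prob_center_le_0[OF this] obtain r where r:
      "\<P>(z in iid_normal {..<d + 2}. \<forall>l\<in>{..<d + 2} - {i}. center d z l \<le> 0) = c * r" "Z * ?lo \<le> r" "r \<le> Z * ?hi"
      unfolding c_def Z_def by blast
    show ?thesis unfolding r(1) using r(2,3) c by (auto intro!: mult_left_mono)
  qed
  have lead: "leading_term d * x = (\<Sum>i<d + 2. 2 * (c * (Z * x)))" for x
  proof -
    have "(\<Sum>i<d + 2. 2 * (c * (Z * x))) = (real d + 2) * (2 * (c * (Z * x)))"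
      by (simp only: sum_constant card_lessThan of_nat_add of_nat_numeral)
    then show ?thesis by (simp only: leading_term_def c_def Z_def mult_ac)
  qed
  show "leading_term d * ?lo \<le> 1 - \<P>(p in gaussian_points d. convex_position {..<d + 2} p)"
    "1 - \<P>(p in gaussian_points d. convex_position {..<d + 2} p) \<le> leading_term d * ?hi"
    unfolding prob_not_convex_position_eq_sum[OF d] lead by (rule sum_mono; use Q in blast)+
qed

lemma prob_not_convex_position_asymp:
  "(\<lambda>d. 1 - \<P>(p in gaussian_points d. convex_position {..<d + 2} p)) \<sim>[sequentially] leading_term"
proof (rule asymp_equivI')
  let ?lo = "\<lambda>d. 2 - (real d + 1) / (real d + 2)"
  let ?hi = "\<lambda>d. 3 - 3 * ((real d + 1) / (real d + 2)) + (real d + 1) * (real d + 6) / ((real d + 2) * (real d + 4))"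
  let ?P = "\<lambda>d. 1 - \<P>(p in gaussian_points d. convex_position {..<d + 2} p)"
  show "(\<lambda>d. ?P d / leading_term d) \<longlonglongrightarrow> 1"
  proof (rule tendsto_sandwich)
    show "eventually (\<lambda>d. ?lo d \<le> ?P d / leading_term d) sequentially"
      using eventually_ge_at_top[of 1]
    proof eventually_elim
      case (elim d)
      then show ?case
        using prob_not_convex_position_bounds(1)[OF elim] leading_term_pos[of d]
        by (simp only: pos_le_divide_eq) (simp only: mult.commute)
    qed
    show "eventually (\<lambda>d. ?P d / leading_term d \<le> ?hi d) sequentially"
      using eventually_ge_at_top[of 1]
    proof eventually_elim
      case (elim d)
      then show ?case
        using prob_not_convex_position_bounds(2)[OF elim] leading_term_pos[of d]
        by (simp only: pos_divide_le_eq) (simp only: mult.commute)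
    qed
    \<comment> \<open>Both moments tend to 1, so the bounds tend to 2 - 1 and 3 - 3 + 1.\<close>
    show "?lo \<longlonglongrightarrow> 1" by real_asymp
    show "?hi \<longlonglongrightarrow> 1" by real_asymp
  qed
qed

text \<open>The quotient is computed exactly as sqrt pi times \<open>U d\<close> over
  \<open>a (Suc d)\<close>. Here \<open>a\<close> tends to sqrt pi by Laplace's method, and
  \<open>U\<close> collects what remains of powers and exponentials.\<close>

lemma leading_term_asymp:
  "leading_term \<sim>[sequentially] (\<lambda>d. 2 * (exp (real d) /
    (2 * real (d + 2) powr (real d - 2) * (2 * pi) ^ (d + 1))) powr (1 / 2))"
proof (rule asymp_equivI')
  define T where "T d = 2 * (exp (real d) / (2 * real (d + 2) powr (real d - 2) * (2 * pi) ^ (d + 1))) powr (1 / 2)" for d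
  define a where "a m = half_moment m / (sqrt (real m) ^ m * exp (- real m / 2))" for m
  \<comment> \<open>Laplace's method at order d + 1 yields a power of d + 1, the claim has a power
    of d + 2. Their ratio (1 + 1 / (d + 1))^((d + 1) / 2) tends to exp (1 / 2), which the last
    factor cancels.\<close>
  define U where "U d = ((real d + 2) powr ((real d + 1) / 2) / (real d + 1) powr ((real d + 1) / 2)) * exp (- 1 / 2)" for d :: nat
  have "leading_term d / T d = sqrt pi * U d / a (Suc d)" for d
  proof -
    define x m where "x = real d + 2" and "m = real d + 1"
    have x: "x > 0" and m: "m > 0" by (simp_all add: x_def m_def)
    \<comment> \<open>The quotient is rewritten with the moment of order d + 1 in the denominator,
      which removes the factorial.\<close>
    have hm: "half_moment d / fact d = sqrt (pi / 2) / half_moment (Suc d)"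
      using half_moment_mult_Suc[of d] half_moment_pos[of "Suc d"] by (simp add: field_simps)
    have sm: "sqrt m ^ (d + 1) = m powr (m / 2)"
    proof -
      have "sqrt m ^ (d + 1) = sqrt m powr m" using m by (simp only: m_def powr_realpow[symmetric] real_sqrt_gt_0_iff) (simp add: add.commute)
      also have "\<dots> = m powr (m / 2)" using m by (simp add: powr_half_sqrt[symmetric] powr_powr)
      finally show ?thesis .
    qed
    have a: "half_moment (Suc d) = a (Suc d) * (m powr (m / 2) * exp (- m / 2))"
      unfolding a_def using m sm by (simp add: m_def add.commute)
    have T: "T d = 2 * (exp (real d / 2) / (sqrt 2 * x powr ((real d - 2) / 2) * sqrt (2 * pi) ^ (d + 1)))"
    proof -
      have "sqrt (exp (real d)) = exp (real d / 2)"
        by (rule real_sqrt_unique) (simp_all add: power2_eq_square exp_add[symmetric])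
      moreover have "sqrt (x powr (real d - 2)) = x powr ((real d - 2) / 2)"
        using x by (simp add: powr_half_sqrt[symmetric] powr_powr)
      moreover have "sqrt ((2 * pi) ^ (d + 1)) = sqrt (2 * pi) ^ (d + 1)"
        by (rule real_sqrt_power)
      moreover have "T d = 2 * sqrt (exp (real d) / (2 * x powr (real d - 2) * (2 * pi) ^ (d + 1)))"
      proof -
        have "real (d + 2) = x" by (simp add: x_def)
        then show ?thesis unfolding T_def by (subst powr_half_sqrt) simp_all
      qed
      moreover have "sqrt (u / (2 * v * w)) = sqrt u / (sqrt 2 * sqrt v * sqrt w)" for u v w
        by (simp only: real_sqrt_divide real_sqrt_mult)
      ultimately show ?thesis by metis
    qed
    \<comment> \<open>The exponents add up to 1 + 1/2 + (d - 2) / 2 = (d + 1) / 2; this accounts for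
      the exponent d - 2 in the claim.\<close>
    have xp: "x * sqrt x * x powr ((real d - 2) / 2) = x powr (m / 2)"
    proof -
      have "x * sqrt x * x powr ((real d - 2) / 2) = x powr 1 * x powr (1 / 2) * x powr ((real d - 2) / 2)"
        using x by (simp add: powr_half_sqrt)
      also have "\<dots> = x powr (1 + 1 / 2 + (real d - 2) / 2)" by (simp only: powr_add)
      also have "1 + 1 / 2 + (real d - 2) / 2 = m / 2" by (simp add: m_def field_simps)
      finally show ?thesis .
    qed
    \<comment> \<open>The first factor cancels the exponential of the Laplace asymptotics, the
      second the square root of exp d in the claim, and the third goes into
      \<open>U\<close>.\<close>
    have ex: "exp (- 1) = exp (- m / 2) * exp (real d / 2) * exp (- 1 / 2)"
      unfolding exp_add[symmetric] by (simp add: m_def field_simps)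
    have sp: "sqrt (pi / 2) = sqrt pi / sqrt 2" by (rule real_sqrt_divide)
    let ?s = "sqrt (2 * pi) ^ (d + 1)"
    have "leading_term d = 2 * (x * sqrt x) * (1 / ?s) * ((sqrt pi / sqrt 2) / (a (Suc d) * (m powr (m / 2) * exp (- m / 2)))) * exp (- 1)"
      unfolding leading_term_def hm a sp x_def by (simp add: power_one_over)
    then have "leading_term d / T d =
      (2 * (x * sqrt x) * (1 / ?s) * ((sqrt pi / sqrt 2) / (a (Suc d) * (m powr (m / 2) * exp (- m / 2)))) *
       (exp (- m / 2) * exp (real d / 2) * exp (- 1 / 2))) /
      (2 * (exp (real d / 2) / (sqrt 2 * x powr ((real d - 2) / 2) * ?s)))"
      by (simp only: T ex[symmetric])
    also have "\<dots> = sqrt pi * ((x * sqrt x * x powr ((real d - 2) / 2)) / m powr (m / 2) * exp (- 1 / 2)) / a (Suc d)"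
    proof -
      have alg: "(2 * X * (1 / s) * ((p / q) / (A * (M * E))) * (E * D * H)) / (2 * (D / (q * Y * s))) = p * ((X * Y) / M * H) / A"
        if "s \<noteq> 0" "q \<noteq> 0" "E \<noteq> 0" "D \<noteq> 0" "Y \<noteq> 0" "A \<noteq> 0" "M \<noteq> 0" for X s p q A M E D H Y :: real
        using that by (simp add: field_simps)
      have "a (Suc d) \<noteq> 0"
        using half_moment_pos[of "Suc d"] by (simp add: a_def)
      then show ?thesis using x m by (intro alg) simp_all
    qed
    finally show ?thesis unfolding xp unfolding U_def x_def m_def .
  qed
  moreover have "(\<lambda>d. sqrt pi * U d / a (Suc d)) \<longlonglongrightarrow> sqrt pi * 1 / sqrt pi"
  proof (intro tendsto_divide tendsto_mult tendsto_const)
    show "U \<longlonglongrightarrow> 1" unfolding U_def by real_asymp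
    show "(\<lambda>d. a (Suc d)) \<longlonglongrightarrow> sqrt pi"
      using half_moment_asymp unfolding a_def[symmetric] by (rule LIMSEQ_Suc)
  qed simp
  ultimately show "(\<lambda>d. leading_term d / (2 * (exp (real d) /
    (2 * real (d + 2) powr (real d - 2) * (2 * pi) ^ (d + 1))) powr (1 / 2))) \<longlonglongrightarrow> 1"
    unfolding T_def[symmetric] by simp
qed

theorem corollary6:
  shows "(\<forall>d. \<P>(p in gaussian_points d. radon_size d p \<noteq> 1)
              = \<P>(p in gaussian_points d. convex_position {..<d + 2} p))
    \<and> (\<lambda>d. 1 - \<P>(p in gaussian_points d. radon_size d p \<noteq> 1))
        \<sim>[sequentially]
      (\<lambda>d. 2 * (exp (real d) /
                  (2 * real (d + 2) powr (real d - 2) * (2 * pi) ^ (d + 1))) powr (1 / 2))"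
  unfolding prob_radon_size_eq_prob_convex_position
  using asymp_equiv_trans[OF prob_not_convex_position_asymp leading_term_asymp] by blast

end
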